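(* Let $S^2$ be the two-sphere with its standard area form and let $\mathcal{G}$ be the identity component of the group of area-preserving diffeomorphisms of $S^2$. For each equator $L\subset S^2$ there is a functional $\Phi:\mathcal{G}\to\mathbb{R}$ and constants $A,B,C,D$, depending only on $L$ and the geometry of $S^2$, such that: (1) $|\Phi(gf)-\Phi(f)-\Phi(g)|\leq C+D\,|g|_1$ for all $f,g\in\mathcal{G}$; (2) $\overline{\Phi}(f)=\liminf_{k\to\infty}\Phi(f^k)/k$ is well-defined (as a real number) for every $f\in\mathcal{G}$, and $\overline{\Phi}$ is not identically zero on $\mathcal{G}$; (3) $|\Phi(h)|\leq B$ for all $h\in\mathcal{G}$ such that $h(L)=L$, and in particular $\overline{\Phi}(h)=0$ for all such $h$; (4) $|\Phi(f)|\leq A(|f|_1+1)$ for all $f\in\mathcal{G}$.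
   Context: An equator is a smooth embedded loop in $S^2$ whose complement consists of two components of equal area. Let $\omega$ be the standard area form on $S^2$ and fix an auxiliary Riemannian metric on $S^2$. For a smooth isotopy $\{\phi_t\}_{t\in[0,1]}$ in $\mathcal{G}$ with $\phi_0=\mathrm{id}$, generated by the time-dependent vector field $X_t$, its $L^1$-length is $$\ell_1(\{\phi_t\})=\int_0^1\int_{S^2}|X_t|\,\omega\,dt,$$ where $|X_t|$ is the pointwise Riemannian norm. The $L^1$-norm of $\phi\in\mathcal{G}$ is $|\phi|_1=\inf \ell_1(\{\phi_t\})$, the infimum being over all isotopies in $\mathcal{G}$ with $\phi_0=\mathrm{id}$ and $\phi_1=\phi$. The product $gf$ denotes the composition $g\circ f$, and $f^k$ is the $k$-th iterate of $f$. *)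

theory Defs
  imports "HOL-Analysis.Analysis"
begin

primrec iter_deriv ::
  "'a list \<Rightarrow> ('a::real_normed_vector \<Rightarrow> 'b::real_normed_vector) \<Rightarrow> 'a \<Rightarrow> 'b" where
  "iter_deriv [] f = f"
| "iter_deriv (v # vs) f = (\<lambda>x. frechet_derivative (iter_deriv vs f) (at x) v)"

definition smooth_on_open ::
  "'a::euclidean_space set \<Rightarrow> ('a \<Rightarrow> 'b::euclidean_space) \<Rightarrow> bool" where
  "smooth_on_open U f \<longleftrightarrow> open U \<and> (\<forall>vs. \<forall>x\<in>U. iter_deriv vs f differentiable (at x))"

text \<open>Smoothness on an arbitrary subset means that the map extends, locally around every point of
  the subset, to a smooth map on an open set. For \<open>sphere 0 1\<close> and \<open>{0..1} \<times> sphere 0 1\<close> this is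
  smoothness in the sense of manifolds (with boundary).\<close>

definition smooth_on ::
  "'a::euclidean_space set \<Rightarrow> ('a \<Rightarrow> 'b::euclidean_space) \<Rightarrow> bool" where
  "smooth_on S f \<longleftrightarrow>
     (\<forall>x\<in>S. \<exists>U F. x \<in> U \<and> smooth_on_open U F \<and> (\<forall>y \<in> U \<inter> S. F y = f y))"

abbreviation S2 :: "(real^3) set" where
  "S2 \<equiv> sphere 0 1"

definition tangent :: "real^3 \<Rightarrow> (real^3) set" where
  "tangent x = {v. x \<bullet> v = 0}"

text \<open>The standard area form, for \<open>x \<in> S2\<close> and \<open>u, v \<in> tangent x\<close>: the determinant
  of the matrix with columns \<open>x, u, v\<close>.\<close>

definition area_form :: "real^3 \<Rightarrow> real^3 \<Rightarrow> real^3 \<Rightarrow> real" where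
  "area_form x u v = x \<bullet> cross3 u v"

text \<open>Integration against the area form, computed in spherical coordinates \<open>p (\<theta>, \<phi>)\<close>. These
  parametrize the sphere up to a null set, and there
  \<open>area_form p (\<partial>p / \<partial>\<theta>) (\<partial>p / \<partial>\<phi>) = sin \<theta>\<close>.\<close>

definition spherical_coords :: "real \<times> real \<Rightarrow> real^3" where
  "spherical_coords = (\<lambda>(\<theta>, \<phi>). vector [sin \<theta> * cos \<phi>, sin \<theta> * sin \<phi>, cos \<theta>])"

definition sphere_area :: "(real^3) measure" where
  "sphere_area =
     distr
       (density lborel
         (\<lambda>(\<theta>, \<phi>). ennreal (indicator ({0..pi} \<times> {0..2 * pi}) (\<theta>, \<phi>) * sin \<theta>)))
       borel spherical_coords"

text \<open>A self-map of the sphere is an element of \<open>S2 \<rightarrow>\<^sub>E S2\<close>, so that maps agreeing on \<open>S2\<close> are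
  equal as functions; the group product \<open>g f\<close> is \<open>compose S2 g f\<close> and the iterate \<open>f\<^sup>k\<close> is
  \<open>restrict (f ^^ k) S2\<close>. A map that is smooth on \<open>S2\<close> has a smooth radial extension away from
  the origin, whose derivative at \<open>x \<in> S2\<close> restricts to the intrinsic differential on \<open>tangent x\<close>.\<close>

definition radial_ext :: "(real^3 \<Rightarrow> real^3) \<Rightarrow> real^3 \<Rightarrow> real^3" where
  "radial_ext f = (\<lambda>x. f (x /\<^sub>R norm x))"

definition sphere_deriv :: "(real^3 \<Rightarrow> real^3) \<Rightarrow> real^3 \<Rightarrow> real^3 \<Rightarrow> real^3" where
  "sphere_deriv f x = frechet_derivative (radial_ext f) (at x)"

definition sphere_diffeo :: "(real^3 \<Rightarrow> real^3) \<Rightarrow> bool" where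
  "sphere_diffeo f \<longleftrightarrow>
     f \<in> S2 \<rightarrow>\<^sub>E S2 \<and> bij_betw f S2 S2 \<and> smooth_on S2 f \<and> smooth_on S2 (inv_into S2 f)"

definition area_preserving :: "(real^3 \<Rightarrow> real^3) \<Rightarrow> bool" where
  "area_preserving f \<longleftrightarrow>
     (\<forall>x\<in>S2. \<forall>u\<in>tangent x. \<forall>v\<in>tangent x.
        area_form (f x) (sphere_deriv f x u) (sphere_deriv f x v) = area_form x u v)"

definition area_diffeos :: "(real^3 \<Rightarrow> real^3) set" where
  "area_diffeos = {f. sphere_diffeo f \<and> area_preserving f}"

text \<open>The \<open>C\<^sup>\<infinity>\<close> topology: uniform closeness on \<open>S2\<close> of all partial derivatives, up to some order,
  of the radial extensions.\<close>

definition Cinf_nhd ::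
  "(real^3 \<Rightarrow> real^3) \<Rightarrow> nat \<Rightarrow> real \<Rightarrow> (real^3 \<Rightarrow> real^3) set" where
  "Cinf_nhd f n \<epsilon> = {g \<in> area_diffeos. \<forall>vs \<in> lists Basis. length vs \<le> n \<longrightarrow>
     (\<forall>x\<in>S2. norm (iter_deriv vs (radial_ext g) x - iter_deriv vs (radial_ext f) x) < \<epsilon>)}"

definition Cinf_topology :: "(real^3 \<Rightarrow> real^3) topology" where
  "Cinf_topology =
     topology_generated_by {Cinf_nhd f n \<epsilon> | f n \<epsilon>. f \<in> area_diffeos \<and> 0 < \<epsilon>}"

text \<open>The connected component of the identity in the group of area-preserving diffeomorphisms.\<close>

definition area_diffeos0 :: "(real^3 \<Rightarrow> real^3) set" where
  "area_diffeos0 = connected_component_of_set Cinf_topology (restrict id S2)"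

definition smooth_vector_field :: "(real^3 \<Rightarrow> real^3) \<Rightarrow> bool" where
  "smooth_vector_field V \<longleftrightarrow> smooth_on S2 V \<and> (\<forall>x\<in>S2. V x \<in> tangent x)"

definition riemannian_metric :: "(real^3 \<Rightarrow> real^3 \<Rightarrow> real^3 \<Rightarrow> real) \<Rightarrow> bool" where
  "riemannian_metric \<rho> \<longleftrightarrow>
     (\<forall>x\<in>S2. \<forall>u\<in>tangent x. \<forall>v\<in>tangent x. \<rho> x u v = \<rho> x v u) \<and>
     (\<forall>x\<in>S2. \<forall>u\<in>tangent x. \<forall>v\<in>tangent x. \<forall>w\<in>tangent x. \<forall>a b.
        \<rho> x (a *\<^sub>R u + b *\<^sub>R v) w = a * \<rho> x u w + b * \<rho> x v w) \<and>
     (\<forall>x\<in>S2. \<forall>u\<in>tangent x. u \<noteq> 0 \<longrightarrow> 0 < \<rho> x u u) \<and>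
     (\<forall>U V. smooth_vector_field U \<longrightarrow> smooth_vector_field V \<longrightarrow>
        smooth_on S2 (\<lambda>x. \<rho> x (U x) (V x)))"

definition isotopy_from_id :: "(real \<Rightarrow> real^3 \<Rightarrow> real^3) \<Rightarrow> bool" where
  "isotopy_from_id \<phi> \<longleftrightarrow>
     smooth_on ({0..1} \<times> S2) (\<lambda>(t, x). \<phi> t x) \<and>
     (\<forall>t\<in>{0..1}. \<phi> t \<in> area_diffeos0) \<and> \<phi> 0 = restrict id S2"

text \<open>The vector field generating an isotopy: \<open>d/dt \<phi>\<^sub>t (x) = X\<^sub>t (\<phi>\<^sub>t (x))\<close>.\<close>

definition generating_field :: "(real \<Rightarrow> real^3 \<Rightarrow> real^3) \<Rightarrow> real \<Rightarrow> real^3 \<Rightarrow> real^3" where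
  "generating_field \<phi> t y =
     vector_derivative (\<lambda>s. \<phi> s (inv_into S2 (\<phi> t) y)) (at t within {0..1})"

definition L1_length ::
  "(real^3 \<Rightarrow> real^3 \<Rightarrow> real^3 \<Rightarrow> real) \<Rightarrow> (real \<Rightarrow> real^3 \<Rightarrow> real^3) \<Rightarrow> real" where
  "L1_length \<rho> \<phi> =
     (LINT t:{0..1}|lborel. LINT y:S2|sphere_area.
        sqrt (\<rho> y (generating_field \<phi> t y) (generating_field \<phi> t y)))"

text \<open>An infimum in the extended reals, so that the infimum over no isotopies would be \<open>\<infinity>\<close>.\<close>

definition L1_norm ::
  "(real^3 \<Rightarrow> real^3 \<Rightarrow> real^3 \<Rightarrow> real) \<Rightarrow> (real^3 \<Rightarrow> real^3) \<Rightarrow> ereal" where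
  "L1_norm \<rho> f = (INF \<phi> \<in> {\<phi>. isotopy_from_id \<phi> \<and> \<phi> 1 = f}. ereal (L1_length \<rho> \<phi>))"

definition smooth_embedded_loop :: "(real^3) set \<Rightarrow> bool" where
  "smooth_embedded_loop L \<longleftrightarrow>
     (\<exists>\<gamma> :: real \<Rightarrow> real^3. smooth_on UNIV \<gamma> \<and> (\<forall>t. \<gamma> (t + 1) = \<gamma> t) \<and>
        inj_on \<gamma> {0..<1} \<and> (\<forall>t. vector_derivative \<gamma> (at t) \<noteq> 0) \<and> range \<gamma> = L)"

definition equator :: "(real^3) set \<Rightarrow> bool" where
  "equator L \<longleftrightarrow> L \<subseteq> S2 \<and> smooth_embedded_loop L \<and>
     (\<exists>U V. components (S2 - L) = {U, V} \<and> U \<noteq> V \<and>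
        measure sphere_area U = measure sphere_area V)"

definition liminf_mean :: "((real^3 \<Rightarrow> real^3) \<Rightarrow> real) \<Rightarrow> (real^3 \<Rightarrow> real^3) \<Rightarrow> ereal" where
  "liminf_mean \<Phi> f = liminf (\<lambda>k. ereal (\<Phi> (restrict (f ^^ k) S2) / real k))"

end

theory Submission
  imports Defs "HOL-Complex_Analysis.Complex_Analysis"
begin

text \<open>Let \<open>U\<close>, \<open>V\<close> be the two discs of \<open>S2 - L\<close>. To four points \<open>x1, x2, x3, x4\<close> of the sphere attach the
  cyclic product \<open>K\<close> of the hermitian projections onto the lines \<open>- x1, x3, - x2, x4\<close> of \<open>CP\<^sup>1\<close>; it vanishes only if
  one of \<open>x1, x2\<close> collides with one of \<open>x3, x4\<close>. Hence, for a homeomorphism \<open>f\<close>, the phase of \<open>K\<close> along \<open>f\<close> lifts to a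
  real function \<open>W f\<close> on the simply connected space \<open>(U \<times> U) \<times> (V \<times> V)\<close>, normalised to vanish for \<open>x1 = x2\<close>,
  where \<open>K\<close> is positive.
  Along an isotopy the phase of \<open>K\<close> moves with speed at most a sum of terms \<open>|X (xi)| / (|xi - xj| |xi - xk|)\<close>,
  which is integrable over quadruples; so the \<open>L\<^sup>1\<close>-distance of \<open>W (\<phi> u)\<close> and \<open>W u\<close> is at most a multiple of the length
  of an isotopy from the identity to \<open>\<phi>\<close>. The functional \<open>\<Phi> f\<close> is the \<open>L\<^sup>1\<close>-distance of \<open>W f\<close> to the set of all
  \<open>W h\<close> with \<open>h L = L\<close>. All these \<open>W h\<close> are equimeasurable, as \<open>h\<close> permutes the discs, whereas a twist, rotating the
  circles of latitude \<open>s\<close> by the angle \<open>k s\<close>, makes \<open>W\<close> grow linearly in \<open>k\<close> on an open set of quadruples.\<close>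

text \<open>A cyclic product of projections does not see the phases of vectors spanning the lines,
  so \<open>K\<close> is polynomial in the four points; the antipodes on \<open>x1, x2\<close> make
  two lines orthogonal exactly when the points collide. Each point is tied to both points of the
  other pair, so its derivative term carries two reciprocal distances with a common endpoint, and
  with that endpoint fixed the integral splits into two finite ones. The bound for
  \<open>W (\<phi> u) - W u\<close> is uniform in \<open>u\<close> because \<open>u\<close>
  preserves area; the triangle inequality turns it into (1) and (4). The distance to all
  \<open>W h\<close>, not just to \<open>W\<close> of the identity, vanishes on the stabiliser even
  though \<open>W\<close> is not known to be integrable. Obstacle: an element of the identity
  component is not known here to end a smooth isotopy, so the distance might be infinite. The
  predicate \<open>good\<close> singles out maps displacing \<open>W\<close> by a uniformly bounded
  amount; other maps get the value 0. Maps of finite norm are good, and goodness cancels in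
  compositions, so the estimates survive this convention.\<close>

no_notation fps_nth (infixl "$" 75)

section \<open>Area of the sphere and area-preserving homeomorphisms\<close>

lemma measurable_vector_3 [measurable (raw)]:
  fixes f g h :: "'a \<Rightarrow> real"
  assumes "f \<in> borel_measurable M" "g \<in> borel_measurable M" "h \<in> borel_measurable M"
  shows "(\<lambda>x. vector [f x, g x, h x] :: real^3) \<in> borel_measurable M"
proof -
  have eq: "(\<lambda>x. vector [f x, g x, h x] :: real^3)
      = (\<lambda>x. f x *\<^sub>R axis 1 1 + g x *\<^sub>R axis 2 1 + h x *\<^sub>R axis 3 1)"
    by (auto simp: vec_eq_iff forall_3 axis_def)
  show ?thesis unfolding eq using assms by measurable
qed

lemma measurable_spherical_coords [measurable]: "spherical_coords \<in> borel_measurable borel"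
  unfolding spherical_coords_def borel_prod[symmetric] by measurable

text \<open>Both measures give boxes the same volume. Through this identification Fubini can split
  the radial integral from the angular ones.\<close>

lemma distr_vector_3:
  "distr (lborel :: (real \<times> real \<times> real) measure) borel
     (\<lambda>p. vector [fst p, fst (snd p), snd (snd p)] :: real^3) = lborel"
proof (rule lborel_eqI[symmetric])
  let ?T = "\<lambda>p::real\<times>real\<times>real. vector [fst p, fst (snd p), snd (snd p)] :: real^3"
  fix l u :: "real^3"
  assume le: "\<And>b. b \<in> Basis \<Longrightarrow> l \<bullet> b \<le> u \<bullet> b"
  have le': "l $ i \<le> u $ i" for i
    using le[of "axis i 1"] by (simp add: inner_axis)
  have m [measurable]: "?T \<in> borel_measurable (lborel :: (real\<times>real\<times>real) measure)"
    unfolding measurable_lborel2 borel_prod[symmetric] by measurable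
  have "?T -` box l u = box (l$1, l$2, l$3) (u$1, u$2, u$3)"
    by (auto simp: mem_box Basis_prod_def forall_3 Basis_vec_def inner_axis)
  then have "emeasure (distr lborel borel ?T) (box l u) =
      emeasure lborel (box (l$1, l$2, l$3) (u$1, u$2, u$3))"
    by (subst emeasure_distr) auto
  also have "\<dots> = (\<Prod>b\<in>Basis. ((u$1, u$2, u$3) - (l$1, l$2, l$3)) \<bullet> b)"
    by (rule emeasure_lborel_box) (use le' in \<open>auto simp: Basis_prod_def\<close>)
  also have "\<dots> = (\<Prod>b\<in>(Basis :: (real\<times>real\<times>real) set). ((u$1 - l$1, u$2 - l$2, u$3 - l$3)) \<bullet> b)"
    by simp
  also have "\<dots> = (u$1 - l$1) * (u$2 - l$2) * (u$3 - l$3)"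
    by (simp add: Basis_prod_def prod.union_disjoint mult_ac)
  also have "\<dots> = (\<Prod>b\<in>Basis. (u - l) \<bullet> b)"
  proof -
    have "(\<Prod>b\<in>Basis. (u - l) \<bullet> b) = (\<Prod>i\<in>(UNIV::3 set). (u - l) $ i)"
      by (simp add: Basis_vec_def UNION_singleton_eq_range prod.reindex inj_on_def axis_eq_axis inner_axis)
    also have "\<dots> = (u$1 - l$1) * (u$2 - l$2) * (u$3 - l$3)"
      unfolding UNIV_3 by (simp add: mult.assoc)
    finally show ?thesis by (simp only:)
  qed
  finally show "emeasure (distr lborel borel ?T) (box l u) = (\<Prod>b\<in>Basis. (u - l) \<bullet> b)" .
qed simp

text \<open>The solid cone over \<open>A\<close> in the open unit ball, apex removed. Its volume is
  a third of the area of \<open>A\<close>, which moves questions about area to Lebesgue measure,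
  where the change of variables with determinants is available.\<close>

definition unit_cone :: "(real^3) set \<Rightarrow> (real^3) set" where
  "unit_cone A = {y. y \<noteq> 0 \<and> norm y < 1 \<and> y /\<^sub>R norm y \<in> A}"

lemma unit_cone_borel [measurable]: "A \<in> sets borel \<Longrightarrow> unit_cone A \<in> sets borel"
proof -
  assume [measurable]: "A \<in> sets borel"
  have "unit_cone A = {y \<in> space borel. y \<noteq> 0 \<and> norm y < 1 \<and> y /\<^sub>R norm y \<in> A}"
    by (auto simp: unit_cone_def)
  also have "\<dots> \<in> sets borel" by measurable
  finally show ?thesis .
qed

text \<open>The excluded plane contains the axis, where \<open>\<phi>\<close> is undetermined, and
  is a null set; off it \<open>sin \<theta>\<close> is positive.\<close>

lemma spherical_coords_exists:
  fixes y :: "real^3"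
  assumes "y $ 2 \<noteq> 0"
  obtains \<theta> \<phi> where "0 < \<theta>" "\<theta> < pi" "0 \<le> \<phi>" "\<phi> < 2 * pi"
    "y = norm y *\<^sub>R spherical_coords (\<theta>, \<phi>)"
proof -
  define \<rho> where "\<rho> = sqrt ((y$1)\<^sup>2 + (y$2)\<^sup>2)"
  have "0 < (y$2)\<^sup>2" using assms by simp
  then have rho: "\<rho> > 0" "\<rho>\<^sup>2 = (y$1)\<^sup>2 + (y$2)\<^sup>2"
    unfolding \<rho>_def by (simp_all add: add_nonneg_pos)
  have n2: "(norm y)\<^sup>2 = \<rho>\<^sup>2 + (y$3)\<^sup>2"
    unfolding rho by (simp add: norm_vec_def L2_set_def sum_3)
  have np: "norm y > 0" using assms by auto
  have "(y$3 / norm y)\<^sup>2 + (\<rho> / norm y)\<^sup>2 = (\<rho>\<^sup>2 + (y$3)\<^sup>2) / (norm y)\<^sup>2"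
    by (simp add: power_divide add_divide_distrib)
  then have "(y$3 / norm y)\<^sup>2 + (\<rho> / norm y)\<^sup>2 = 1"
    using np by (simp flip: n2)
  then obtain \<theta> where th: "0 \<le> \<theta>" "\<theta> \<le> pi" "y$3 / norm y = cos \<theta>" "\<rho> / norm y = sin \<theta>"
    using rho np sincos_total_pi[of "\<rho> / norm y" "y$3 / norm y"] by auto
  have "(y$1 / \<rho>)\<^sup>2 + (y$2 / \<rho>)\<^sup>2 = ((y$1)\<^sup>2 + (y$2)\<^sup>2) / \<rho>\<^sup>2"
    by (simp add: power_divide add_divide_distrib)
  then have "(y$1 / \<rho>)\<^sup>2 + (y$2 / \<rho>)\<^sup>2 = 1"
    using rho(1) by (simp flip: rho(2))
  then obtain \<phi> where ph: "0 \<le> \<phi>" "\<phi> < 2 * pi" "y$1 / \<rho> = cos \<phi>" "y$2 / \<rho> = sin \<phi>"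
    using sincos_total_2pi[of "y$1 / \<rho>" "y$2 / \<rho>"] by auto
  have "sin \<theta> > 0" using th rho np by (metis divide_pos_pos)
  then have "\<theta> \<noteq> 0" "\<theta> \<noteq> pi" by auto
  show thesis
  proof (rule that[of \<theta> \<phi>])
    show "y = norm y *\<^sub>R spherical_coords (\<theta>, \<phi>)"
      using rho np
      by (simp add: vec_eq_iff forall_3 spherical_coords_def th(3,4)[symmetric] ph(3,4)[symmetric])
  qed (use th ph \<open>\<theta> \<noteq> 0\<close> \<open>\<theta> \<noteq> pi\<close> in auto)
qed

lemma norm_spherical_coords [simp]: "norm (spherical_coords p) = 1"
proof -
  obtain \<theta> \<phi> where p: "p = (\<theta>, \<phi>)" by force
  have "(norm (spherical_coords p))\<^sup>2 = (sin \<theta> * cos \<phi>)\<^sup>2 + (sin \<theta> * sin \<phi>)\<^sup>2 + (cos \<theta>)\<^sup>2"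
    unfolding p by (simp add: norm_vec_def L2_set_def sum_3 spherical_coords_def)
  also have "\<dots> = (sin \<theta>)\<^sup>2 * ((cos \<phi>)\<^sup>2 + (sin \<phi>)\<^sup>2) + (cos \<theta>)\<^sup>2"
    by (simp only: power_mult_distrib distrib_left)
  also have "\<dots> = 1" by simp
  finally have "(norm (spherical_coords p))\<^sup>2 = 1\<^sup>2" by simp
  then show ?thesis by (rule power2_eq_imp_eq) auto
qed

lemma cos_sin_inj_2pi:
  assumes "0 \<le> s" "s < 2*pi" "0 \<le> t" "t < 2*pi" "cos s = cos t" "sin s = sin t"
  shows "s = t"
proof -
  obtain n :: int where n: "s = t + 2 * pi * n"
    using sin_cos_eq_iff[of s t] assms(5,6) by (auto simp: ac_simps)
  have "\<bar>2 * pi * n\<bar> < 2 * pi * 1" using n assms(1-4) by linarith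
  then have "\<bar>real_of_int n\<bar> < 1" by (simp add: abs_mult)
  then show ?thesis using n by simp
qed

lemma matrix_of_columns_det:
  fixes F :: "real^3 \<Rightarrow> real^3"
  shows "det (matrix F) = F (axis 1 1) \<bullet> cross3 (F (axis 2 1)) (F (axis 3 1))"
  by (simp add: det_3 cross3_def inner_vec_def sum_3 matrix_def algebra_simps)

lemma spherical_map_derivative:
  fixes x :: "real^3"
  defines "D \<equiv> \<lambda>h::real^3. h$1 *\<^sub>R spherical_coords (x$2, x$3) +
     x$1 *\<^sub>R (h$2 *\<^sub>R vector [cos (x$2) * cos (x$3), cos (x$2) * sin (x$3), - sin (x$2)]
             + h$3 *\<^sub>R vector [- sin (x$2) * sin (x$3), sin (x$2) * cos (x$3), 0])"
  shows "((\<lambda>x::real^3. x$1 *\<^sub>R spherical_coords (x$2, x$3)) has_derivative D) (at x within S)"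
    and "det (matrix D) = (x$1)\<^sup>2 * sin (x$2)"
proof -
  let ?F = "\<lambda>x::real^3. x$1 *\<^sub>R spherical_coords (x$2, x$3)"
  have nth: "((\<lambda>x::real^3. x$i) has_derivative (\<lambda>h. h$i)) (at x within S)" for i
    using bounded_linear_imp_has_derivative bounded_linear_vec_nth by blast
  show "(?F has_derivative D) (at x within S)"
  proof (subst has_derivative_componentwise_within, intro ballI)
    fix b :: "real^3" assume "b \<in> Basis"
    then obtain i where b: "b = axis i 1" by (auto simp: Basis_vec_def)
    have "i = 1 \<or> i = 2 \<or> i = 3" using exhaust_3 by blast
    then show "((\<lambda>x. ?F x \<bullet> b) has_derivative (\<lambda>h. D h \<bullet> b)) (at x within S)"
      unfolding b D_def
      by (elim disjE; simp add: inner_axis spherical_coords_def;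
          auto intro!: derivative_eq_intros nth simp: algebra_simps)
  qed
  have c: "(cos t)\<^sup>2 = 1 - (sin t)\<^sup>2" for t :: real using sin_cos_squared_add[of t] by linarith
  show "det (matrix D) = (x$1)\<^sup>2 * sin (x$2)"
    unfolding matrix_of_columns_det D_def
    apply (simp add: axis_def cross3_def spherical_coords_def inner_vec_def sum_3)
    using c[of "x$2"] c[of "x$3"] by algebra
qed

lemma emeasure_sphere_area:
  assumes [measurable]: "A \<in> sets borel"
  shows "emeasure sphere_area A =
    (\<integral>\<^sup>+p. indicator ({0..pi} \<times> {0..2 * pi}) p * ennreal (sin (fst p)) * indicator A (spherical_coords p) \<partial>lborel)"
proof -
  have eq: "(\<lambda>(\<theta>, \<phi>). ennreal (indicator ({0..pi} \<times> {0..2 * pi}) (\<theta>, \<phi>) * sin \<theta>))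
      = (\<lambda>p. indicator ({0..pi} \<times> {0..2 * pi}) p * ennreal (sin (fst p)))"
    by (auto simp: fun_eq_iff indicator_def)
  have m1: "(\<lambda>p::real\<times>real. sin (fst p)) \<in> borel_measurable borel"
    by (intro borel_measurable_continuous_onI continuous_intros)
  have m2: "{0..pi} \<times> {0..2 * pi} \<in> sets (borel :: (real\<times>real) measure)"
    by (intro borel_closed closed_Times) auto
  have m3: "spherical_coords -` A \<in> sets borel"
    using measurable_sets[OF measurable_spherical_coords assms] by simp
  note [measurable] = m1 m2 m3
  show ?thesis
    unfolding sphere_area_def eq
    by (subst emeasure_distr, simp, simp, subst emeasure_density)
       (auto intro!: nn_integral_cong simp: indicator_def)
qed

text \<open>The parametrisation by radius and two angles has Jacobian
  \<open>r\<^sup>2 * sin \<theta>\<close>; the radial part integrates to 1/3 over the unit interval,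
  and the angular part is the area.\<close>

lemma emeasure_sphere_area_eq_unit_cone:
  assumes A [measurable]: "A \<in> sets borel"
  shows "emeasure sphere_area A = 3 * emeasure lborel (unit_cone A)"
proof -
  let ?F = "\<lambda>x::real^3. x$1 *\<^sub>R spherical_coords (x$2, x$3)"
  define D where "D = (\<lambda>(x::real^3) (h::real^3). h$1 *\<^sub>R spherical_coords (x$2, x$3) +
     x$1 *\<^sub>R (h$2 *\<^sub>R vector [cos (x$2) * cos (x$3), cos (x$2) * sin (x$3), - sin (x$2)]
             + h$3 *\<^sub>R vector [- sin (x$2) * sin (x$3), sin (x$2) * cos (x$3), 0]) :: real^3)"
  have detD: "det (matrix (D x)) = (x$1)\<^sup>2 * sin (x$2)" for x
    unfolding D_def by (rule spherical_map_derivative(2))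
  have derD: "(?F has_derivative D x) (at x within X)" for x X
    unfolding D_def by (rule spherical_map_derivative(1))
  \<comment> \<open>A half-open range for \<open>\<phi>\<close> and an open one for
    \<open>\<theta>\<close> make the parametrisation injective; the discarded angles do not change
    the integral.\<close>
  define R where "R = {0<..<pi} \<times> {0..<2*pi}"
  define g where "g = (\<lambda>p. indicator R p * ennreal (sin (fst p)) * indicator A (spherical_coords p))"
  have m1 [measurable]: "(\<lambda>p::real\<times>real. sin (fst p)) \<in> borel_measurable borel"
    by (intro borel_measurable_continuous_onI continuous_intros)
  have R [measurable]: "R \<in> sets borel"
    unfolding R_def borel_prod[symmetric] by measurable
  have g [measurable]: "g \<in> borel_measurable borel"
    unfolding g_def by measurable
  define S where "S = {x::real^3. 0 < x$1 \<and> x$1 < 1 \<and> (x$2, x$3) \<in> R \<and> spherical_coords (x$2, x$3) \<in> A}"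
  have pm [measurable]: "(\<lambda>x::real^3. (x$2, x$3)) \<in> borel_measurable borel"
    by (intro borel_measurable_continuous_onI continuous_intros)
  have S: "S \<in> sets borel"
  proof -
    have "S = {x \<in> space borel. 0 < x$1 \<and> x$1 < 1 \<and> (x$2, x$3) \<in> R \<and> spherical_coords (x$2, x$3) \<in> A}"
      by (simp add: S_def)
    also have "\<dots> \<in> sets borel" by measurable
    finally show ?thesis .
  qed
  have sin0: "0 < sin (x$2)" if "x \<in> S" for x
    using that by (auto simp: S_def R_def intro!: sin_gt_zero)
  have inj: "inj_on ?F S"
  proof (rule inj_onI)
    fix x y assume x: "x \<in> S" and y: "y \<in> S" and eq: "?F x = ?F y"
    have "norm (?F x) = norm (?F y)" using eq by simp
    then have 1: "x$1 = y$1" using x y by (simp add: S_def)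
    then have sc: "spherical_coords (x$2, x$3) = spherical_coords (y$2, y$3)"
      using eq x by (simp add: S_def)
    have r: "0 \<le> x$2" "x$2 \<le> pi" "0 \<le> y$2" "y$2 \<le> pi"
      "0 \<le> x$3" "x$3 < 2*pi" "0 \<le> y$3" "y$3 < 2*pi"
      using x y by (auto simp: S_def R_def)
    have c: "sin (x$2) * cos (x$3) = sin (y$2) * cos (y$3)" "sin (x$2) * sin (x$3) = sin (y$2) * sin (y$3)"
      "cos (x$2) = cos (y$2)"
      using sc by (simp_all add: spherical_coords_def vec_eq_iff forall_3)
    have 2: "x$2 = y$2" by (rule cos_inj_pi[OF r(1-4) c(3)])
    have "cos (x$3) = cos (y$3)" "sin (x$3) = sin (y$3)"
      using c(1,2) sin0[OF x] 2 by simp_all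
    then have "x$3 = y$3" by (rule cos_sin_inj_2pi[OF r(5-8)])
    then show "x = y" using 1 2 by (simp add: vec_eq_iff forall_3)
  qed
  define I where "I = (\<integral>\<^sup>+x. indicator S x * ennreal ((x$1)\<^sup>2 * sin (x$2)) \<partial>lborel)"
  have I: "I = (\<integral>\<^sup>+r. indicator {0<..<1} r * ennreal (r\<^sup>2) \<partial>lborel) * (\<integral>\<^sup>+p. g p \<partial>lborel)"
  proof -
    let ?T = "\<lambda>p. vector [fst p, fst (snd p), snd (snd p)] :: real^3"
    have T [measurable]: "?T \<in> borel_measurable (lborel :: (real\<times>real\<times>real) measure)"
      unfolding measurable_lborel2 borel_prod[symmetric] by measurable
    have f: "(\<lambda>x::real^3. indicator S x * ennreal ((x$1)\<^sup>2 * sin (x$2))) \<in> borel_measurable borel"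
      using S by measurable
    have "I = (\<integral>\<^sup>+p. indicator S (?T p) * ennreal ((?T p$1)\<^sup>2 * sin (?T p$2)) \<partial>lborel)"
      unfolding I_def by (subst distr_vector_3[symmetric], subst nn_integral_distr[OF T]) (use f in auto)
    also have "\<dots> = (\<integral>\<^sup>+p. (indicator {0<..<1} (fst p) * ennreal ((fst p)\<^sup>2)) * g (snd p) \<partial>lborel)"
    proof (intro nn_integral_cong)
      fix p :: "real\<times>real\<times>real"
      show "indicator S (?T p) * ennreal ((?T p$1)\<^sup>2 * sin (?T p$2)) =
        (indicator {0<..<1} (fst p) * ennreal ((fst p)\<^sup>2)) * g (snd p)"
        by (auto simp: S_def g_def indicator_def ennreal_mult')
    qed
    also have "\<dots> = (\<integral>\<^sup>+r. indicator {0<..<1} r * ennreal (r\<^sup>2) \<partial>lborel) * (\<integral>\<^sup>+p. g p \<partial>lborel)"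
    proof -
      have [measurable]: "g \<in> borel_measurable lborel" using g by simp
      have [measurable]: "(\<lambda>r::real. indicator {0<..<1} r * ennreal (r\<^sup>2)) \<in> borel_measurable lborel"
        by measurable
      have m: "(\<lambda>p::real\<times>real\<times>real. (indicator {0<..<1} (fst p) * ennreal ((fst p)\<^sup>2)) * g (snd p))
          \<in> borel_measurable (lborel \<Otimes>\<^sub>M lborel)"
        by (intro borel_measurable_times_ennreal measurable_compose[OF measurable_fst, of "\<lambda>r. indicator {0<..<1} r * ennreal (r\<^sup>2)"]
            measurable_compose[OF measurable_snd, of g]) measurable
      show ?thesis
        unfolding lborel_prod[symmetric, where 'a=real and 'b="real\<times>real"]
        by (subst lborel.nn_integral_fst[OF m, symmetric])
           (simp add: nn_integral_cmult nn_integral_multc)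
    qed
    finally show ?thesis .
  qed
  have r2: "(\<integral>\<^sup>+r. indicator {0<..<1} r * ennreal (r\<^sup>2) \<partial>lborel) = ennreal (1/3)"
  proof -
    have "(\<integral>\<^sup>+r. ennreal (r\<^sup>2) * indicator {0..1} r \<partial>lborel) = ennreal (1^3/3 - 0^3/3)"
      by (rule nn_integral_FTC_Icc) (auto intro!: derivative_eq_intros)
    moreover have "(\<integral>\<^sup>+r. indicator {0<..<1} r * ennreal (r\<^sup>2) \<partial>lborel) =
       (\<integral>\<^sup>+r. ennreal (r\<^sup>2) * indicator {0..1} r \<partial>lborel)"
    proof (rule nn_integral_cong_AE)
      have "AE r in lborel. r \<noteq> (0::real) \<and> r \<noteq> 1"
        using AE_lborel_singleton[of "0::real"] AE_lborel_singleton[of "1::real"] by eventually_elim auto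
      then show "AE r in lborel. indicator {0<..<1} r * ennreal (r\<^sup>2) = ennreal (r\<^sup>2) * indicator {0..1} r"
        by eventually_elim (auto simp: indicator_def)
    qed
    ultimately show ?thesis by simp
  qed
  have g_int: "(\<integral>\<^sup>+p. g p \<partial>lborel) = emeasure sphere_area A"
    unfolding emeasure_sphere_area[OF A]
  proof (rule nn_integral_cong_AE)
    have "negligible {p::real\<times>real. p \<bullet> (0, 1) = 2 * pi}"
      by (rule negligible_standard_hyperplane) (simp add: Basis_prod_def)
    then have "AE p in lborel. \<not> (p::real\<times>real) \<bullet> (0, 1) = 2 * pi"
      by (metis (mono_tags, lifting) AE_completion_iff negligible_iff_null_sets AE_not_in mem_Collect_eq eventually_mono)
    then show "AE p in lborel. g p = indicator ({0..pi} \<times> {0..2 * pi}) p * ennreal (sin (fst p)) * indicator A (spherical_coords p)"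
      by eventually_elim (auto simp: g_def R_def indicator_def less_le)
  qed
  have Ifin: "I < \<infinity>"
  proof -
    have "(\<integral>\<^sup>+p. g p \<partial>lborel) \<le> (\<integral>\<^sup>+p. indicator (cbox (0,0) (pi, 2*pi)) p \<partial>lborel)"
      by (intro nn_integral_mono) (auto simp: g_def R_def indicator_def cbox_Pair_eq intro!: ennreal_leI[of _ 1, simplified])
    also have "\<dots> = emeasure lborel (cbox (0,0) (pi, 2*pi) :: (real\<times>real) set)" by simp
    also have "\<dots> < \<infinity>" by (rule emeasure_lborel_cbox_finite)
    finally show ?thesis unfolding I r2 by (simp add: ennreal_mult_less_top)
  qed
  define m where "m = enn2real I"
  have Im: "I = ennreal m" using Ifin unfolding m_def by simp
  have "((\<lambda>x. indicator S x * ((x$1)\<^sup>2 * sin (x$2))) has_integral m) UNIV"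
  proof (subst has_integral_iff_nn_integral_lebesgue)
    show "0 \<le> indicator S x * ((x $ 1)\<^sup>2 * sin (x $ 2))" for x
      using sin0[of x] by (auto simp: indicator_def)
    have "(\<lambda>x::real^3. indicator S x * ((x$1)\<^sup>2 * sin (x$2))) \<in> borel_measurable borel"
      using S by measurable
    moreover have "(\<integral>\<^sup>+x. ennreal (indicator S x * ((x$1)\<^sup>2 * sin (x$2))) \<partial>lebesgue) = ennreal m"
      unfolding Im[symmetric] I_def nn_integral_completion
      by (intro nn_integral_cong) (auto simp: indicator_def)
    ultimately show "(\<lambda>x. indicator S x * ((x$1)\<^sup>2 * sin (x$2))) \<in> borel_measurable lebesgue \<and>
       (\<integral>\<^sup>+x. ennreal (indicator S x * ((x$1)\<^sup>2 * sin (x$2))) \<partial>lebesgue) = ennreal m \<and> 0 \<le> m"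
      by (auto simp: m_def intro: measurable_completion)
  qed
  then have "((\<lambda>x. if x \<in> S then (x$1)\<^sup>2 * sin (x$2) else 0) has_integral m) UNIV"
    by (rule has_integral_eq[rotated]) (simp add: indicator_def)
  then have "((\<lambda>x. (x$1)\<^sup>2 * sin (x$2)) has_integral m) S"
    by (simp only: has_integral_restrict_UNIV)
  then have "((\<lambda>x. \<bar>det (matrix (D x))\<bar>) has_integral m) S"
    by (rule has_integral_eq[rotated])
       (use sin0 in \<open>simp add: detD abs_mult less_imp_le\<close>)
  then have im: "?F ` S \<in> lmeasurable \<and> measure lebesgue (?F ` S) = m"
    by (subst has_measure_differentiable_image[where f' = D])
       (use S inj in \<open>auto intro!: derD\<close>)
  have "?F ` S \<subseteq> unit_cone A"
  proof
    fix y assume "y \<in> ?F ` S"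
    then obtain x where x: "x \<in> S" "y = ?F x" by blast
    have "norm y = x$1" using x by (simp add: S_def)
    moreover have "y \<noteq> 0" using calculation x(1) by (auto simp: S_def)
    ultimately show "y \<in> unit_cone A" using x by (simp add: S_def unit_cone_def)
  qed
  moreover have "unit_cone A - ?F ` S \<subseteq> {y. y \<bullet> axis 2 1 = 0}"
  proof
    fix y assume y: "y \<in> unit_cone A - ?F ` S"
    show "y \<in> {y. y \<bullet> axis 2 1 = 0}"
    proof (rule ccontr)
      assume "y \<notin> {y. y \<bullet> axis 2 1 = 0}"
      then have "y$2 \<noteq> 0" by (simp add: inner_axis)
      then obtain \<theta> \<phi> where *: "0 < \<theta>" "\<theta> < pi" "0 \<le> \<phi>" "\<phi> < 2 * pi"
        "y = norm y *\<^sub>R spherical_coords (\<theta>, \<phi>)" by (rule spherical_coords_exists)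
      have y0: "y \<noteq> 0" using y by (auto simp: unit_cone_def)
      have "y /\<^sub>R norm y = spherical_coords (\<theta>, \<phi>)"
        by (subst *(5)) (use y0 in simp)
      then have "vector [norm y, \<theta>, \<phi>] \<in> S" using y *(1-4) y0 by (auto simp: S_def unit_cone_def R_def)
      moreover have "y = ?F (vector [norm y, \<theta>, \<phi>])" using *(5)[symmetric] by simp
      ultimately have "y \<in> ?F ` S" by (rule rev_image_eqI)
      with y show False by simp
    qed
  qed
  moreover have neg: "negligible {y::real^3. y \<bullet> axis 2 1 = 0}"
    by (rule negligible_standard_hyperplane) (simp add: axis_in_Basis_iff)
  ultimately have n: "negligible (unit_cone A - ?F ` S)" "negligible (?F ` S - unit_cone A)"
    by (auto intro: negligible_subset)
  have c: "unit_cone A \<in> lmeasurable" "measure lebesgue (unit_cone A) = m"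
    using measure_negligible_symdiff[of "?F ` S" "unit_cone A"] lmeasurable_negligible_symdiff[of "?F ` S" "unit_cone A"] im n by auto
  have "emeasure lborel (unit_cone A) = emeasure lebesgue (unit_cone A)" using unit_cone_borel[OF A] by simp
  also have "\<dots> = ennreal m" using c by (simp add: emeasure_eq_measure2)
  also have "\<dots> = ennreal (1/3) * emeasure sphere_area A" using Im I r2 g_int by simp
  finally have "3 * emeasure lborel (unit_cone A) = (3 * ennreal (1/3)) * emeasure sphere_area A"
    by (simp add: mult.assoc)
  also have "3 * ennreal (1/3) = 1" by (simp add: ennreal_mult'[symmetric] flip: ennreal_numeral)
  finally show ?thesis by simp
qed

lemma cross_triple_linear_image:
  fixes T :: "real^3 \<Rightarrow> real^3"
  assumes "linear T"
  shows "T a \<bullet> cross3 (T b) (T c) = det (matrix T) * (a \<bullet> cross3 b c)"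
proof -
  define A where "A = matrix T"
  have T: "T x = A *v x" for x using assms by (simp add: matrix_works A_def)
  have "(vector [A *v a, A *v b, A *v c] :: real^3^3) = vector [a, b, c] ** transpose A"
    by (simp add: vec_eq_iff forall_3 matrix_matrix_mult_def matrix_vector_mult_def sum_3 transpose_def mult.commute)
  then show ?thesis by (simp add: dot_cross_det det_mul T A_def[symmetric])
qed

text \<open>Maps in \<open>S2 \<rightarrow>\<^sub>E S2\<close> are constantly
  \<open>undefined\<close> off the sphere, so continuity on the sphere alone makes them Borel;
  lifts, which are 0 off their domain, are treated in the same way.\<close>

lemma borel_measurable_continuous_on_const_outside:
  fixes f :: "'a::topological_space \<Rightarrow> 'b::topological_space"
  assumes "continuous_on S f" "S \<in> sets borel" "\<And>x. x \<notin> S \<Longrightarrow> f x = c"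
  shows "f \<in> borel_measurable borel"
proof -
  have "(\<lambda>x. if x \<in> S then f x else c) \<in> borel_measurable borel"
    using assms by (subst measurable_If_restrict_space_iff) (auto intro: borel_measurable_continuous_on_restrict)
  moreover have "(\<lambda>x. if x \<in> S then f x else c) = f" using assms(3) by auto
  ultimately show ?thesis by simp
qed

lemma sets_sphere_area [simp, measurable_cong]: "sets sphere_area = sets borel"
  by (simp add: sphere_area_def)

lemma space_sphere_area [simp]: "space sphere_area = UNIV"
  by (simp add: sphere_area_def)

lemma finite_sphere_area: "finite_measure sphere_area"
proof
  have "emeasure lborel (unit_cone UNIV) \<le> emeasure lborel (cbox (-1) (1::real^3))"
  proof (rule emeasure_mono)
    show "unit_cone UNIV \<subseteq> cbox (-1) 1"
    proof
      fix y assume "y \<in> unit_cone UNIV"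
      then have "\<bar>y$i\<bar> \<le> 1" for i using component_le_norm_cart[of y i] by (auto simp: unit_cone_def)
      then show "y \<in> cbox (-1) 1" by (simp add: mem_box_cart abs_le_iff minus_le_iff)
    qed
  qed simp
  also have "\<dots> < \<infinity>" by (rule emeasure_lborel_cbox_finite)
  finally show "emeasure sphere_area (space sphere_area) \<noteq> \<infinity>"
    by (simp add: emeasure_sphere_area_eq_unit_cone ennreal_mult_eq_top_iff)
qed

interpretation sphere_area: finite_measure sphere_area by (rule finite_sphere_area)

lemma AE_sphere_area: "AE x in sphere_area. x \<in> S2"
proof -
  have False if "y \<in> unit_cone (- S2)" for y
  proof -
    have "y \<noteq> 0" "norm (y /\<^sub>R norm y) \<noteq> 1" using that by (auto simp: unit_cone_def simp del: norm_scaleR)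
    then show False by simp
  qed
  then have "unit_cone (- S2) = {}" by blast
  then have "emeasure sphere_area (- S2) = 0" by (simp add: emeasure_sphere_area_eq_unit_cone)
  then show ?thesis by (intro AE_I[where N = "- S2"]) auto
qed

lemma open_normalize_preimage:
  fixes W :: "'a::real_normed_vector set"
  assumes "open W" shows "open {y. y \<noteq> 0 \<and> y /\<^sub>R norm y \<in> W}"
proof -
  have "open (- {0} \<inter> (\<lambda>y. y /\<^sub>R norm y) -` W)"
    using assms by (intro continuous_open_preimage continuous_intros) auto
  moreover have "- {0} \<inter> (\<lambda>y. y /\<^sub>R norm y) -` W = {y. y \<noteq> 0 \<and> y /\<^sub>R norm y \<in> W}" by auto
  ultimately show ?thesis by simp
qed

lemma emeasure_sphere_area_pos:
  assumes "open W" "x \<in> W" "x \<in> S2"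
  shows "emeasure sphere_area (W \<inter> S2) > 0"
proof -
  let ?C = "{y. y \<noteq> 0 \<and> y /\<^sub>R norm y \<in> W} \<inter> ball 0 1"
  have op: "open ?C" using open_normalize_preimage[OF assms(1)] by auto
  have ne: "(1/2) *\<^sub>R x \<in> ?C" using assms by auto
  have eq: "?C = unit_cone (W \<inter> S2)" by (auto simp: unit_cone_def)
  have "emeasure lborel ?C \<noteq> 0"
  proof
    assume "emeasure lborel ?C = 0"
    then have "negligible ?C" using op by (simp add: negligible_iff_emeasure0)
    then show False using open_not_negligible[OF op] ne by blast
  qed
  then have "emeasure lborel (unit_cone (W \<inter> S2)) > 0"
    unfolding eq by (simp add: zero_less_iff_neq_zero)
  then show ?thesis using assms(1)
    by (simp add: emeasure_sphere_area_eq_unit_cone ennreal_zero_less_mult_iff)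
qed

text \<open>The lifts \<open>W\<close> and the distance \<open>dW\<close> use only that a map is a
  continuous bijection preserving the measure. This class is closed under composition and inversion
  without any smoothness argument.\<close>

definition mp_homeos :: "(real^3 \<Rightarrow> real^3) set" where
  "mp_homeos = {f. f \<in> S2 \<rightarrow>\<^sub>E S2 \<and> bij_betw f S2 S2 \<and> continuous_on S2 f \<and>
     distr sphere_area borel f = sphere_area}"

lemma measurable_extensional_sphere:
  assumes "f \<in> S2 \<rightarrow>\<^sub>E S2" "continuous_on S2 f"
  shows "f \<in> borel_measurable borel"
  by (rule borel_measurable_continuous_on_const_outside[OF assms(2), of undefined])
     (use assms(1) in \<open>auto simp: PiE_def extensional_def\<close>)

text \<open>The extension homogeneous of degree one maps the cone over \<open>A\<close> bijectively
  onto the cone over its image. With determinant of modulus 1 it preserves the volumes of cones,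
  hence areas.\<close>

lemma mp_homeos_if_det_radial:
  assumes f: "f \<in> S2 \<rightarrow>\<^sub>E S2" "bij_betw f S2 S2" "continuous_on S2 f"
    and D: "\<And>x. x \<noteq> 0 \<Longrightarrow> ((\<lambda>y. norm y *\<^sub>R f (y /\<^sub>R norm y)) has_derivative T x) (at x)"
    and det: "\<And>x. x \<noteq> 0 \<Longrightarrow> \<bar>det (matrix (T x))\<bar> = 1"
  shows "f \<in> mp_homeos"
proof -
  let ?G = "\<lambda>y. norm y *\<^sub>R f (y /\<^sub>R norm y)"
  have fS: "f x \<in> S2" if "x \<in> S2" for x using f(1) that by auto
  have nf: "norm (f (y /\<^sub>R norm y)) = 1" if "y \<noteq> 0" for y
    using fS[of "y /\<^sub>R norm y"] that by simp
  have meas: "emeasure sphere_area (f ` A) = emeasure sphere_area A" if A: "A \<in> sets borel" "A \<subseteq> S2" for A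
  proof -
    have inj: "inj_on ?G (unit_cone A)"
    proof (rule inj_onI)
      fix x y assume x: "x \<in> unit_cone A" and y: "y \<in> unit_cone A" and eq: "?G x = ?G y"
      have "norm (?G x) = norm (?G y)" using eq by simp
      then have n: "norm x = norm y" using x y nf by (auto simp: unit_cone_def)
      then have "f (x /\<^sub>R norm x) = f (y /\<^sub>R norm y)" using eq x by (auto simp: unit_cone_def)
      moreover have "x /\<^sub>R norm x \<in> S2" "y /\<^sub>R norm y \<in> S2" using x y by (auto simp: unit_cone_def)
      ultimately have "x /\<^sub>R norm x = y /\<^sub>R norm y" using f(2) by (auto simp: bij_betw_def inj_on_def)
      then show "x = y" using n x by (auto simp: unit_cone_def)
    qed
    have img: "?G ` unit_cone A = unit_cone (f ` A)"
    proof
      show "?G ` unit_cone A \<subseteq> unit_cone (f ` A)"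
      proof
        fix z assume "z \<in> ?G ` unit_cone A"
        then obtain y where y: "y \<in> unit_cone A" "z = ?G y" by blast
        have "norm z = norm y" using y nf[of y] by (simp add: unit_cone_def)
        moreover have "z \<noteq> 0" using calculation y(1) by (auto simp: unit_cone_def)
        ultimately show "z \<in> unit_cone (f ` A)" using y by (simp add: unit_cone_def)
      qed
      show "unit_cone (f ` A) \<subseteq> ?G ` unit_cone A"
      proof
        fix z assume z: "z \<in> unit_cone (f ` A)"
        then obtain a where a: "a \<in> A" "z /\<^sub>R norm z = f a" and z0: "z \<noteq> 0" "norm z < 1" by (auto simp: unit_cone_def)
        have na: "norm a = 1" using a A by auto
        have "a \<noteq> 0" using na by auto
        then have "norm z *\<^sub>R a \<in> unit_cone A" using z0 na a by (simp add: unit_cone_def)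
        moreover have "?G (norm z *\<^sub>R a) = z" using na z0 by (simp flip: a(2))
        ultimately show "z \<in> ?G ` unit_cone A" by (metis (no_types, lifting) imageI)
      qed
    qed
    have finA: "emeasure lborel (unit_cone A) < \<infinity>"
      using sphere_area.emeasure_finite[of A] emeasure_sphere_area_eq_unit_cone[OF A(1)]
      by (auto simp: ennreal_mult_eq_top_iff less_top)
    have cA: "unit_cone A \<in> sets borel" using A by simp
    then have lm: "unit_cone A \<in> lmeasurable" using finA by (auto simp: fmeasurable_def)
    have ind: "(indicat_real (unit_cone A) has_integral measure lebesgue (unit_cone A)) UNIV"
      using lm by (simp add: lmeasurable_iff_has_integral)
    have "((\<lambda>x. if x \<in> unit_cone A then 1::real else 0) has_integral measure lebesgue (unit_cone A)) UNIV"
      by (rule has_integral_eq[OF _ ind]) (simp add: indicator_def)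
    then have "((\<lambda>x. 1::real) has_integral measure lebesgue (unit_cone A)) (unit_cone A)"
      by (simp only: has_integral_restrict_UNIV)
    then have "((\<lambda>x. \<bar>det (matrix (T x))\<bar>) has_integral measure lebesgue (unit_cone A)) (unit_cone A)"
      by (rule has_integral_eq[rotated]) (simp add: det unit_cone_def)
    then have "?G ` unit_cone A \<in> lmeasurable \<and> measure lebesgue (?G ` unit_cone A) = measure lebesgue (unit_cone A)"
      by (subst has_measure_differentiable_image[where f' = T])
         (use cA inj in \<open>auto simp: unit_cone_def intro!: has_derivative_at_withinI D\<close>)
    then have "emeasure lebesgue (unit_cone (f ` A)) = emeasure lebesgue (unit_cone A)"
      using lm unfolding img by (simp add: emeasure_eq_measure2)
    \<comment> \<open>Images of Borel sets are read as preimages under the inverse map, which is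
      continuous because the sphere is compact.\<close>
    moreover have "f ` A \<in> sets borel"
    proof -
      let ?g = "the_inv_into S2 f"
      have inj: "inj_on f S2" and surj: "f ` S2 = S2" using f(2) by (auto simp: bij_betw_def)
      have cg: "continuous_on S2 ?g"
        using continuous_on_inv_into[OF f(3) _ inj] surj by simp
      have "?g \<in> restrict_space borel S2 \<rightarrow>\<^sub>M borel" by (rule borel_measurable_continuous_on_restrict[OF cg])
      then have "?g -` A \<inter> space (restrict_space borel S2) \<in> sets (restrict_space borel S2)"
        using A(1) by (rule measurable_sets)
      then have "?g -` A \<inter> S2 \<in> sets borel" by (simp add: sets_restrict_space_iff space_restrict_space)
      moreover have "?g -` A \<inter> S2 = f ` A"
      proof (intro subset_antisym subsetI)
        fix y assume "y \<in> ?g -` A \<inter> S2"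
        then show "y \<in> f ` A" using surj f_the_inv_into_f[OF inj, of y] by (auto intro: rev_image_eqI)
      next
        fix y assume "y \<in> f ` A"
        then obtain x where "x \<in> A" "y = f x" by blast
        then show "y \<in> ?g -` A \<inter> S2" using A(2) the_inv_into_f_f[OF inj, of x] fS[of x] by auto
      qed
      ultimately show ?thesis by simp
    qed
    ultimately show ?thesis using A(1) by (simp add: emeasure_sphere_area_eq_unit_cone)
  qed
  have fm [measurable]: "f \<in> borel_measurable borel" by (rule measurable_extensional_sphere) fact+
  have "distr sphere_area borel f = sphere_area"
  proof (rule measure_eqI)
    fix B assume "B \<in> sets (distr sphere_area borel f)"
    then have B [measurable]: "B \<in> sets borel" by simp
    have AES: "emeasure sphere_area (X \<inter> S2) = emeasure sphere_area X" if "X \<in> sets borel" for X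
      by (rule emeasure_eq_AE) (use AE_sphere_area that in auto)
    have v: "f -` B \<in> sets borel" using measurable_sets[OF fm B] by simp
    have "emeasure (distr sphere_area borel f) B = emeasure sphere_area (f -` B)"
      by (subst emeasure_distr) auto
    also have "\<dots> = emeasure sphere_area (f -` B \<inter> S2)" using AES[OF v] by simp
    also have "\<dots> = emeasure sphere_area (f ` (f -` B \<inter> S2))" using v by (intro meas[symmetric]) auto
    also have "f ` (f -` B \<inter> S2) = B \<inter> S2"
    proof (intro subset_antisym subsetI)
      fix y assume y: "y \<in> B \<inter> S2"
      then obtain x where "x \<in> S2" "y = f x" using bij_betw_imp_surj_on[OF f(2)] by (metis IntD2 imageE)
      then show "y \<in> f ` (f -` B \<inter> S2)" using y by (intro image_eqI[of _ _ x]) auto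
    next
      fix y assume "y \<in> f ` (f -` B \<inter> S2)"
      then show "y \<in> B \<inter> S2" using fS by blast
    qed
    also have "emeasure sphere_area (B \<inter> S2) = emeasure sphere_area B" using AES[OF B] .
    finally show "emeasure (distr sphere_area borel f) B = emeasure sphere_area B" .
  qed simp
  then show ?thesis using f by (simp add: mp_homeos_def)
qed

lemma smooth_on_imp_local:
  assumes "smooth_on S f" "x \<in> S"
  obtains U F where "open U" "x \<in> U" "\<And>y. y \<in> U \<Longrightarrow> F differentiable (at y)" "\<And>y. y \<in> U \<inter> S \<Longrightarrow> F y = f y"
    "\<And>v. continuous_on U (\<lambda>y. frechet_derivative F (at y) v)"
proof -
  obtain U F where *: "x \<in> U" "smooth_on_open U F" "\<forall>y \<in> U \<inter> S. F y = f y"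
    using assms unfolding smooth_on_def by blast
  have it: "iter_deriv vs F differentiable (at y)" if "y \<in> U" for y vs
    using *(2) that unfolding smooth_on_open_def by blast
  have d: "F differentiable (at y)" if "y \<in> U" for y using it[OF that, of "[]"] by simp
  have "(\<lambda>y. frechet_derivative F (at y) v) differentiable (at y)" if "y \<in> U" for v y
    using it[OF that, of "[v]"] by simp
  then have "continuous_on U (\<lambda>y. frechet_derivative F (at y) v)" for v
    by (meson continuous_at_imp_continuous_on differentiable_imp_continuous_within)
  then show thesis using that[of U F] * d by (auto simp: smooth_on_open_def)
qed

lemma smooth_on_imp_continuous_on:
  assumes "smooth_on S f" shows "continuous_on S f"
proof (subst continuous_on_eq_continuous_within, intro ballI)
  fix x assume x: "x \<in> S"
  obtain U F where *: "open U" "x \<in> U" "\<And>y. y \<in> U \<Longrightarrow> F differentiable (at y)" "\<And>y. y \<in> U \<inter> S \<Longrightarrow> F y = f y"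
    using smooth_on_imp_local[OF assms x] by metis
  have "continuous (at x within S) F"
    using *(2,3) differentiable_imp_continuous_within continuous_at_imp_continuous_at_within by blast
  moreover have "\<forall>\<^sub>F y in at x within S. F y = f y"
    using *(1,2,4) by (auto simp: eventually_at_topological)
  ultimately have "(f \<longlongrightarrow> F x) (at x within S)"
    unfolding continuous_within by (rule Lim_transform_eventually)
  then show "continuous (at x within S) f" using *(2,4) x by (simp add: continuous_within)
qed

lemma radial_ext_scale: "c > 0 \<Longrightarrow> radial_ext f (c *\<^sub>R x) = radial_ext f x"
  by (simp add: radial_ext_def field_simps)

lemma differentiable_normalize:
  fixes x :: "'a::real_inner" assumes "x \<noteq> 0"
  shows "(\<lambda>y. y /\<^sub>R norm y) differentiable (at x)"
proof -
  have "(\<lambda>y::'a. norm y) differentiable (at x)"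
    using has_derivative_norm[OF assms] unfolding differentiable_def by blast
  then show ?thesis using assms
    by (intro differentiable_scaleR differentiable_inverse differentiable_ident) auto
qed

lemma radial_ext_differentiable:
  assumes "smooth_on S2 f" "x \<noteq> 0"
  shows "radial_ext f differentiable (at x)"
proof -
  let ?n = "\<lambda>y::real^3. y /\<^sub>R norm y"
  have "?n x \<in> S2" using assms by simp
  then obtain U F where *: "open U" "?n x \<in> U" "\<And>y. y \<in> U \<Longrightarrow> F differentiable (at y)" "\<And>y. y \<in> U \<inter> S2 \<Longrightarrow> F y = f y"
    using smooth_on_imp_local[OF assms(1)] by metis
  have "(\<lambda>y. F (?n y)) differentiable (at x)"
    using differentiable_chain_at[OF differentiable_normalize[OF assms(2)] *(3)[OF *(2)]] by (simp add: o_def)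
  then obtain D where D: "((\<lambda>y. F (?n y)) has_derivative D) (at x)" unfolding differentiable_def by blast
  have "open {y. y \<noteq> 0 \<and> ?n y \<in> U}" by (rule open_normalize_preimage) fact
  then have "(radial_ext f has_derivative D) (at x)"
    by (rule has_derivative_transform_within_open[OF D]) (use * assms in \<open>auto simp: radial_ext_def\<close>)
  then show ?thesis unfolding differentiable_def by blast
qed

text \<open>The differential \<open>T x\<close> of the degree-one extension sends the normal
  \<open>p\<close> to \<open>f p\<close> and acts on tangent vectors as \<open>sphere_deriv\<close>.
  As \<open>area_form\<close> is the triple product with the normal, preserving it means preserving
  the volume of \<open>p, u, v\<close>, so the determinant is 1.\<close>

lemma area_diffeos_subset_mp_homeos: "area_diffeos \<subseteq> mp_homeos"
proof
  fix f assume "f \<in> area_diffeos"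
  then have f: "f \<in> S2 \<rightarrow>\<^sub>E S2" "bij_betw f S2 S2" "smooth_on S2 f" "area_preserving f"
    by (auto simp: area_diffeos_def sphere_diffeo_def)
  have D: "(radial_ext f has_derivative sphere_deriv f p) (at p)" if "p \<in> S2" for p
  proof -
    have "p \<noteq> 0" using that by auto
    then show ?thesis unfolding sphere_deriv_def
      using radial_ext_differentiable[OF f(3), of p] by (simp add: frechet_derivative_works)
  qed
  define T where "T x h = (let p = x /\<^sub>R norm x in (p \<bullet> h) *\<^sub>R f p + sphere_deriv f p h)" for x h
  show "f \<in> mp_homeos"
  proof (rule mp_homeos_if_det_radial[OF f(1,2) smooth_on_imp_continuous_on[OF f(3)], of T])
    fix x :: "real^3" assume x: "x \<noteq> 0"
    define p where "p = x /\<^sub>R norm x"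
    have p: "p \<in> S2" using x by (simp add: p_def)
    have rp: "radial_ext f p = f p" using p by (simp add: radial_ext_def)
    have "((\<lambda>y. radial_ext f (y /\<^sub>R norm x)) has_derivative (\<lambda>h. sphere_deriv f p (h /\<^sub>R norm x))) (at x)"
      using D[OF p] unfolding p_def
      by (rule has_derivative_compose[of "\<lambda>y. y /\<^sub>R norm x" "\<lambda>h. h /\<^sub>R norm x", rotated])
         (auto intro!: derivative_eq_intros)
    moreover have "(\<lambda>y. radial_ext f (y /\<^sub>R norm x)) = radial_ext f"
      using x by (auto simp: radial_ext_scale fun_eq_iff)
    ultimately have R: "(radial_ext f has_derivative (\<lambda>h. sphere_deriv f p (h /\<^sub>R norm x))) (at x)" by simp
    have lin: "linear (sphere_deriv f p)" using D[OF p] has_derivative_linear by blast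
    have "((\<lambda>y. norm y *\<^sub>R radial_ext f y) has_derivative
        (\<lambda>h. norm x *\<^sub>R sphere_deriv f p (h /\<^sub>R norm x) + (h \<bullet> sgn x) *\<^sub>R radial_ext f x)) (at x)"
      by (rule has_derivative_scaleR[OF has_derivative_norm[OF x] R])
    moreover have "(\<lambda>h. norm x *\<^sub>R sphere_deriv f p (h /\<^sub>R norm x) + (h \<bullet> sgn x) *\<^sub>R radial_ext f x) = T x"
    proof
      fix h
      have "norm x *\<^sub>R sphere_deriv f p (h /\<^sub>R norm x) = sphere_deriv f p h"
        using x by (subst linear_scale[OF lin]) simp
      moreover have "h \<bullet> sgn x = p \<bullet> h" by (simp add: p_def sgn_div_norm inner_commute)
      moreover have "radial_ext f x = f p" by (simp add: radial_ext_def p_def)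
      ultimately show "norm x *\<^sub>R sphere_deriv f p (h /\<^sub>R norm x) + (h \<bullet> sgn x) *\<^sub>R radial_ext f x = T x h"
        by (simp add: T_def Let_def p_def)
    qed
    ultimately show "((\<lambda>y. norm y *\<^sub>R f (y /\<^sub>R norm y)) has_derivative T x) (at x)"
      by (simp add: radial_ext_def)
    \<comment> \<open>The radial extension is constant along rays, so its derivative kills the
      radial direction.\<close>
    have Dp: "sphere_deriv f p p = 0"
    proof -
      have h: "((\<lambda>t::real. p + t *\<^sub>R p) has_derivative (\<lambda>t. t *\<^sub>R p)) (at 0)"
        by (auto intro!: derivative_eq_intros)
      have "(radial_ext f has_derivative sphere_deriv f p) (at (p + 0 *\<^sub>R p))" using D[OF p] by simp
      note has_derivative_compose[OF h this]
      moreover have "((\<lambda>t::real. radial_ext f (p + t *\<^sub>R p)) has_derivative (\<lambda>t. 0)) (at 0)"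
      proof (rule has_derivative_transform_within_open)
        show "((\<lambda>t::real. f p) has_derivative (\<lambda>t. 0)) (at 0)" by simp
        show "open {-1<..<(1::real)}" "0 \<in> {-1<..<(1::real)}" by auto
        fix t :: real assume "t \<in> {-1<..<1}"
        then have "radial_ext f ((1 + t) *\<^sub>R p) = radial_ext f p" by (intro radial_ext_scale) auto
        then show "f p = radial_ext f (p + t *\<^sub>R p)" by (simp add: rp scaleR_add_left)
      qed
      ultimately have "(\<lambda>t. sphere_deriv f p (t *\<^sub>R p)) = (\<lambda>t. 0)" by (rule has_derivative_unique)
      then show ?thesis by (metis scaleR_one)
    qed
    \<comment> \<open>With \<open>v\<close> the cross product of \<open>p\<close> and
      \<open>u\<close>, the triple \<open>p, u, v\<close> has nonzero volume, and the determinant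
      can be read off from it.\<close>
    obtain u where u: "u \<noteq> 0" "orthogonal p u"
      using orthogonal_to_vector_exists[of p] by auto
    define v where "v = cross3 p u"
    have pu: "p \<bullet> u = 0" "p \<bullet> v = 0" using u by (auto simp: orthogonal_def v_def dot_cross_self)
    have vol: "p \<bullet> cross3 u v \<noteq> 0"
    proof -
      have "cross3 u v = (u \<bullet> u) *\<^sub>R p - (u \<bullet> p) *\<^sub>R u"
        unfolding v_def by (simp add: cross3_simps forall_3)
      then have "p \<bullet> cross3 u v = (u \<bullet> u) * (p \<bullet> p)" using pu by (simp add: inner_diff_right inner_commute)
      then show ?thesis using u(1) p by auto
    qed
    have linT: "linear (T x)"
      unfolding T_def Let_def p_def[symmetric]
      by (intro linear_compose_add lin) (auto intro!: linearI simp: inner_add_right scaleR_add_left)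
    have Tx: "T x h = (p \<bullet> h) *\<^sub>R f p + sphere_deriv f p h" for h
      by (simp add: T_def Let_def p_def)
    have Tp: "T x p = f p" using p Dp by (simp add: Tx dot_square_norm)
    have Tuv: "T x u = sphere_deriv f p u" "T x v = sphere_deriv f p v"
      using pu by (simp_all add: Tx)
    have "area_form (f p) (sphere_deriv f p u) (sphere_deriv f p v) = area_form p u v"
      using f(4) p pu unfolding area_preserving_def tangent_def by blast
    then have "det (matrix (T x)) * (p \<bullet> cross3 u v) = p \<bullet> cross3 u v"
      unfolding cross_triple_linear_image[OF linT, symmetric] Tp Tuv area_form_def .
    then show "\<bar>det (matrix (T x))\<bar> = 1" using vol by simp
  qed
qed

text \<open>The degree-one extension of the restricted map is \<open>T\<close> itself. This serves
  to rotate a point to the pole, and for the identity.\<close>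

lemma restrict_orthogonal_in_mp_homeos:
  fixes T :: "real^3 \<Rightarrow> real^3"
  assumes T: "orthogonal_transformation T"
  shows "restrict T S2 \<in> mp_homeos"
proof -
  let ?f = "restrict T S2"
  have lin: "linear T" and nT: "norm (T x) = norm x" for x
    using T by (auto simp: orthogonal_transformation)
  have eq: "(\<lambda>y. norm y *\<^sub>R ?f (y /\<^sub>R norm y)) = T"
  proof
    fix y :: "real^3"
    show "norm y *\<^sub>R ?f (y /\<^sub>R norm y) = T y"
    proof (cases "y = 0")
      case False
      then have "y /\<^sub>R norm y \<in> S2" by simp
      then have "norm y *\<^sub>R ?f (y /\<^sub>R norm y) = norm y *\<^sub>R (inverse (norm y) *\<^sub>R T y)"
        by (simp only: restrict_apply' linear_scale[OF lin])
      then show ?thesis using False by simp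
    qed (simp add: linear_0[OF lin])
  qed
  show ?thesis
  proof (rule mp_homeos_if_det_radial[where T = "\<lambda>_. T"])
    show "?f \<in> S2 \<rightarrow>\<^sub>E S2" using nT by auto
    have "inj T" "surj T"
      using T orthogonal_transformation_inj orthogonal_transformation_surj by blast+
    have "x \<in> T ` S2" if "x \<in> S2" for x
    proof -
      obtain z where "x = T z" using surjD[OF \<open>surj T\<close>] by blast
      then show ?thesis using nT[of z] that by auto
    qed
    then have "T ` S2 = S2" using nT by auto
    then have "bij_betw T S2 S2"
      using inj_on_subset[OF \<open>inj T\<close>, of S2] by (simp add: bij_betw_def)
    then show "bij_betw ?f S2 S2" by (rule bij_betw_cong[THEN iffD1, rotated]) simp
    show "continuous_on S2 ?f"
      using linear_continuous_on[OF lin[unfolded linear_conv_bounded_linear], of S2]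
      by (rule continuous_on_eq) simp
    show "((\<lambda>y. norm y *\<^sub>R ?f (y /\<^sub>R norm y)) has_derivative T) (at x)" for x
      unfolding eq using lin linear_imp_has_derivative by blast
    show "\<bar>det (matrix T)\<bar> = 1" using T by simp
  qed
qed

lemma nn_integral_sphere_area:
  assumes [measurable]: "F \<in> borel_measurable borel"
  shows "(\<integral>\<^sup>+x. F x \<partial>sphere_area) =
    (\<integral>\<^sup>+p. indicator ({0..pi} \<times> {0..2 * pi}) p * ennreal (sin (fst p)) * F (spherical_coords p) \<partial>lborel)"
proof -
  have eq: "(\<lambda>(\<theta>, \<phi>). ennreal (indicator ({0..pi} \<times> {0..2 * pi}) (\<theta>, \<phi>) * sin \<theta>))
      = (\<lambda>p. indicator ({0..pi} \<times> {0..2 * pi}) p * ennreal (sin (fst p)))"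
    by (auto simp: fun_eq_iff indicator_def)
  have m1: "(\<lambda>p::real\<times>real. sin (fst p)) \<in> borel_measurable borel"
    by (intro borel_measurable_continuous_onI continuous_intros)
  have m2: "{0..pi} \<times> {0..2 * pi} \<in> sets (borel :: (real\<times>real) measure)"
    by (intro borel_closed closed_Times) auto
  note [measurable] = m1 m2
  show ?thesis
    unfolding sphere_area_def eq
    by (subst nn_integral_distr, simp, simp, subst nn_integral_density) auto
qed

lemma nn_integral_mp_homeos:
  assumes "f \<in> mp_homeos" "F \<in> borel_measurable borel"
  shows "(\<integral>\<^sup>+x. F (f x) \<partial>sphere_area) = (\<integral>\<^sup>+x. F x \<partial>sphere_area)"
proof -
  have fm: "f \<in> sphere_area \<rightarrow>\<^sub>M borel"
    using assms(1) measurable_extensional_sphere[of f] by (simp add: mp_homeos_def)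
  have d: "distr sphere_area borel f = sphere_area" using assms(1) by (simp add: mp_homeos_def)
  have "(\<integral>\<^sup>+x. F (f x) \<partial>sphere_area) = (\<integral>\<^sup>+x. F x \<partial>distr sphere_area borel f)"
    by (rule nn_integral_distr[symmetric]) (use fm assms(2) in auto)
  then show ?thesis by (simp add: d)
qed

text \<open>At the pole, the square of \<open>sin \<theta>\<close> is
  \<open>(1 - cos \<theta>) * (1 + cos \<theta>)\<close>, at most the squared chord
  \<open>2 - 2 * cos \<theta>\<close>. So the density absorbs the singularity and the area of the
  parameter rectangle remains. A rotation carries any other point to the pole.\<close>

lemma nn_integral_inverse_dist_le:
  assumes "y \<in> S2"
  shows "(\<integral>\<^sup>+x. ennreal (1 / dist y x) \<partial>sphere_area) \<le> ennreal (2 * pi\<^sup>2)"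
proof -
  define N :: "real^3" where "N = axis 3 1"
  have sb: "sin \<theta> * (1 / dist N (spherical_coords (\<theta>, \<phi>))) \<le> 1" if "0 \<le> \<theta>" "\<theta> \<le> pi" for \<theta> \<phi>
  proof -
    let ?d = "dist N (spherical_coords (\<theta>, \<phi>))"
    have i: "spherical_coords (\<theta>, \<phi>) \<bullet> spherical_coords (\<theta>, \<phi>) = 1" "N \<bullet> N = 1"
      "N \<bullet> spherical_coords (\<theta>, \<phi>) = cos \<theta>"
      using dot_square_norm[of "spherical_coords (\<theta>, \<phi>)"]
      by (simp_all add: N_def inner_axis' inner_axis) (simp add: spherical_coords_def)
    have d2: "?d\<^sup>2 = 2 - 2 * cos \<theta>"
      unfolding dist_norm power2_norm_eq_inner inner_diff_left inner_diff_right
      by (simp add: i inner_commute[of "spherical_coords (\<theta>, \<phi>)" N])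
    have "(sin \<theta>)\<^sup>2 = (1 - cos \<theta>) * (1 + cos \<theta>)"
      using sin_cos_squared_add[of \<theta>] by (simp add: algebra_simps power2_eq_square)
    also have "\<dots> \<le> (1 - cos \<theta>) * 2"
      by (intro mult_left_mono) (use cos_le_one[of \<theta>] in auto)
    finally have "(sin \<theta>)\<^sup>2 \<le> ?d\<^sup>2" unfolding d2 by simp
    then have "sin \<theta> \<le> ?d" by (rule power2_le_imp_le) simp
    moreover have "?d \<ge> 0" by simp
    ultimately show ?thesis by (cases "?d = 0") (auto simp: field_simps)
  qed
  have "(\<integral>\<^sup>+x. ennreal (1 / dist N x) \<partial>sphere_area) \<le>
      (\<integral>\<^sup>+p. indicator (cbox (0,0) (pi, 2*pi)) p \<partial>lborel)"
  proof (subst nn_integral_sphere_area)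
    show "(\<integral>\<^sup>+ p. indicator ({0..pi} \<times> {0..2 * pi}) p * ennreal (sin (fst p)) *
          ennreal (1 / dist N (spherical_coords p)) \<partial>lborel) \<le>
      (\<integral>\<^sup>+p. indicator (cbox (0,0) (pi, 2*pi)) p \<partial>lborel)"
    proof (rule nn_integral_mono)
      fix p :: "real\<times>real"
      obtain \<theta> \<phi> where p: "p = (\<theta>, \<phi>)" by force
      have "ennreal (sin \<theta>) * ennreal (1 / dist N (spherical_coords (\<theta>, \<phi>))) \<le> 1"
        if "0 \<le> \<theta>" "\<theta> \<le> pi"
      proof -
        have "ennreal (sin \<theta>) * ennreal (1 / dist N (spherical_coords (\<theta>, \<phi>))) =
            ennreal (sin \<theta> * (1 / dist N (spherical_coords (\<theta>, \<phi>))))"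
          using that by (intro ennreal_mult'[symmetric]) (simp add: sin_ge_zero)
        also have "\<dots> \<le> ennreal 1" by (rule ennreal_leI) (rule sb[OF that])
        finally show ?thesis by simp
      qed
      then show "indicator ({0..pi} \<times> {0..2 * pi}) p * ennreal (sin (fst p)) *
          ennreal (1 / dist N (spherical_coords p)) \<le> indicator (cbox (0,0) (pi, 2*pi)) p"
        unfolding p by (simp add: cbox_Pair_eq indicator_def mult.assoc)
    qed
  qed measurable
  also have "\<dots> = emeasure lborel (cbox (0,0) (pi, 2*pi) :: (real\<times>real) set)" by simp
  also have "\<dots> = ennreal (2 * pi\<^sup>2)"
    by (subst emeasure_lborel_cbox) (auto simp: Basis_prod_def prod.union_disjoint power2_eq_square mult_ac)
  finally have N: "(\<integral>\<^sup>+x. ennreal (1 / dist N x) \<partial>sphere_area) \<le> ennreal (2 * pi\<^sup>2)" .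
  have "norm N = norm y" using assms by (simp add: N_def)
  then obtain T where T: "orthogonal_transformation T" "T N = y"
    by (rule orthogonal_transformation_exists)
  have iso: "dist (T u) (T v) = dist u v" for u v
    using T(1) by (simp add: orthogonal_transformation_isometry)
  have "(\<integral>\<^sup>+x. ennreal (1 / dist y x) \<partial>sphere_area) =
      (\<integral>\<^sup>+x. ennreal (1 / dist y (restrict T S2 x)) \<partial>sphere_area)"
    by (rule nn_integral_mp_homeos[symmetric, OF restrict_orthogonal_in_mp_homeos[OF T(1)]]) measurable
  also have "\<dots> = (\<integral>\<^sup>+x. ennreal (1 / dist N x) \<partial>sphere_area)"
    using AE_sphere_area by (intro nn_integral_cong_AE) (auto elim!: eventually_mono simp: iso simp flip: T(2))
  finally show ?thesis using N by simp
qed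

section \<open>Cyclic products of projections and the phase function \<open>K\<close>\<close>

type_synonym herm = "complex \<times> complex \<times> complex"

text \<open>A triple \<open>(p, q, r)\<close> stands for the matrix with rows
  \<open>(p, cnj q)\<close> and \<open>(q, r)\<close>. The summands pair the entries of the product
  of the first two matrices with those of the last two: this is the trace of a product of
  four.\<close>

definition tr4 :: "herm \<Rightarrow> herm \<Rightarrow> herm \<Rightarrow> herm \<Rightarrow> complex" where
  "tr4 = (\<lambda>(p1, q1, r1) (p2, q2, r2) (p3, q3, r3) (p4, q4, r4).
     (p1 * p2 + cnj q1 * q2) * (p3 * p4 + cnj q3 * q4) +
     (p1 * cnj q2 + cnj q1 * r2) * (q3 * p4 + r3 * q4) +
     (q1 * p2 + r1 * q2) * (p3 * cnj q4 + cnj q3 * r4) +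
     (q1 * cnj q2 + r1 * r2) * (q3 * cnj q4 + r3 * r4))"

text \<open>A column vector times its adjoint: the projection onto its line if the vector is a unit
  vector. Accordingly \<open>hprod\<close> is antilinear in its first argument, and
  \<open>hform h u v\<close> is the adjoint of \<open>u\<close> times \<open>h\<close> times
  \<open>v\<close>.\<close>

definition rk1 :: "complex \<times> complex \<Rightarrow> herm" where
  "rk1 = (\<lambda>(u, v). (u * cnj u, v * cnj u, v * cnj v))"

definition hprod :: "complex \<times> complex \<Rightarrow> complex \<times> complex \<Rightarrow> complex" where
  "hprod = (\<lambda>(u, v) (u', v'). cnj u * u' + cnj v * v')"

definition hform :: "herm \<Rightarrow> complex \<times> complex \<Rightarrow> complex \<times> complex \<Rightarrow> complex" where
  "hform = (\<lambda>(p, q, r) (u, v) (u', v'). cnj u * p * u' + cnj u * cnj q * v' + cnj v * q * u' + cnj v * r * v')"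

lemma tr4_cyclic: "tr4 a b c d = tr4 b c d a"
  by (simp add: tr4_def split_beta algebra_simps)

text \<open>Rank-one factors break the trace into scalar products. The first slot stays general,
  because differentiation puts a matrix there that is no projection.\<close>

lemma tr4_rk1: "tr4 h (rk1 v) (rk1 w) (rk1 u) = hform h u v * hprod v w * hprod w u"
  by (cases h; cases v; cases w; cases u)
     (simp add: tr4_def rk1_def hprod_def hform_def algebra_simps)

lemma hform_rk1: "hform (rk1 w) u v = hprod u w * hprod w v"
  by (cases v; cases w; cases u)
     (simp add: rk1_def hprod_def hform_def algebra_simps)

text \<open>Conjugation makes \<open>tr4\<close> multilinear over the reals only, so the product
  rule is applied entry by entry.\<close>

lemma tr4_has_vector_derivative:
  assumes "(h1 has_vector_derivative k1) (at t within S)" "(h2 has_vector_derivative k2) (at t within S)"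
    "(h3 has_vector_derivative k3) (at t within S)" "(h4 has_vector_derivative k4) (at t within S)"
  shows "((\<lambda>t. tr4 (h1 t) (h2 t) (h3 t) (h4 t)) has_vector_derivative
    tr4 k1 (h2 t) (h3 t) (h4 t) + tr4 (h1 t) k2 (h3 t) (h4 t) +
    tr4 (h1 t) (h2 t) k3 (h4 t) + tr4 (h1 t) (h2 t) (h3 t) k4) (at t within S)"
proof -
  have c: "((\<lambda>t. fst (h t)) has_vector_derivative fst k) (at t within S)"
    "((\<lambda>t. fst (snd (h t))) has_vector_derivative fst (snd k)) (at t within S)"
    "((\<lambda>t. cnj (fst (snd (h t)))) has_vector_derivative cnj (fst (snd k))) (at t within S)"
    "((\<lambda>t. snd (snd (h t))) has_vector_derivative snd (snd k)) (at t within S)"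
    if "(h has_vector_derivative k) (at t within S)" for h :: "real \<Rightarrow> herm" and k
    by (rule bounded_linear.has_vector_derivative[OF _ that];
        intro bounded_linear_compose[OF bounded_linear_cnj] bounded_linear_fst_comp bounded_linear_snd_comp bounded_linear_ident)+
  note d = c[OF assms(1)] c[OF assms(2)] c[OF assms(3)] c[OF assms(4)]
  show ?thesis
    unfolding tr4_def split_beta
    apply (rule has_vector_derivative_eq_rhs)
     apply (rule has_vector_derivative_add has_vector_derivative_mult d)+
    apply (simp only: ring_distribs ac_simps)
    done
qed

lemma tr4_continuous_on [continuous_intros]:
  assumes "continuous_on S h1" "continuous_on S h2" "continuous_on S h3" "continuous_on S h4"
  shows "continuous_on S (\<lambda>x. tr4 (h1 x) (h2 x) (h3 x) (h4 x))"
  unfolding tr4_def split_beta by (intro continuous_intros assms)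

text \<open>The axis \<open>e\<close> is fixed only once the two discs are known, since the twist
  about it has to wind points of one around points of the other. In the frame, \<open>zeta\<close>
  is the complex coordinate orthogonal to the axis and \<open>ht\<close> the height along
  it.\<close>

locale orthonormal_frame =
  fixes a b e :: "real^3"
  assumes unit: "a \<bullet> a = 1" "b \<bullet> b = 1" "e \<bullet> e = 1"
    and orth: "a \<bullet> b = 0" "a \<bullet> e = 0" "b \<bullet> e = 0"
begin

definition zeta :: "real^3 \<Rightarrow> complex" where "zeta x = Complex (a \<bullet> x) (b \<bullet> x)"
definition ht :: "real^3 \<Rightarrow> real" where "ht x = e \<bullet> x"

lemma frame_matrix: "orthogonal_matrix (vector [a, b, e] :: real^3^3)"
proof -
  have "(vector [a, b, e] :: real^3^3) ** transpose (vector [a, b, e]) = mat 1"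
    using unit orth
    by (simp add: vec_eq_iff forall_3 matrix_matrix_mult_def transpose_def mat_def inner_vec_def sum_3 mult.commute)
  then show ?thesis
    using matrix_left_right_inverse[of "vector [a, b, e] :: real^3^3"] by (auto simp: orthogonal_matrix_def)
qed

lemma inner_frame: "x \<bullet> y = (a \<bullet> x) * (a \<bullet> y) + (b \<bullet> x) * (b \<bullet> y) + (e \<bullet> x) * (e \<bullet> y)"
proof -
  let ?A = "vector [a, b, e] :: real^3^3"
  have "orthogonal_transformation ((*v) ?A)"
    using frame_matrix by (simp add: orthogonal_transformation_matrix)
  then have "(?A *v x) \<bullet> (?A *v y) = x \<bullet> y" by (simp add: orthogonal_transformation_def)
  moreover have "(?A *v x) $ 1 = a \<bullet> x" "(?A *v x) $ 2 = b \<bullet> x" "(?A *v x) $ 3 = e \<bullet> x" for x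
    by (simp_all add: matrix_vector_mult_def inner_vec_def)
  ultimately show ?thesis by (simp add: inner_vec_def sum_3)
qed

lemma frame_expand: "x = (a \<bullet> x) *\<^sub>R a + (b \<bullet> x) *\<^sub>R b + (e \<bullet> x) *\<^sub>R e"
proof -
  have "y \<bullet> x = y \<bullet> ((a \<bullet> x) *\<^sub>R a + (b \<bullet> x) *\<^sub>R b + (e \<bullet> x) *\<^sub>R e)" for y
  proof -
    have "y \<bullet> ((a \<bullet> x) *\<^sub>R a + (b \<bullet> x) *\<^sub>R b + (e \<bullet> x) *\<^sub>R e) =
        (a \<bullet> x) * (y \<bullet> a) + (b \<bullet> x) * (y \<bullet> b) + (e \<bullet> x) * (y \<bullet> e)"
      by (simp only: inner_add_right inner_scaleR_right)
    also have "\<dots> = (a \<bullet> y) * (a \<bullet> x) + (b \<bullet> y) * (b \<bullet> x) + (e \<bullet> y) * (e \<bullet> x)"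
      by (simp only: inner_commute[of y] mult.commute)
    finally show ?thesis by (simp only: inner_frame[of y x])
  qed
  note vector_eq_ldot[THEN iffD1, OF allI, OF this]
  then show ?thesis .
qed

lemma norm_frame: "(norm x)\<^sup>2 = (cmod (zeta x))\<^sup>2 + (ht x)\<^sup>2"
  unfolding power2_norm_eq_inner[of x] inner_frame[of x x]
  by (simp add: zeta_def ht_def cmod_power2 flip: power2_eq_square)

lemma inner_zeta_ht: "x \<bullet> y = Re (cnj (zeta x) * zeta y) + ht x * ht y"
  by (subst inner_frame) (simp add: zeta_def ht_def)

lemma norm_zeta_le: "cmod (zeta x) \<le> norm x"
  by (rule power2_le_imp_le) (simp_all add: norm_frame)

lemma abs_ht_le: "\<bar>ht x\<bar> \<le> norm x"
  by (rule power2_le_imp_le) (simp_all add: norm_frame)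

text \<open>The Bloch sphere: half of the identity plus \<open>x\<close> contracted with the Pauli
  matrices, the projection onto the line that \<open>x\<close> represents. \<open>proj_minus\<close>
  belongs to the antipode, and \<open>proj_lin\<close> is the linear part, hence the
  derivative.\<close>

definition proj_plus :: "real^3 \<Rightarrow> herm" where
  "proj_plus x = (of_real ((1 + ht x) / 2), zeta x / 2, of_real ((1 - ht x) / 2))"

definition proj_minus :: "real^3 \<Rightarrow> herm" where
  "proj_minus x = (of_real ((1 - ht x) / 2), - zeta x / 2, of_real ((1 + ht x) / 2))"

definition proj_lin :: "real^3 \<Rightarrow> herm" where
  "proj_lin x = (of_real (ht x / 2), zeta x / 2, of_real (- ht x / 2))"

text \<open>A unit vector on the line of \<open>x\<close>, with non-negative real first coordinate.
  It jumps at the south pole, where no continuous choice could help, since the Hopf fibration has no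
  section. This is harmless: \<open>K\<close> is defined by the projections, and spinors only factor
  it.\<close>

definition spinor :: "real^3 \<Rightarrow> complex \<times> complex" where
  "spinor x = (if ht x = -1 then (0, 1)
     else (of_real (sqrt ((1 + ht x) / 2)), zeta x / complex_of_real (2 * sqrt ((1 + ht x) / 2))))"

definition cospinor :: "real^3 \<Rightarrow> complex \<times> complex" where
  "cospinor x = (- cnj (snd (spinor x)), cnj (fst (spinor x)))"

lemma spinor_facts:
  assumes "x \<in> S2"
  shows "(cmod (fst (spinor x)))\<^sup>2 = (1 + ht x) / 2" "(cmod (snd (spinor x)))\<^sup>2 = (1 - ht x) / 2"
    "snd (spinor x) * cnj (fst (spinor x)) = zeta x / 2"
proof -
  have n: "(cmod (zeta x))\<^sup>2 = 1 - (ht x)\<^sup>2" using norm_frame[of x] assms by simp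
  have h: "\<bar>ht x\<bar> \<le> 1" using abs_ht_le[of x] assms by simp
  have "(cmod (fst (spinor x)))\<^sup>2 = (1 + ht x) / 2 \<and> (cmod (snd (spinor x)))\<^sup>2 = (1 - ht x) / 2 \<and>
    snd (spinor x) * cnj (fst (spinor x)) = zeta x / 2"
  proof (cases "ht x = -1")
    case True
    then show ?thesis using n by (simp add: spinor_def)
  next
    case False
    define s where "s = sqrt ((1 + ht x) / 2)"
    have s2: "s\<^sup>2 = (1 + ht x) / 2" and s: "s > 0" using h False by (auto simp: s_def)
    have fs: "fst (spinor x) = of_real s" "snd (spinor x) = zeta x / of_real (2 * s)"
      using False by (simp_all add: spinor_def s_def)
    have "(cmod (zeta x))\<^sup>2 = (1 - ht x) * (2 * s\<^sup>2)"
      unfolding n s2 by (simp add: power2_eq_square algebra_simps)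
    then have "(cmod (snd (spinor x)))\<^sup>2 = (1 - ht x) / 2"
      unfolding fs using s by (simp add: norm_divide norm_mult power_divide power_mult_distrib)
    moreover have "(cmod (fst (spinor x)))\<^sup>2 = (1 + ht x) / 2" unfolding fs using s2 by simp
    moreover have "snd (spinor x) * cnj (fst (spinor x)) = zeta x / 2" unfolding fs using s by simp
    ultimately show ?thesis by blast
  qed
  then show "(cmod (fst (spinor x)))\<^sup>2 = (1 + ht x) / 2" "(cmod (snd (spinor x)))\<^sup>2 = (1 - ht x) / 2"
    "snd (spinor x) * cnj (fst (spinor x)) = zeta x / 2" by auto
qed

lemma spinor_mult_cnj:
  assumes "x \<in> S2"
  shows "fst (spinor x) * cnj (fst (spinor x)) = of_real ((1 + ht x) / 2)"
    "snd (spinor x) * cnj (snd (spinor x)) = of_real ((1 - ht x) / 2)"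
  unfolding complex_norm_square[symmetric] spinor_facts[OF assms] by simp_all

lemma proj_plus_eq: "x \<in> S2 \<Longrightarrow> proj_plus x = rk1 (spinor x)"
  unfolding proj_plus_def rk1_def split_beta spinor_mult_cnj spinor_facts(3) by simp

lemma proj_minus_eq:
  assumes "x \<in> S2" shows "proj_minus x = rk1 (cospinor x)"
proof -
  have "rk1 (cospinor x) = (snd (spinor x) * cnj (snd (spinor x)), - (snd (spinor x) * cnj (fst (spinor x))),
      fst (spinor x) * cnj (fst (spinor x)))"
    by (simp add: rk1_def cospinor_def mult.commute)
  then show ?thesis
    unfolding spinor_mult_cnj[OF assms] spinor_facts(3)[OF assms] by (simp add: proj_minus_def)
qed

lemma spinor_norms_le:
  assumes "x \<in> S2"
  shows "cmod (fst (spinor x)) \<le> 1" "cmod (snd (spinor x)) \<le> 1"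
    "cmod (fst (cospinor x)) \<le> 1" "cmod (snd (cospinor x)) \<le> 1"
proof -
  have "\<bar>ht x\<bar> \<le> 1" using abs_ht_le[of x] assms by simp
  then have "(cmod (fst (spinor x)))\<^sup>2 \<le> 1" "(cmod (snd (spinor x)))\<^sup>2 \<le> 1"
    using spinor_facts[OF assms] by auto
  then show "cmod (fst (spinor x)) \<le> 1" "cmod (snd (spinor x)) \<le> 1"
    "cmod (fst (cospinor x)) \<le> 1" "cmod (snd (cospinor x)) \<le> 1"
    by (auto simp: cospinor_def abs_square_le_1)
qed

text \<open>The operator norm of \<open>proj_lin X\<close> is \<open>norm X / 2\<close>; the cruder
  estimate through the entries keeps the linear dependence on \<open>norm X\<close>, which is what
  counts.\<close>

lemma norm_hform_proj_lin:
  assumes "cmod (fst u) \<le> 1" "cmod (snd u) \<le> 1" "cmod (fst v) \<le> 1" "cmod (snd v) \<le> 1"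
  shows "cmod (hform (proj_lin X) u v) \<le> 2 * norm X"
proof -
  have p: "cmod (cnj r * c * s) \<le> cmod c" if "cmod r \<le> 1" "cmod s \<le> 1" for r c s
  proof -
    have "cmod (cnj r * c * s) \<le> 1 * cmod c * 1"
      unfolding norm_mult using that by (intro mult_mono) auto
    then show ?thesis by simp
  qed
  have hd: "hform (proj_lin X) u v = cnj (fst u) * (ht X / 2) * fst v + cnj (fst u) * cnj (zeta X / 2) * snd v
      + cnj (snd u) * (zeta X / 2) * fst v + cnj (snd u) * (- ht X / 2) * snd v"
    by (simp add: hform_def proj_lin_def split_beta)
  have "cmod (hform (proj_lin X) u v) \<le> cmod (cnj (fst u) * (ht X / 2) * fst v) + cmod (cnj (fst u) * cnj (zeta X / 2) * snd v)
      + cmod (cnj (snd u) * (zeta X / 2) * fst v) + cmod (cnj (snd u) * (- ht X / 2) * snd v)"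
    unfolding hd by (intro order_trans[OF norm_triangle_ineq] add_mono order_refl)
  also have "\<dots> \<le> cmod (ht X / 2) + cmod (cnj (zeta X / 2)) + cmod (zeta X / 2) + cmod (- ht X / 2)"
    by (intro add_mono p assms)
  also have "\<dots> = \<bar>ht X\<bar> + cmod (zeta X)" by (simp add: norm_divide)
  also have "\<dots> \<le> 2 * norm X" using norm_zeta_le[of X] abs_ht_le[of X] by simp
  finally show ?thesis .
qed

text \<open>The transition probability between the lines of \<open>- x\<close> and \<open>y\<close>
  is \<open>(1 - x \<bullet> y) / 2\<close>, and for unit vectors this is the square of half the
  chord. The antipode is what makes the factor vanish exactly at a collision.\<close>

lemma norm_hprod_cospinor_spinor:
  assumes "x \<in> S2" "y \<in> S2"
  shows "cmod (hprod (cospinor x) (spinor y)) = dist x y / 2"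
    and "cmod (hprod (spinor y) (cospinor x)) = dist x y / 2"
proof -
  obtain p q where s: "spinor x = (p, q)" by force
  obtain p' q' where s': "spinor y = (p', q')" by force
  note fx = spinor_mult_cnj[OF assms(1), unfolded s fst_conv snd_conv] spinor_facts(3)[OF assms(1), unfolded s fst_conv snd_conv]
  note fy = spinor_mult_cnj[OF assms(2), unfolded s' fst_conv snd_conv] spinor_facts(3)[OF assms(2), unfolded s' fst_conv snd_conv]
  have "complex_of_real ((cmod (p * q' - q * p'))\<^sup>2) =
    (p * cnj p) * (q' * cnj q') + (q * cnj q) * (p' * cnj p') - ((q' * cnj p') * cnj (q * cnj p) + cnj (q' * cnj p') * (q * cnj p))"
    unfolding complex_norm_square by (simp add: algebra_simps)
  also have "\<dots> = complex_of_real ((1 + ht x) / 2 * ((1 - ht y) / 2) + (1 - ht x) / 2 * ((1 + ht y) / 2))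
      - (zeta y / 2 * cnj (zeta x / 2) + cnj (zeta y / 2) * (zeta x / 2))"
    unfolding fx fy by simp
  also have "zeta y / 2 * cnj (zeta x / 2) + cnj (zeta y / 2) * (zeta x / 2) = complex_of_real (Re (cnj (zeta x) * zeta y) / 2)"
    by (simp add: complex_eq_iff field_simps)
  also have "complex_of_real ((1 + ht x) / 2 * ((1 - ht y) / 2) + (1 - ht x) / 2 * ((1 + ht y) / 2)) - complex_of_real (Re (cnj (zeta x) * zeta y) / 2)
     = complex_of_real ((1 - x \<bullet> y) / 2)"
    unfolding inner_zeta_ht of_real_diff[symmetric] by (simp add: field_simps)
  finally have 1: "(cmod (p * q' - q * p'))\<^sup>2 = (1 - x \<bullet> y) / 2" by (simp only: of_real_eq_iff)
  have 2: "(dist x y / 2)\<^sup>2 = (1 - x \<bullet> y) / 2"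
  proof -
    have i: "x \<bullet> x = 1" "y \<bullet> y = 1" using assms by (simp_all add: dot_square_norm)
    have "(dist x y)\<^sup>2 = 2 - 2 * (x \<bullet> y)"
      unfolding dist_norm power2_norm_eq_inner inner_diff_left inner_diff_right
      by (simp add: i inner_commute[of y x])
    then show ?thesis by (simp add: power_divide)
  qed
  have "cmod (p * q' - q * p') = dist x y / 2"
    by (rule power2_eq_imp_eq[OF trans[OF 1 2[symmetric]]]) simp_all
  then show "cmod (hprod (cospinor x) (spinor y)) = dist x y / 2"
    by (simp add: hprod_def cospinor_def s s' algebra_simps)
  moreover have "hprod (spinor y) (cospinor x) = cnj (hprod (cospinor x) (spinor y))"
    by (simp add: hprod_def split_beta mult.commute)
  ultimately show "cmod (hprod (spinor y) (cospinor x)) = dist x y / 2" by simp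
qed

definition K :: "real^3 \<Rightarrow> real^3 \<Rightarrow> real^3 \<Rightarrow> real^3 \<Rightarrow> complex" where
  "K x1 x2 x3 x4 = tr4 (proj_minus x1) (proj_plus x3) (proj_minus x2) (proj_plus x4)"

lemma K_spinor:
  assumes "x1 \<in> S2" "x2 \<in> S2" "x3 \<in> S2" "x4 \<in> S2"
  shows "K x1 x2 x3 x4 = hprod (cospinor x1) (spinor x3) * hprod (spinor x3) (cospinor x2) *
     hprod (cospinor x2) (spinor x4) * hprod (spinor x4) (cospinor x1)"
  using assms by (simp add: K_def proj_minus_eq proj_plus_eq tr4_rk1 hform_rk1)

lemma norm_K:
  assumes "x1 \<in> S2" "x2 \<in> S2" "x3 \<in> S2" "x4 \<in> S2"
  shows "cmod (K x1 x2 x3 x4) = dist x1 x3 * dist x2 x3 * dist x2 x4 * dist x1 x4 / 16"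
  using assms by (simp add: K_spinor norm_mult norm_hprod_cospinor_spinor)

text \<open>Each of the four factors is a determinant of two spinors or its conjugate, so exchanging
  the roles of the pairs changes four signs. This covers homeomorphisms that interchange the
  discs.\<close>

lemma K_swap:
  assumes "x1 \<in> S2" "x2 \<in> S2" "x3 \<in> S2" "x4 \<in> S2"
  shows "K x3 x4 x1 x2 = K x1 x2 x3 x4"
proof -
  have *: "hprod (cospinor x) (spinor y) = - hprod (cospinor y) (spinor x)"
     "hprod (spinor x) (cospinor y) = - hprod (spinor y) (cospinor x)" for x y
    by (simp_all add: hprod_def cospinor_def split_beta)
  show ?thesis using assms
    by (simp add: K_spinor *(1)[of x3 x1] *(2)[of x1 x4] *(1)[of x4 x2] *(2)[of x2 x3] mult_ac)
qed

text \<open>For coinciding first points the factors come in conjugate pairs, so the product is a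
  product of squared moduli.\<close>

lemma K_diag:
  assumes "x \<in> S2" "x3 \<in> S2" "x4 \<in> S2"
  shows "K x x x3 x4 = of_real (cmod (K x x x3 x4))"
proof -
  have c: "hprod (spinor y) (cospinor x) = cnj (hprod (cospinor x) (spinor y))" for y
    by (simp add: hprod_def split_beta mult.commute)
  define r where "r = (cmod (hprod (cospinor x) (spinor x3)))\<^sup>2 * (cmod (hprod (cospinor x) (spinor x4)))\<^sup>2"
  have "K x x x3 x4 = complex_of_real r"
    unfolding r_def of_real_mult complex_norm_square using assms by (simp add: K_spinor c mult_ac)
  moreover have "r \<ge> 0" by (simp add: r_def)
  ultimately show ?thesis by simp
qed

lemma bounded_linear_zeta: "bounded_linear zeta"
  by (rule bounded_linear_intro[where K = 1])
     (auto simp: zeta_def[abs_def] complex_eq_iff inner_add_right norm_zeta_le[unfolded zeta_def])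

lemma bounded_linear_ht: "bounded_linear ht"
  unfolding ht_def by (rule bounded_linear_inner_right)

lemma proj_continuous_on [continuous_intros]:
  assumes "continuous_on S f"
  shows "continuous_on S (\<lambda>x. proj_plus (f x))" "continuous_on S (\<lambda>x. proj_minus (f x))"
proof -
  have [continuous_intros]: "continuous_on S (\<lambda>x. zeta (f x))" "continuous_on S (\<lambda>x. ht (f x))"
    using assms bounded_linear.continuous_on[OF bounded_linear_zeta] bounded_linear.continuous_on[OF bounded_linear_ht] by auto
  show "continuous_on S (\<lambda>x. proj_plus (f x))" "continuous_on S (\<lambda>x. proj_minus (f x))"
    unfolding proj_plus_def proj_minus_def by (intro continuous_intros; simp)+
qed

lemma K_continuous_on [continuous_intros]:
  assumes "continuous_on S f1" "continuous_on S f2" "continuous_on S f3" "continuous_on S f4"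
  shows "continuous_on S (\<lambda>x. K (f1 x) (f2 x) (f3 x) (f4 x))"
  unfolding K_def by (intro continuous_intros assms)

lemma bounded_linear_proj_lin: "bounded_linear proj_lin"
proof (subst linear_conv_bounded_linear[symmetric], rule linearI)
  have z: "zeta (x + y) = zeta x + zeta y" "ht (x + y) = ht x + ht y" "zeta (r *\<^sub>R x) = r *\<^sub>R zeta x" "ht (r *\<^sub>R x) = r *\<^sub>R ht x" for x y r
    using bounded_linear_zeta bounded_linear_ht
    by (simp_all add: linear_simps)
  show "proj_lin (x + y) = proj_lin x + proj_lin y" "proj_lin (r *\<^sub>R x) = r *\<^sub>R proj_lin x" for x y r
    by (simp_all add: proj_lin_def z add_divide_distrib scaleR_conv_of_real[where 'a=complex])
qed

lemma proj_has_vector_derivative: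
  assumes "(f has_vector_derivative X) (at t within S)"
  shows "((\<lambda>t. proj_plus (f t)) has_vector_derivative proj_lin X) (at t within S)"
    "((\<lambda>t. proj_minus (f t)) has_vector_derivative - proj_lin X) (at t within S)"
proof -
  have d: "((\<lambda>t. proj_lin (f t)) has_vector_derivative proj_lin X) (at t within S)"
    by (rule bounded_linear.has_vector_derivative[OF bounded_linear_proj_lin assms])
  have e: "proj_plus x = (1/2, 0, 1/2) + proj_lin x" "proj_minus x = (1/2, 0, 1/2) - proj_lin x" for x
    by (simp_all add: proj_plus_def proj_minus_def proj_lin_def add_divide_distrib diff_divide_distrib)
  show "((\<lambda>t. proj_plus (f t)) has_vector_derivative proj_lin X) (at t within S)"
    unfolding e using has_vector_derivative_add[OF has_vector_derivative_const d] by simp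
  show "((\<lambda>t. proj_minus (f t)) has_vector_derivative - proj_lin X) (at t within S)"
    unfolding e using has_vector_derivative_diff[OF has_vector_derivative_const d] by simp
qed

lemma hform_minus: "hform (- h) u v = - hform h u v"
  by (simp add: hform_def split_beta algebra_simps)

text \<open>Differentiation replaces one projection by \<open>proj_lin\<close> of the velocity, up
  to sign. Moving it to the front cyclically leaves two scalar products, precisely those not
  involving the moving point; divided by \<open>cmod K\<close> only the two distances at the moving
  point remain, in the denominator.\<close>

lemma K_path_derivative:
  assumes d: "(f1 has_vector_derivative X1) (at t within S)" "(f2 has_vector_derivative X2) (at t within S)"
    "(f3 has_vector_derivative X3) (at t within S)" "(f4 has_vector_derivative X4) (at t within S)"
    and S: "f1 t \<in> S2" "f2 t \<in> S2" "f3 t \<in> S2" "f4 t \<in> S2"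
  obtains D where "((\<lambda>t. K (f1 t) (f2 t) (f3 t) (f4 t)) has_vector_derivative D) (at t within S)"
    "cmod D \<le> norm X1 * dist (f2 t) (f3 t) * dist (f2 t) (f4 t) / 2
            + norm X2 * dist (f1 t) (f3 t) * dist (f1 t) (f4 t) / 2
            + norm X3 * dist (f1 t) (f4 t) * dist (f2 t) (f4 t) / 2
            + norm X4 * dist (f1 t) (f3 t) * dist (f2 t) (f3 t) / 2"
proof -
  define m where "m = proj_minus" define p where "p = proj_plus"
  define D1 where "D1 = tr4 (- proj_lin X1) (p (f3 t)) (m (f2 t)) (p (f4 t))"
  define D3 where "D3 = tr4 (m (f1 t)) (proj_lin X3) (m (f2 t)) (p (f4 t))"
  define D2 where "D2 = tr4 (m (f1 t)) (p (f3 t)) (- proj_lin X2) (p (f4 t))"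
  define D4 where "D4 = tr4 (m (f1 t)) (p (f3 t)) (m (f2 t)) (proj_lin X4)"
  have der: "((\<lambda>t. K (f1 t) (f2 t) (f3 t) (f4 t)) has_vector_derivative D1 + D3 + D2 + D4) (at t within S)"
    unfolding K_def D1_def D2_def D3_def D4_def m_def p_def
    by (intro tr4_has_vector_derivative proj_has_vector_derivative d)
  have hl: "cmod (hform (proj_lin X) u v * r * s) \<le> 2 * norm X * cmod r * cmod s"
    if "cmod (fst u) \<le> 1" "cmod (snd u) \<le> 1" "cmod (fst v) \<le> 1" "cmod (snd v) \<le> 1" for X u v r s
    unfolding norm_mult using norm_hform_proj_lin[OF that] by (intro mult_right_mono) auto
  have 1: "cmod D1 \<le> norm X1 * dist (f2 t) (f3 t) * dist (f2 t) (f4 t) / 2"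
  proof -
    have "cmod D1 = cmod (hform (proj_lin X1) (spinor (f4 t)) (spinor (f3 t)) * hprod (spinor (f3 t)) (cospinor (f2 t)) * hprod (cospinor (f2 t)) (spinor (f4 t)))"
      unfolding D1_def m_def p_def using S by (simp add: proj_minus_eq proj_plus_eq tr4_rk1 hform_minus norm_mult)
    also have "\<dots> \<le> 2 * norm X1 * (dist (f2 t) (f3 t) / 2) * (dist (f2 t) (f4 t) / 2)"
      by (rule order_trans[OF hl]) (simp_all add: norm_hprod_cospinor_spinor spinor_norms_le S[simplified])
    finally show ?thesis by simp
  qed
  have 2: "cmod D2 \<le> norm X2 * dist (f1 t) (f3 t) * dist (f1 t) (f4 t) / 2"
  proof -
    have "D2 = tr4 (- proj_lin X2) (p (f4 t)) (m (f1 t)) (p (f3 t))"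
      unfolding D2_def by (simp add: tr4_cyclic[of "m (f1 t)"] tr4_cyclic[of "p (f3 t)"])
    then have "cmod D2 = cmod (hform (proj_lin X2) (spinor (f3 t)) (spinor (f4 t)) * hprod (spinor (f4 t)) (cospinor (f1 t)) * hprod (cospinor (f1 t)) (spinor (f3 t)))"
      unfolding m_def p_def using S by (simp add: proj_minus_eq proj_plus_eq tr4_rk1 hform_minus norm_mult)
    also have "\<dots> \<le> 2 * norm X2 * (dist (f1 t) (f4 t) / 2) * (dist (f1 t) (f3 t) / 2)"
      by (rule order_trans[OF hl]) (simp_all add: norm_hprod_cospinor_spinor spinor_norms_le S[simplified])
    finally show ?thesis by (simp add: mult_ac)
  qed
  have 3: "cmod D3 \<le> norm X3 * dist (f1 t) (f4 t) * dist (f2 t) (f4 t) / 2"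
  proof -
    have "D3 = tr4 (proj_lin X3) (m (f2 t)) (p (f4 t)) (m (f1 t))"
      unfolding D3_def by (rule tr4_cyclic)
    then have "cmod D3 = cmod (hform (proj_lin X3) (cospinor (f1 t)) (cospinor (f2 t)) * hprod (cospinor (f2 t)) (spinor (f4 t)) * hprod (spinor (f4 t)) (cospinor (f1 t)))"
      unfolding m_def p_def using S by (simp add: proj_minus_eq proj_plus_eq tr4_rk1)
    also have "\<dots> \<le> 2 * norm X3 * (dist (f2 t) (f4 t) / 2) * (dist (f1 t) (f4 t) / 2)"
      by (rule order_trans[OF hl]) (simp_all add: norm_hprod_cospinor_spinor spinor_norms_le S[simplified])
    finally show ?thesis by (simp add: mult_ac)
  qed
  have 4: "cmod D4 \<le> norm X4 * dist (f1 t) (f3 t) * dist (f2 t) (f3 t) / 2"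
  proof -
    have "D4 = tr4 (proj_lin X4) (m (f1 t)) (p (f3 t)) (m (f2 t))"
      unfolding D4_def by (rule tr4_cyclic[symmetric])
    then have "cmod D4 = cmod (hform (proj_lin X4) (cospinor (f2 t)) (cospinor (f1 t)) * hprod (cospinor (f1 t)) (spinor (f3 t)) * hprod (spinor (f3 t)) (cospinor (f2 t)))"
      unfolding m_def p_def using S by (simp add: proj_minus_eq proj_plus_eq tr4_rk1)
    also have "\<dots> \<le> 2 * norm X4 * (dist (f1 t) (f3 t) / 2) * (dist (f2 t) (f3 t) / 2)"
      by (rule order_trans[OF hl]) (simp_all add: norm_hprod_cospinor_spinor spinor_norms_le S[simplified])
    finally show ?thesis by (simp add: mult_ac)
  qed
  have "cmod (D1 + D3 + D2 + D4) \<le> cmod D1 + cmod D3 + cmod D2 + cmod D4"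
    by (intro order_trans[OF norm_triangle_ineq] add_mono order_refl)
  then show thesis using 1 2 3 4 by (intro that[OF der]) linarith
qed

end

section \<open>Uniqueness of continuous phases, and the group of measure-preserving
  homeomorphisms\<close>

lemma continuous_int_valued_constant:
  fixes w :: "'a::topological_space \<Rightarrow> real"
  assumes "connected S" "continuous_on S w" "\<And>x. x \<in> S \<Longrightarrow> cis (w x) = 1" "x \<in> S" "y \<in> S"
  shows "w x = w y"
proof -
  have n: "\<exists>n::int. w x = 2 * pi * n" if "x \<in> S" for x
  proof -
    have "cos (w x) = 1" using assms(3)[OF that] by (simp add: complex_eq_iff)
    then show ?thesis by (auto simp: cos_one_2pi_int mult_ac)
  qed
  have "w constant_on S"
  proof (rule continuous_discrete_range_constant[OF assms(1,2)], intro exI[of _ "2 * pi"] conjI allI impI)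
    fix x y assume x: "x \<in> S" and y: "y \<in> S \<and> w y \<noteq> w x"
    obtain m n :: int where m: "w x = 2 * pi * m" and n: "w y = 2 * pi * n" using n x y by blast
    have "n \<noteq> m" using m n y by auto
    then have "1 \<le> \<bar>real_of_int (n - m)\<bar>" by linarith
    then have "2 * pi * 1 \<le> 2 * pi * \<bar>real_of_int (n - m)\<bar>" by (intro mult_left_mono) auto
    also have "\<dots> = \<bar>2 * pi * real_of_int (n - m)\<bar>" by (simp add: abs_mult)
    also have "2 * pi * real_of_int (n - m) = w y - w x" unfolding m n by (simp add: right_diff_distrib)
    finally show "2 * pi \<le> norm (w y - w x)" unfolding real_norm_def by (simp only: mult_1_right)
  qed simp
  then show ?thesis using assms(4,5) by (auto simp: constant_on_def)
qed

lemma lift_unique: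
  fixes w w' :: "'a::topological_space \<Rightarrow> real"
  assumes "connected S" "continuous_on S w" "continuous_on S w'" "\<And>x. x \<in> S \<Longrightarrow> cis (w x) = cis (w' x)"
    and "x0 \<in> S" "w x0 = w' x0" "x \<in> S"
  shows "w x = w' x"
proof -
  have "w x - w' x = w x0 - w' x0"
  proof (rule continuous_int_valued_constant[OF assms(1) _ _ assms(7,5)])
    show "continuous_on S (\<lambda>x. w x - w' x)" using assms by (intro continuous_intros)
    show "cis (w y - w' y) = 1" if "y \<in> S" for y
      using assms(4)[OF that] by (simp flip: cis_divide)
  qed
  then show ?thesis using assms(6) by simp
qed

lemma polar_cis_unique:
  assumes "z \<noteq> 0" "z = of_real (cmod z) * cis s" "z = of_real (cmod z) * cis t"
  shows "cis s = cis t"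
proof -
  have "of_real (cmod z) * cis s = of_real (cmod z) * cis t"
    by (rule trans[OF assms(2)[symmetric] assms(3)])
  then show ?thesis using assms(1) by simp
qed

lemma mp_homeosD:
  assumes "f \<in> mp_homeos"
  shows "x \<in> S2 \<Longrightarrow> f x \<in> S2" "inj_on f S2" "continuous_on S2 f" "f ` S2 = S2" "f \<in> extensional S2"
    "f \<in> borel_measurable borel"
  using assms measurable_extensional_sphere[of f] by (auto simp: mp_homeos_def bij_betw_def PiE_iff)

lemma compose_in_mp_homeos:
  assumes f: "f \<in> mp_homeos" and g: "g \<in> mp_homeos"
  shows "compose S2 g f \<in> mp_homeos"
proof -
  note F = mp_homeosD[OF f] and G = mp_homeosD[OF g]
  have d: "distr sphere_area borel f = sphere_area" "distr sphere_area borel g = sphere_area"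
    using f g by (auto simp: mp_homeos_def)
  have "continuous_on S2 (g \<circ> f)"
    using F G by (intro continuous_on_compose) auto
  then have c: "continuous_on S2 (compose S2 g f)"
    by (rule continuous_on_eq) (simp add: compose_def)
  have b: "bij_betw (compose S2 g f) S2 S2"
    using bij_betw_compose[of f S2 S2 g S2] f g by (auto simp: mp_homeos_def)
  have e: "compose S2 g f \<in> S2 \<rightarrow>\<^sub>E S2" using F G by (auto simp: compose_def)
  have m: "f \<in> sphere_area \<rightarrow>\<^sub>M borel" "g \<in> borel \<rightarrow>\<^sub>M borel" "compose S2 g f \<in> sphere_area \<rightarrow>\<^sub>M borel"
    using F G measurable_extensional_sphere[OF e c] by (simp_all cong: measurable_cong_sets)
  have "distr sphere_area borel (compose S2 g f) = distr sphere_area borel (g \<circ> f)"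
    using AE_sphere_area m by (intro distr_cong_AE) (auto elim!: eventually_mono simp: compose_def)
  also have "\<dots> = distr (distr sphere_area borel f) borel g"
    by (rule distr_distr[symmetric]) (use m in auto)
  also have "\<dots> = sphere_area" by (simp add: d)
  finally show ?thesis using b c e by (simp add: mp_homeos_def)
qed

lemma inverse_in_mp_homeos:
  assumes f: "f \<in> mp_homeos"
  obtains g where "g \<in> mp_homeos" "\<And>x. x \<in> S2 \<Longrightarrow> f (g x) = x" "\<And>x. x \<in> S2 \<Longrightarrow> g (f x) = x"
proof -
  note F = mp_homeosD[OF f]
  define g where "g = restrict (the_inv_into S2 f) S2"
  have gf: "g (f x) = x" "f (g x) = x" if "x \<in> S2" for x
    using that F by (auto simp: g_def the_inv_into_f_f f_the_inv_into_f)
  have gS: "g x \<in> S2" if "x \<in> S2" for x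
    using that F the_inv_into_into[OF F(2), of x S2] by (auto simp: g_def)
  have "continuous_on (f ` S2) (the_inv_into S2 f)"
    using F by (intro continuous_on_inv_into) auto
  then have c: "continuous_on S2 g"
    unfolding F(4) by (rule continuous_on_eq) (simp add: g_def)
  have e: "g \<in> S2 \<rightarrow>\<^sub>E S2" using gS by (auto simp: g_def)
  have b: "bij_betw g S2 S2"
    using gf gS F(1) by (intro bij_betw_byWitness[of _ f]) auto
  have m: "f \<in> sphere_area \<rightarrow>\<^sub>M borel" "g \<in> borel \<rightarrow>\<^sub>M borel"
    using F measurable_extensional_sphere[OF e c] by (simp_all cong: measurable_cong_sets)
  have d: "distr sphere_area borel f = sphere_area"
    using f by (auto simp: mp_homeos_def)
  have "distr sphere_area borel g = distr (distr sphere_area borel f) borel g" by (simp add: d)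
  also have "\<dots> = distr sphere_area borel (g \<circ> f)"
    by (rule distr_distr) (use m in auto)
  also have "\<dots> = distr sphere_area sphere_area (\<lambda>x. x)"
  proof (rule distr_cong_AE)
    show "AE x in sphere_area. (g \<circ> f) x = x"
      using AE_sphere_area by (auto elim!: eventually_mono simp: gf)
  qed (use m in \<open>auto cong: measurable_cong_sets\<close>)
  also have "\<dots> = sphere_area" by (rule distr_id)
  finally have "g \<in> mp_homeos" using b c e by (simp add: mp_homeos_def)
  then show thesis using gf by (intro that)
qed

section \<open>Phase lifts over two disjoint discs\<close>

abbreviation quad :: "('a \<Rightarrow> 'b) \<Rightarrow> ('a \<times> 'a) \<times> ('a \<times> 'a) \<Rightarrow> ('b \<times> 'b) \<times> ('b \<times> 'b)" where
  "quad h \<equiv> map_prod (map_prod h h) (map_prod h h)"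

type_synonym quadruple = "((real^3) \<times> (real^3)) \<times> ((real^3) \<times> (real^3))"

locale two_discs = orthonormal_frame +
  fixes U V :: "(real^3) set"
  assumes open_UV: "openin (top_of_set S2) U" "openin (top_of_set S2) V"
    and disjoint_UV: "U \<inter> V = {}"
    and ne_UV: "U \<noteq> {}" "V \<noteq> {}"
    and sc_UV: "simply_connected U" "simply_connected V"
begin

definition Y :: "quadruple set" where
  "Y = (U \<times> U) \<times> (V \<times> V)"

definition Kq :: "quadruple \<Rightarrow> complex" where
  "Kq = (\<lambda>((x1, x2), (x3, x4)). K x1 x2 x3 x4)"

text \<open>On the connected set \<open>Y\<close> a continuous phase is determined up to a multiple
  of \<open>2 * pi\<close>; the last clause removes this freedom and can be met by
  \<open>K_diag\<close>.\<close>

definition is_lift :: "(real^3 \<Rightarrow> real^3) \<Rightarrow> (quadruple \<Rightarrow> real) \<Rightarrow> bool" where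
  "is_lift f w \<longleftrightarrow> continuous_on Y w \<and>
     (\<forall>p\<in>Y. Kq (quad f p) = of_real (cmod (Kq (quad f p))) * cis (w p)) \<and>
     (\<forall>x\<in>U. \<forall>x3\<in>V. \<forall>x4\<in>V. w ((x, x), (x3, x4)) = 0)"

lemma UV_subset: "U \<subseteq> S2" "V \<subseteq> S2"
  using open_UV openin_imp_subset by blast+

lemma connected_UV: "connected U" "connected V"
  using sc_UV simply_connected_imp_connected by blast+

lemma simply_connected_Y: "simply_connected Y"
  unfolding Y_def by (intro simply_connected_Times sc_UV)

lemma connected_Y: "connected Y"
  using simply_connected_Y simply_connected_imp_connected by blast

lemma locally_path_connected_Y: "locally path_connected Y"
proof -
  have "locally path_connected U" "locally path_connected V"
    using open_UV locally_path_connected_sphere locally_open_subset by blast+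
  then show ?thesis unfolding Y_def
    by (intro locally_Times[where P = path_connected and Q = path_connected] path_connected_Times) auto
qed

lemma YE:
  assumes "p \<in> Y"
  obtains x1 x2 x3 x4 where "p = ((x1, x2), (x3, x4))" "x1 \<in> U" "x2 \<in> U" "x3 \<in> V" "x4 \<in> V"
    "x1 \<in> S2" "x2 \<in> S2" "x3 \<in> S2" "x4 \<in> S2" "x1 \<noteq> x3" "x1 \<noteq> x4" "x2 \<noteq> x3" "x2 \<noteq> x4"
proof -
  obtain x1 x2 x3 x4 where p: "p = ((x1, x2), (x3, x4))" by (metis prod.exhaust)
  with assms have "x1 \<in> U" "x2 \<in> U" "x3 \<in> V" "x4 \<in> V" by (auto simp: Y_def)
  with p show thesis using UV_subset disjoint_UV by (intro that[of x1 x2 x3 x4]) (auto simp del: mem_sphere_0)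
qed

lemma Kq_nonzero:
  assumes "p \<in> Y" "inj_on f S2" "f ` S2 \<subseteq> S2"
  shows "Kq (quad f p) \<noteq> 0"
proof -
  obtain x1 x2 x3 x4 where p: "p = ((x1, x2), (x3, x4))" 
    "x1 \<in> S2" "x2 \<in> S2" "x3 \<in> S2" "x4 \<in> S2" "x1 \<noteq> x3" "x1 \<noteq> x4" "x2 \<noteq> x3" "x2 \<noteq> x4"
    using YE[OF assms(1)] by metis
  have "f x1 \<noteq> f x3" "f x1 \<noteq> f x4" "f x2 \<noteq> f x3" "f x2 \<noteq> f x4"
    using p assms(2) by (metis inj_onD)+
  moreover have "f x1 \<in> S2" "f x2 \<in> S2" "f x3 \<in> S2" "f x4 \<in> S2"
    using p assms(3) by blast+
  ultimately have "cmod (Kq (quad f p)) \<noteq> 0" by (simp add: p(1) Kq_def norm_K)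
  then show ?thesis by simp
qed

lemma Kq_continuous_on:
  assumes "continuous_on S g"
  shows "continuous_on S (\<lambda>x. Kq (g x))"
  unfolding Kq_def split_beta by (intro continuous_intros assms)

text \<open>The logarithm is taken on time and \<open>Y\<close> together, which is still simply
  connected and locally path connected. A joint lift is what gives continuity in time; a constant
  family yields the lift of a single map.\<close>

lemma lift_family_exists:
  assumes c: "continuous_on ({0..1} \<times> S2) (\<lambda>(t, x). \<phi> t x)"
    and i: "\<And>t. t \<in> {0..1} \<Longrightarrow> inj_on (\<phi> t) S2" "\<And>t. t \<in> {0..1} \<Longrightarrow> \<phi> t ` S2 \<subseteq> S2"
  obtains w where "continuous_on ({0..1::real} \<times> Y) (\<lambda>(t, p). w t p)" "\<And>t. t \<in> {0..1} \<Longrightarrow> is_lift (\<phi> t) (w t)"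
proof -
  define H where "H = (\<lambda>(t, p). Kq (quad (\<phi> t) p))"
  have cpt: "continuous_on ({0..1} \<times> Y) (\<lambda>q. \<phi> (fst q) (g (snd q)))"
    if "continuous_on Y g" "g ` Y \<subseteq> S2" for g
  proof -
    have "continuous_on ({0..1} \<times> Y) (\<lambda>q. (fst q, g (snd q)))"
      using that by (intro continuous_intros) (auto intro!: continuous_on_compose2[OF that(1)] continuous_intros)
    moreover have "(\<lambda>q. (fst q, g (snd q))) ` ({0..1} \<times> Y) \<subseteq> {0..1} \<times> S2" using that(2) by auto
    ultimately have "continuous_on ({0..1} \<times> Y) (\<lambda>q. case (fst q, g (snd q)) of (t, x) \<Rightarrow> \<phi> t x)"
      by (rule continuous_on_compose2[OF c])
    then show ?thesis by simp
  qed
  have cH: "continuous_on ({0..1} \<times> Y) H"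
  proof -
    have s: "(\<lambda>p. fst (fst p)) ` Y \<subseteq> S2" "(\<lambda>p. snd (fst p)) ` Y \<subseteq> S2" "(\<lambda>p. fst (snd p)) ` Y \<subseteq> S2" "(\<lambda>p. snd (snd p)) ` Y \<subseteq> S2"
      using UV_subset unfolding Y_def by auto
    have "continuous_on ({0..1} \<times> Y) (\<lambda>q. ((\<phi> (fst q) (fst (fst (snd q))), \<phi> (fst q) (snd (fst (snd q)))),
        (\<phi> (fst q) (fst (snd (snd q))), \<phi> (fst q) (snd (snd (snd q))))))"
      by (intro continuous_on_Pair cpt[of "\<lambda>p. fst (fst p)"] cpt[of "\<lambda>p. snd (fst p)"]
          cpt[of "\<lambda>p. fst (snd p)"] cpt[of "\<lambda>p. snd (snd p)"] s) (intro continuous_intros)+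
    from Kq_continuous_on[OF this] show ?thesis
      by (simp add: H_def split_beta map_prod_def)
  qed
  have nz: "H q \<noteq> 0" if "q \<in> {0..1} \<times> Y" for q
    using that Kq_nonzero i by (auto simp: H_def)
  have "simply_connected ({0..1::real} \<times> Y)"
    by (intro simply_connected_Times simply_connected_Y convex_imp_simply_connected) auto
  moreover have "locally path_connected ({0..1::real} \<times> Y)"
    by (intro locally_Times[where P = path_connected and Q = path_connected] path_connected_Times
        locally_path_connected_Y convex_imp_locally_path_connected) auto
  ultimately obtain g where g: "continuous_on ({0..1} \<times> Y) g" "\<And>q. q \<in> {0..1} \<times> Y \<Longrightarrow> H q = exp (g q)"
    using continuous_logarithm_on_simply_connected[OF cH] nz by metis
  have Hg: "H q = of_real (cmod (H q)) * cis (Im (g q))" if "q \<in> {0..1} \<times> Y" for q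
    using g(2)[OF that] by (simp add: exp_eq_polar norm_mult)
  \<comment> \<open>Times and diagonal quadruples together form a connected set on which the phase
    is a multiple of \<open>2 * pi\<close>, hence constant. One constant \<open>c0\<close> therefore
    normalises all times at once.\<close>
  let ?d = "\<lambda>(t::real, x, x3, x4). (t, ((x, x), (x3, x4)))"
  let ?D = "{0..1::real} \<times> U \<times> V \<times> V"
  have dD: "?d q \<in> {0..1} \<times> Y" if "q \<in> ?D" for q using that by (auto simp: Y_def)
  have conD: "connected ?D"
    by (intro connected_Times connected_UV) auto
  have cd: "continuous_on ?D (\<lambda>q. Im (g (?d q)))"
    by (intro continuous_intros continuous_on_compose2[OF g(1)])
       (auto simp: split_beta Y_def intro!: continuous_intros)
  have one: "cis (Im (g (?d q))) = 1" if q: "q \<in> ?D" for q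
  proof -
    obtain t x x3 x4 where qq: "q = (t, x, x3, x4)" by (metis prod.exhaust)
    have m: "t \<in> {0..1}" "x \<in> S2" "x3 \<in> S2" "x4 \<in> S2" using q qq UV_subset by auto
    then have "\<phi> t x \<in> S2" "\<phi> t x3 \<in> S2" "\<phi> t x4 \<in> S2" using i(2) by blast+
    then have "H (?d q) = of_real (cmod (H (?d q)))"
      unfolding qq H_def Kq_def using K_diag by simp
    then have "H (?d q) = of_real (cmod (H (?d q))) * cis 0" by simp
    from polar_cis_unique[OF nz[OF dD[OF q]] Hg[OF dD[OF q]] this] show ?thesis by simp
  qed
  obtain u v where uv: "u \<in> U" "v \<in> V" using ne_UV by blast
  define c0 where "c0 = Im (g (?d (0, u, v, v)))"
  have uvD: "(0, u, v, v) \<in> ?D" using uv by simp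
  have c0: "cis c0 = 1" unfolding c0_def by (rule one[OF uvD])
  define w where "w t p = Im (g (t, p)) - c0" for t p
  show thesis
  proof (rule that)
    show "continuous_on ({0..1} \<times> Y) (\<lambda>(t, p). w t p)"
      unfolding w_def split_beta by (intro continuous_intros) (use g(1) in simp)
    fix t :: real assume t: "t \<in> {0..1}"
    show "is_lift (\<phi> t) (w t)"
      unfolding is_lift_def
    proof (intro conjI ballI)
      show "continuous_on Y (w t)"
        unfolding w_def by (intro continuous_intros continuous_on_compose2[OF g(1)]) (use t in \<open>auto intro!: continuous_intros\<close>)
      fix p assume p: "p \<in> Y"
      have "cis (w t p) = cis (Im (g (t, p)))"
        unfolding w_def using c0 by (simp flip: cis_divide)
      then show "Kq (quad (\<phi> t) p) = of_real (cmod (Kq (quad (\<phi> t) p))) * cis (w t p)"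
        using Hg[of "(t, p)"] t p by (simp add: H_def)
    next
      fix x x3 x4 assume "x \<in> U" "x3 \<in> V" "x4 \<in> V"
      then have "(t, x, x3, x4) \<in> ?D" using t by simp
      from continuous_int_valued_constant[OF conD cd one this uvD]
      show "w t ((x, x), (x3, x4)) = 0" by (simp add: w_def c0_def)
    qed
  qed
qed

text \<open>Set to 0 off \<open>Y\<close> so that it is a Borel function of all quadruples; by
  \<open>W_unique\<close> the choice does not matter for maps in \<open>mp_homeos\<close>.\<close>

definition W :: "(real^3 \<Rightarrow> real^3) \<Rightarrow> quadruple \<Rightarrow> real" where
  "W f = (\<lambda>p. if p \<in> Y then (SOME w. is_lift f w) p else 0)"

lemma is_lift_cong:
  assumes "is_lift f w" "\<And>p. p \<in> Y \<Longrightarrow> w p = w' p"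
  shows "is_lift f w'"
  using assms unfolding is_lift_def
  by (auto simp: Y_def cong: continuous_on_cong)

lemma W_is_lift:
  assumes "f \<in> mp_homeos" shows "is_lift f (W f)"
proof -
  have "continuous_on ({0..1::real} \<times> S2) (\<lambda>(t, x). f x)"
    unfolding split_beta using mp_homeosD[OF assms] by (intro continuous_on_compose2[OF mp_homeosD(3)[OF assms]] continuous_intros) auto
  then obtain w where "\<And>t::real. t \<in> {0..1} \<Longrightarrow> is_lift f (w t)"
    using lift_family_exists[of "\<lambda>_. f"] mp_homeosD[OF assms] by (metis subset_refl)
  then have "is_lift f (w 0)" by simp
  then have "\<exists>w. is_lift f w" by blast
  then have "is_lift f (SOME w. is_lift f w)" by (rule someI_ex)
  then show ?thesis by (rule is_lift_cong) (simp add: W_def)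
qed

lemma is_lift_unique:
  assumes "inj_on f S2" "f ` S2 \<subseteq> S2" and w: "is_lift f w" "p \<in> Y"
    and w': "continuous_on Y w'" "\<And>p. p \<in> Y \<Longrightarrow> Kq (quad f p) = of_real (cmod (Kq (quad f p))) * cis (w' p)"
      "p0 \<in> Y" "w' p0 = w p0"
  shows "w' p = w p"
proof (rule lift_unique[where S = Y and w = w' and w' = w and ?x0.0 = p0])
  show "connected Y" "continuous_on Y w'" "p0 \<in> Y" "w' p0 = w p0" "p \<in> Y" by (fact connected_Y w' w)+
  show "continuous_on Y w" using w by (simp add: is_lift_def)
  fix q assume q: "q \<in> Y"
  have "Kq (quad f q) \<noteq> 0" by (rule Kq_nonzero) fact+
  moreover have "Kq (quad f q) = of_real (cmod (Kq (quad f q))) * cis (w q)"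
    using w(1) q unfolding is_lift_def by blast
  ultimately show "cis (w' q) = cis (w q)" by (rule polar_cis_unique[OF _ w'(2)[OF q]])
qed

lemma W_unique:
  assumes "f \<in> mp_homeos" "is_lift f w" "p \<in> Y"
  shows "w p = W f p"
proof -
  obtain u v where uv: "u \<in> U" "v \<in> V" using ne_UV by blast
  then have "((u, u), (v, v)) \<in> Y" by (simp add: Y_def)
  moreover have "w ((u, u), (v, v)) = W f ((u, u), (v, v))"
    using W_is_lift[OF assms(1)] assms(2) uv unfolding is_lift_def by metis
  ultimately show ?thesis
    using is_lift_unique[OF _ _ W_is_lift[OF assms(1)] assms(3), of w "((u, u), (v, v))"] mp_homeosD[OF assms(1)] assms(2)
    unfolding is_lift_def by (metis subset_refl)
qed

text \<open>Each slice of the joint lift is the normalised lift of that time, so by uniqueness the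
  separately chosen \<open>W (\<phi> t)\<close> fit together.\<close>

lemma W_isotopy_continuous:
  assumes c: "continuous_on ({0..1} \<times> S2) (\<lambda>(t, x). \<phi> t x)"
    and m: "\<And>t. t \<in> {0..1::real} \<Longrightarrow> \<phi> t \<in> mp_homeos" and p: "p \<in> Y"
  shows "continuous_on {0..1} (\<lambda>t. W (\<phi> t) p)"
proof -
  obtain w where w: "continuous_on ({0..1::real} \<times> Y) (\<lambda>(t, p). w t p)" "\<And>t. t \<in> {0..1} \<Longrightarrow> is_lift (\<phi> t) (w t)"
    using lift_family_exists[OF c] mp_homeosD(1,2,4)[OF m] by (metis subset_refl)
  have "continuous_on {0..1} (\<lambda>t. w t p)"
  proof -
    have "continuous_on {0..1::real} (\<lambda>t. (t, p))" "(\<lambda>t. (t, p)) ` {0..1} \<subseteq> {0..1} \<times> Y"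
      using p by (auto intro!: continuous_intros)
    from continuous_on_compose2[OF w(1) this] show ?thesis by simp
  qed
  then show ?thesis
    by (rule continuous_on_eq) (use W_unique[OF m w(2) p] in auto)
qed

text \<open>For a single quadruple, the change of \<open>W\<close> along a path of maps can be
  computed from any continuous phase of \<open>K\<close> along that path; it need not come from a
  lift over \<open>Y\<close>. This is how twists are evaluated.\<close>

lemma W_isotopy_lift:
  assumes c: "continuous_on ({0..1} \<times> S2) (\<lambda>(t, x). \<phi> t x)"
    and m: "\<And>t. t \<in> {0..1::real} \<Longrightarrow> \<phi> t \<in> mp_homeos" and p: "p \<in> Y"
    and w: "continuous_on {0..1} w" "\<And>t. t \<in> {0..1} \<Longrightarrow> Kq (quad (\<phi> t) p) = of_real (cmod (Kq (quad (\<phi> t) p))) * cis (w t)"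
  shows "W (\<phi> 1) p - W (\<phi> 0) p = w 1 - w 0"
proof -
  have "W (\<phi> 1) p - w 1 = W (\<phi> 0) p - w 0"
  proof (rule continuous_int_valued_constant[of "{0..1}" "\<lambda>t. W (\<phi> t) p - w t" 1 0])
    show "continuous_on {0..1} (\<lambda>t. W (\<phi> t) p - w t)"
      by (intro continuous_intros W_isotopy_continuous[OF c m p] w)
    fix t :: real assume t: "t \<in> {0..1}"
    have nz: "Kq (quad (\<phi> t) p) \<noteq> 0"
      using mp_homeosD(2,4)[OF m[OF t]] by (intro Kq_nonzero[OF p]) auto
    have "Kq (quad (\<phi> t) p) = of_real (cmod (Kq (quad (\<phi> t) p))) * cis (W (\<phi> t) p)"
      using W_is_lift[OF m[OF t]] p unfolding is_lift_def by blast
    then have "cis (W (\<phi> t) p) = cis (w t)" by (rule polar_cis_unique[OF nz _ w(2)[OF t]])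
    then show "cis (W (\<phi> t) p - w t) = 1" by (simp flip: cis_divide)
  qed auto
  then show ?thesis by simp
qed

text \<open>A connected disc goes into one of the two open discs; both cannot go into the same one,
  since \<open>h\<close> maps the complement of \<open>L\<close> onto itself.\<close>

lemma stabilizer_cases:
  assumes h: "h \<in> mp_homeos" and L: "h ` L = L" and LUV: "S2 - L = U \<union> V" "L \<subseteq> S2"
  shows "(h ` U \<subseteq> U \<and> h ` V \<subseteq> V) \<or> (h ` U \<subseteq> V \<and> h ` V \<subseteq> U)"
proof -
  note H = mp_homeosD[OF h]
  have hUV: "h ` (U \<union> V) = U \<union> V"
  proof -
    have "h ` (S2 - L) = h ` S2 - h ` L" using H(2) LUV(2) by (simp add: inj_on_image_set_diff)
    then show ?thesis using H(4) L LUV by simp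
  qed
  have sub: "h ` X \<subseteq> U \<or> h ` X \<subseteq> V" if X: "X \<subseteq> U \<union> V" "connected X" for X
  proof -
    have "connected (h ` X)" 
    proof (rule connected_continuous_image[OF continuous_on_subset[OF H(3)] X(2)])
      show "X \<subseteq> S2" by (rule order_trans[OF X(1) Un_least[OF UV_subset]])
    qed
    moreover have "h ` X \<subseteq> U \<union> V" using X hUV by blast
    moreover obtain U' where "open U'" "U = S2 \<inter> U'" using open_UV(1) unfolding openin_open by blast
    moreover obtain V' where "open V'" "V = S2 \<inter> V'" using open_UV(2) unfolding openin_open by blast
    moreover have "h ` X \<subseteq> S2" using \<open>h ` X \<subseteq> U \<union> V\<close> UV_subset by blast
    ultimately have "U' \<inter> h ` X = {} \<or> V' \<inter> h ` X = {}"
      using disjoint_UV by (intro connectedD[of "h ` X" U' V']) blast+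
    then show ?thesis using \<open>h ` X \<subseteq> U \<union> V\<close> \<open>U = S2 \<inter> U'\<close> \<open>V = S2 \<inter> V'\<close> by blast
  qed
  have 1: "h ` U \<subseteq> U \<or> h ` U \<subseteq> V" by (rule sub[OF Un_upper1 connected_UV(1)])
  have 2: "h ` V \<subseteq> U \<or> h ` V \<subseteq> V" by (rule sub[OF Un_upper2 connected_UV(2)])
  have 3: "h ` U \<union> h ` V = U \<union> V" using hUV by (simp only: image_Un)
  have 4: "\<not> (h ` U \<subseteq> U \<and> h ` V \<subseteq> U)"
  proof
    assume "h ` U \<subseteq> U \<and> h ` V \<subseteq> U"
    then have "h ` U \<union> h ` V \<subseteq> U" by simp
    then have "V \<subseteq> U" unfolding 3 by simp
    then show False using disjoint_UV ne_UV(2) by auto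
  qed
  have 5: "\<not> (h ` U \<subseteq> V \<and> h ` V \<subseteq> V)"
  proof
    assume "h ` U \<subseteq> V \<and> h ` V \<subseteq> V"
    then have "h ` U \<union> h ` V \<subseteq> V" by simp
    then have "U \<subseteq> V" unfolding 3 by simp
    then show False using disjoint_UV ne_UV(1) by auto
  qed
  show ?thesis using 1 2 4 5 by meson
qed

lemma id_in_mp_homeos: "restrict id S2 \<in> mp_homeos"
proof -
  have "orthogonal_transformation (\<lambda>x::real^3. x)" by (rule orthogonal_transformation_id)
  then have "restrict (\<lambda>x. x) S2 \<in> mp_homeos" by (rule restrict_orthogonal_in_mp_homeos)
  then show ?thesis unfolding id_def .
qed

text \<open>Sorting the image quadruple so that the points in \<open>U\<close> come first gives a
  continuous self-map \<open>s\<close> of \<open>Y\<close> that preserves the diagonal and, by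
  \<open>K_swap\<close>, the value of \<open>K\<close>. So the lift of the identity composed with
  \<open>s\<close> is a lift for \<open>h\<close>, and uniqueness identifies it with
  \<open>W h\<close>.\<close>

lemma W_stabilizer:
  assumes h: "h \<in> mp_homeos" and p: "p \<in> Y"
    and c: "(h ` U \<subseteq> U \<and> h ` V \<subseteq> V) \<or> (h ` U \<subseteq> V \<and> h ` V \<subseteq> U)"
  shows "W h p = W (restrict id S2) (if h ` U \<subseteq> U then quad h p else prod.swap (quad h p))"
proof -
  note H = mp_homeosD[OF h] and I = W_is_lift[OF id_in_mp_homeos, unfolded is_lift_def]
  define s where "s = (\<lambda>p. if h ` U \<subseteq> U then quad h p else prod.swap (quad h p))"
  have c1: "h ` V \<subseteq> V" if "h ` U \<subseteq> U"
  proof -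
    have "\<not> h ` U \<subseteq> V"
    proof
      assume "h ` U \<subseteq> V"
      then have "h ` U \<subseteq> U \<inter> V" using that by simp
      then show False using disjoint_UV ne_UV(1) by simp
    qed
    then show ?thesis using c by meson
  qed
  have c2: "h ` U \<subseteq> V" "h ` V \<subseteq> U" if "\<not> h ` U \<subseteq> U" using c that by meson+
  have sY: "s q \<in> Y" if "q \<in> Y" for q
  proof (cases "h ` U \<subseteq> U")
    case True
    then have "s q = quad h q" by (simp add: s_def)
    then show ?thesis using that c1[OF True] True by (auto simp: Y_def image_subset_iff)
  next
    case False
    then have "s q = prod.swap (quad h q)" by (simp add: s_def)
    then show ?thesis using that c2[OF False] by (auto simp: Y_def image_subset_iff)
  qed
  have qid: "quad (restrict id S2) q = q" if "q \<in> Y" for q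
    by (rule YE[OF that]) simp
  have Ks: "Kq (s q) = Kq (quad h q)" if "q \<in> Y" for q
  proof -
    obtain x1 x2 x3 x4 where q: "q = ((x1, x2), (x3, x4))" 
      "x1 \<in> S2" "x2 \<in> S2" "x3 \<in> S2" "x4 \<in> S2"
      using YE[OF \<open>q \<in> Y\<close>] by metis
    show ?thesis unfolding s_def Kq_def q(1) using K_swap H(1) q by simp
  qed
  have hc: "continuous_on Y (\<lambda>q. h (g q))" if "continuous_on Y g" "g ` Y \<subseteq> S2" for g
    by (rule continuous_on_compose2[OF H(3) that])
  have gS: "(\<lambda>p. fst (fst p)) ` Y \<subseteq> S2" "(\<lambda>p. snd (fst p)) ` Y \<subseteq> S2" "(\<lambda>p. fst (snd p)) ` Y \<subseteq> S2" "(\<lambda>p. snd (snd p)) ` Y \<subseteq> S2"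
    using UV_subset unfolding Y_def by auto
  have hc4: "continuous_on Y (\<lambda>p. h (fst (fst p)))" "continuous_on Y (\<lambda>p. h (snd (fst p)))"
    "continuous_on Y (\<lambda>p. h (fst (snd p)))" "continuous_on Y (\<lambda>p. h (snd (snd p)))"
    by (intro hc gS continuous_intros)+
  have e: "(\<lambda>p. ((h (fst (fst p)), h (snd (fst p))), (h (fst (snd p)), h (snd (snd p))))) = quad h"
    "(\<lambda>p. ((h (fst (snd p)), h (snd (snd p))), (h (fst (fst p)), h (snd (fst p))))) = (\<lambda>p. prod.swap (quad h p))"
    by (auto simp: fun_eq_iff)
  have "continuous_on Y (quad h)" unfolding e(1)[symmetric] by (intro continuous_on_Pair hc4)
  moreover have "continuous_on Y (\<lambda>p. prod.swap (quad h p))"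
    unfolding e(2)[symmetric] by (intro continuous_on_Pair hc4)
  ultimately have cs: "continuous_on Y s" by (cases "h ` U \<subseteq> U") (simp_all only: s_def if_True if_False)
  obtain u v where uv: "u \<in> U" "v \<in> V" using ne_UV by blast
  define p0 where "p0 = ((u, u), (v, v))"
  have p0: "p0 \<in> Y" using uv by (simp add: Y_def p0_def)
  have "s p0 \<in> Y" by (rule sY[OF p0])
  then have "W (restrict id S2) (s p0) = 0"
    using I unfolding s_def p0_def by (auto simp: Y_def split: if_splits)
  moreover have "W h p0 = 0" using W_is_lift[OF h] uv unfolding is_lift_def p0_def by blast
  ultimately have e0: "W (restrict id S2) (s p0) = W h p0" by simp
  have "W (restrict id S2) (s p) = W h p"
  proof (rule is_lift_unique[where f = h and w = "W h" and p = p and ?p0.0 = p0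
        and w' = "\<lambda>p. W (restrict id S2) (s p)"])
    show "inj_on h S2" "is_lift h (W h)" "p \<in> Y" "p0 \<in> Y" by (fact H(2) W_is_lift[OF h] p p0)+
    show "W (restrict id S2) (s p0) = W h p0" by (rule e0)
    show "h ` S2 \<subseteq> S2" using H(4) by simp
    show "continuous_on Y (\<lambda>p. W (restrict id S2) (s p))"
    proof (rule continuous_on_compose2[OF _ cs])
      show "continuous_on Y (W (restrict id S2))" using I by blast
      show "s ` Y \<subseteq> Y" using sY by blast
    qed
    fix q assume q: "q \<in> Y"
    show "Kq (quad h q) = of_real (cmod (Kq (quad h q))) * cis (W (restrict id S2) (s q))"
    proof -
      have "Kq (quad (restrict id S2) (s q)) =
          of_real (cmod (Kq (quad (restrict id S2) (s q)))) * cis (W (restrict id S2) (s q))"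
        using I sY[OF q] by blast
      then show ?thesis unfolding qid[OF sY[OF q]] Ks[OF q] .
    qed
  qed
  then show ?thesis unfolding s_def by simp
qed

end

section \<open>Speed of the phase and the distance between lifts\<close>

lemma lift_has_derivative:
  fixes k :: "real \<Rightarrow> complex"
  assumes w: "continuous_on S w" "\<And>s. s \<in> S \<Longrightarrow> k s = of_real (cmod (k s)) * cis (w s)" "\<And>s. s \<in> S \<Longrightarrow> k s \<noteq> 0"
    and k: "(k has_vector_derivative k') (at t within S)" and t: "t \<in> S"
  shows "(w has_vector_derivative Im (k' / k t)) (at t within S)"
proof -
  have q: "((\<lambda>s. k s / k t) has_vector_derivative k' / k t) (at t within S)"
    using bounded_linear.has_vector_derivative[OF bounded_linear_divide k] .
  have "(Ln has_field_derivative 1) (at (k t / k t))"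
    using w(3)[OF t] has_field_derivative_Ln[of 1] by simp
  note field_vector_diff_chain_within[OF q has_field_derivative_at_within[OF this]]
  then have "((\<lambda>s. Ln (k s / k t)) has_vector_derivative k' / k t) (at t within S)"
    by (simp add: o_def)
  from bounded_linear.has_vector_derivative[OF bounded_linear_Im this]
  have d: "((\<lambda>s. w t + Im (Ln (k s / k t))) has_vector_derivative Im (k' / k t)) (at t within S)"
    using has_vector_derivative_add[OF has_vector_derivative_const[of "w t"]] by fastforce
  \<comment> \<open>Within \<open>\<delta>\<close> the phases differ by less than \<open>pi\<close>,
    so the principal logarithm of \<open>k s / k t\<close> recovers \<open>w s - w t\<close>
    exactly, and the derivative of the lift reduces to that of \<open>Ln\<close> at 1.\<close>
  obtain \<delta> where del: "\<delta> > 0" "\<And>s. s \<in> S \<Longrightarrow> dist s t < \<delta> \<Longrightarrow> dist (w s) (w t) < pi"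
    using w(1) t unfolding continuous_on_iff by (metis pi_gt_zero)
  have eq: "w t + Im (Ln (k s / k t)) = w s" if s: "s \<in> S" "dist s t < \<delta>" for s
  proof -
    define c where "c = complex_of_real (ln (cmod (k s) / cmod (k t))) + \<i> * of_real (w s - w t)"
    have "exp c = of_real (cmod (k s) / cmod (k t)) * cis (w s - w t)"
      using w(3)[OF s(1)] w(3)[OF t] by (simp add: c_def exp_add exp_of_real cis_conv_exp)
    also have "\<dots> = (of_real (cmod (k s)) * cis (w s)) / (of_real (cmod (k t)) * cis (w t))"
      by (simp add: cis_divide[symmetric])
    also have "\<dots> = k s / k t" using w(2)[OF s(1)] w(2)[OF t] by simp
    finally have "Ln (k s / k t) = Ln (exp c)" by simp
    also have "\<dots> = c"
      using del(2)[OF s] by (intro Ln_exp) (auto simp: c_def dist_real_def)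
    finally show ?thesis by (simp add: c_def)
  qed
  show ?thesis
    by (rule has_vector_derivative_transform_within[OF d del(1) t]) (rule eq)
qed

text \<open>The fundamental theorem for the gauge integral accepts a derivative that merely exists
  at each time; the continuous majorant \<open>G\<close> then carries the estimate over to the
  Lebesgue integral.\<close>

lemma lift_difference_le:
  fixes k :: "real \<Rightarrow> complex"
  assumes w: "continuous_on {0..1} w" "\<And>s. s \<in> {0..1} \<Longrightarrow> k s = of_real (cmod (k s)) * cis (w s)" "\<And>s. s \<in> {0..1} \<Longrightarrow> k s \<noteq> 0"
    and k: "\<And>t. t \<in> {0..1} \<Longrightarrow> \<exists>D. (k has_vector_derivative D) (at t within {0..1}) \<and> cmod D \<le> G t * cmod (k t)"
    and G: "continuous_on {0..1} G" "\<And>t. t \<in> {0..1} \<Longrightarrow> 0 \<le> G t"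
  shows "ennreal \<bar>w 1 - w 0\<bar> \<le> (\<integral>\<^sup>+t. ennreal (G t) * indicator {0..1} t \<partial>lborel)"
proof -
  obtain D where D: "\<And>t. t \<in> {0..1} \<Longrightarrow> (k has_vector_derivative D t) (at t within {0..1})"
    "\<And>t. t \<in> {0..1} \<Longrightarrow> cmod (D t) \<le> G t * cmod (k t)" using k by metis
  have "((\<lambda>t. Im (D t / k t)) has_integral (w 1 - w 0)) {0..1}"
    by (rule fundamental_theorem_of_calculus) (auto intro!: lift_has_derivative[OF w] D)
  then have i: "(\<lambda>t. Im (D t / k t)) integrable_on {0..1}" "integral {0..1} (\<lambda>t. Im (D t / k t)) = w 1 - w 0"
    by (auto simp: has_integral_iff)
  have iG: "G integrable_on {0..1}" by (rule integrable_continuous_real) (rule G)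
  have "norm (integral {0..1} (\<lambda>t. Im (D t / k t))) \<le> integral {0..1} G"
  proof (rule integral_norm_bound_integral[OF i(1) iG])
    fix t :: real assume t: "t \<in> {0..1}"
    have "norm (Im (D t / k t)) \<le> cmod (D t / k t)" using abs_Im_le_cmod by simp
    also have "\<dots> \<le> G t" using D(2)[OF t] w(3)[OF t] by (simp add: norm_divide field_simps)
    finally show "norm (Im (D t / k t)) \<le> G t" .
  qed
  then have "ennreal \<bar>w 1 - w 0\<bar> \<le> ennreal (integral {0..1} G)" unfolding i by (intro ennreal_leI) simp
  also have "\<dots> = (\<integral>\<^sup>+t. ennreal (G t) * indicator {0..1} t \<partial>lborel)"
    by (rule nn_integral_has_integral_lebesgue'[symmetric]) (use G iG in \<open>auto simp: integrable_integral\<close>)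
  finally show ?thesis .
qed

definition quad_measure :: "quadruple measure" where
  "quad_measure = (sphere_area \<Otimes>\<^sub>M sphere_area) \<Otimes>\<^sub>M (sphere_area \<Otimes>\<^sub>M sphere_area)"

lemma sets_quad_measure [measurable_cong, simp]: "sets quad_measure = sets borel"
  unfolding quad_measure_def borel_prod[symmetric] by (intro sets_pair_measure_cong sets_sphere_area)

lemma space_quad_measure [simp]: "space quad_measure = UNIV"
  by (simp add: quad_measure_def space_pair_measure)

interpretation sphere_area2: pair_sigma_finite sphere_area sphere_area ..
interpretation sphere_area2f: finite_measure "sphere_area \<Otimes>\<^sub>M sphere_area"
  by (rule finite_measure_pair_measure) unfold_locales
interpretation sphere_area4: pair_sigma_finite "sphere_area \<Otimes>\<^sub>M sphere_area" "sphere_area \<Otimes>\<^sub>M sphere_area" ..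
interpretation quad_measure: finite_measure quad_measure
  unfolding quad_measure_def by (rule finite_measure_pair_measure) unfold_locales

text \<open>Both orders occur: a term centred at a point of one pair is integrated first over the
  other pair.\<close>

lemma nn_integral_quad_measure:
  assumes "F \<in> borel_measurable borel"
  shows "(\<integral>\<^sup>+p. F p \<partial>quad_measure) =
      (\<integral>\<^sup>+p. (\<integral>\<^sup>+q. F (p, q) \<partial>(sphere_area \<Otimes>\<^sub>M sphere_area)) \<partial>(sphere_area \<Otimes>\<^sub>M sphere_area))"
    and "(\<integral>\<^sup>+p. F p \<partial>quad_measure) =
      (\<integral>\<^sup>+q. (\<integral>\<^sup>+p. F (p, q) \<partial>(sphere_area \<Otimes>\<^sub>M sphere_area)) \<partial>(sphere_area \<Otimes>\<^sub>M sphere_area))"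
proof -
  have "measurable ((sphere_area \<Otimes>\<^sub>M sphere_area) \<Otimes>\<^sub>M (sphere_area \<Otimes>\<^sub>M sphere_area)) (borel :: ennreal measure)
      = measurable borel borel"
    by (rule measurable_cong_sets[OF sets_quad_measure[unfolded quad_measure_def] refl])
  have sf: "sigma_finite_measure (sphere_area \<Otimes>\<^sub>M sphere_area)" by unfold_locales
  from \<open>measurable _ _ = _\<close> have "F \<in> borel_measurable ((sphere_area \<Otimes>\<^sub>M sphere_area) \<Otimes>\<^sub>M (sphere_area \<Otimes>\<^sub>M sphere_area))"
    using assms by simp
  then show "(\<integral>\<^sup>+p. F p \<partial>quad_measure) =
      (\<integral>\<^sup>+p. (\<integral>\<^sup>+q. F (p, q) \<partial>(sphere_area \<Otimes>\<^sub>M sphere_area)) \<partial>(sphere_area \<Otimes>\<^sub>M sphere_area))"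
    "(\<integral>\<^sup>+p. F p \<partial>quad_measure) =
      (\<integral>\<^sup>+q. (\<integral>\<^sup>+p. F (p, q) \<partial>(sphere_area \<Otimes>\<^sub>M sphere_area)) \<partial>(sphere_area \<Otimes>\<^sub>M sphere_area))"
    unfolding quad_measure_def using sigma_finite_measure.nn_integral_fst[OF sf, of F] sphere_area4.nn_integral_snd[of F]
    by simp_all
qed

lemma nn_integral_prod_sphere_area:
  assumes "f \<in> borel_measurable borel" "g \<in> borel_measurable borel"
  shows "(\<integral>\<^sup>+q. f (fst q) * g (snd q) \<partial>(sphere_area \<Otimes>\<^sub>M sphere_area)) =
    (\<integral>\<^sup>+x. f x \<partial>sphere_area) * (\<integral>\<^sup>+x. g x \<partial>sphere_area)"
proof -
  have [measurable]: "f \<in> borel_measurable sphere_area" "g \<in> borel_measurable sphere_area"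
    using assms by (simp_all cong: measurable_cong_sets)
  have "(\<integral>\<^sup>+q. f (fst q) * g (snd q) \<partial>(sphere_area \<Otimes>\<^sub>M sphere_area)) =
      (\<integral>\<^sup>+x. (\<integral>\<^sup>+y. f (fst (x, y)) * g (snd (x, y)) \<partial>sphere_area) \<partial>sphere_area)"
    by (rule sphere_area.nn_integral_fst[symmetric]) measurable
  also have "\<dots> = (\<integral>\<^sup>+x. f x * (\<integral>\<^sup>+y. g y \<partial>sphere_area) \<partial>sphere_area)"
    by (intro nn_integral_cong) (simp add: nn_integral_cmult)
  also have "\<dots> = (\<integral>\<^sup>+x. f x \<partial>sphere_area) * (\<integral>\<^sup>+x. g x \<partial>sphere_area)"
    by (rule nn_integral_multc) measurable
  finally show ?thesis .
qed

lemma AE_sphere_area2: "AE p in sphere_area \<Otimes>\<^sub>M sphere_area. fst p \<in> S2 \<and> snd p \<in> S2"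
proof -
  have [measurable]: "S2 \<in> sets borel" by (intro borel_closed) auto
  show ?thesis
  proof (rule sphere_area2.AE_pair_measure)
    show "{p \<in> space (sphere_area \<Otimes>\<^sub>M sphere_area). fst p \<in> S2 \<and> snd p \<in> S2} \<in> sets (sphere_area \<Otimes>\<^sub>M sphere_area)"
    proof -
      have "{p \<in> space (sphere_area \<Otimes>\<^sub>M sphere_area). fst p \<in> S2 \<and> snd p \<in> S2} = S2 \<times> S2"
        by (auto simp: space_pair_measure)
      then show ?thesis using \<open>S2 \<in> sets borel\<close> by (simp only:) (intro pair_measureI; simp)
    qed
    show "AE x in sphere_area. AE y in sphere_area. fst (x, y) \<in> S2 \<and> snd (x, y) \<in> S2"
      using AE_sphere_area
    proof eventually_elim
      case (elim x)
      show ?case using AE_sphere_area by eventually_elim (use elim in auto)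
    qed
  qed
qed

definition total_area :: ennreal where "total_area = emeasure sphere_area UNIV"

text \<open>The sum runs over the four stars \<open>1 \<rightarrow> 3, 4\<close>, \<open>2 \<rightarrow> 3, 4\<close>, \<open>3 \<rightarrow> 1, 2\<close>, \<open>4 \<rightarrow> 1, 2\<close>.\<close>

lemma nn_integral_star_le:
  assumes n [measurable]: "n \<in> borel_measurable borel" and r [measurable]: "r \<in> borel_measurable borel"
    and J: "\<And>x. x \<in> S2 \<Longrightarrow> (\<integral>\<^sup>+y. r (x, y) \<partial>sphere_area) \<le> J" and sym: "\<And>x y. r (x, y) = r (y, x)"
  shows "(\<integral>\<^sup>+p. (case p of ((x1, x2), (x3, x4)) \<Rightarrow>
     n x1 * (r (x1, x3) * r (x1, x4)) + n x2 * (r (x2, x3) * r (x2, x4)) +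
     n x3 * (r (x1, x3) * r (x2, x3)) + n x4 * (r (x1, x4) * r (x2, x4))) \<partial>quad_measure)
    \<le> 4 * (J\<^sup>2 * total_area * (\<integral>\<^sup>+x. n x \<partial>sphere_area))"
proof -
  let ?N = "sphere_area \<Otimes>\<^sub>M sphere_area"
  have r' [measurable]: "r \<in> borel_measurable (borel \<Otimes>\<^sub>M borel)" using r by (simp add: borel_prod)
  have rx: "(\<lambda>y. r (x, y)) \<in> borel_measurable borel" for x by measurable
  have inner: "(\<integral>\<^sup>+q. r (x, fst q) * r (x, snd q) \<partial>?N) \<le> J\<^sup>2" if "x \<in> S2" for x
    unfolding nn_integral_prod_sphere_area[OF rx rx] power2_eq_square using J[OF that] by (intro mult_mono) auto
  have one: "(\<lambda>_::real^3. 1::ennreal) \<in> borel_measurable borel" by simp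
  have n1: "(\<integral>\<^sup>+p. n (fst p) \<partial>?N) = total_area * (\<integral>\<^sup>+x. n x \<partial>sphere_area)"
    using nn_integral_prod_sphere_area[OF n one] by (simp add: total_area_def mult.commute)
  have n2: "(\<integral>\<^sup>+p. n (snd p) \<partial>?N) = total_area * (\<integral>\<^sup>+x. n x \<partial>sphere_area)"
    using nn_integral_prod_sphere_area[OF one n] by (simp add: total_area_def mult.commute)
  have mN: "(\<lambda>p. n (fst p)) \<in> borel_measurable ?N" "(\<lambda>p. n (snd p)) \<in> borel_measurable ?N"
    by measurable
  have mr: "(\<lambda>q. r (x, fst q) * r (x, snd q)) \<in> borel_measurable ?N" for x by measurable
  have st: "(\<integral>\<^sup>+p. (\<integral>\<^sup>+q. n (g p) * (r (g p, fst q) * r (g p, snd q)) \<partial>?N) \<partial>?N) \<le> J\<^sup>2 * total_area * (\<integral>\<^sup>+x. n x \<partial>sphere_area)"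
    if g: "g = fst \<or> g = snd" for g
  proof -
    have "(\<integral>\<^sup>+p. (\<integral>\<^sup>+q. n (g p) * (r (g p, fst q) * r (g p, snd q)) \<partial>?N) \<partial>?N) \<le> (\<integral>\<^sup>+p. n (g p) * J\<^sup>2 \<partial>?N)"
    proof (rule nn_integral_mono_AE)
      show "AE p in ?N. (\<integral>\<^sup>+q. n (g p) * (r (g p, fst q) * r (g p, snd q)) \<partial>?N) \<le> n (g p) * J\<^sup>2"
        using AE_sphere_area2
      proof eventually_elim
        case (elim p)
        then have "g p \<in> S2" using g by auto
        then show ?case by (subst nn_integral_cmult[OF mr]) (intro mult_left_mono inner, auto)
      qed
    qed
    also have "\<dots> = (\<integral>\<^sup>+p. n (g p) \<partial>?N) * J\<^sup>2"
      by (rule nn_integral_multc) (use mN g in auto)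
    also have "\<dots> = J\<^sup>2 * total_area * (\<integral>\<^sup>+x. n x \<partial>sphere_area)"
      using g n1 n2 by (auto simp: mult_ac)
    finally show ?thesis .
  qed
  let ?c = "\<lambda>p::quadruple. fst (fst p)" let ?d = "\<lambda>p::quadruple. snd (fst p)"
  let ?e = "\<lambda>p::quadruple. fst (snd p)" let ?f = "\<lambda>p::quadruple. snd (snd p)"
  have cm [measurable]: "?c \<in> borel_measurable borel" "?d \<in> borel_measurable borel" "?e \<in> borel_measurable borel" "?f \<in> borel_measurable borel"
    by (intro borel_measurable_continuous_onI continuous_intros)+
  have m1 [measurable]: "(\<lambda>p. n (?c p) * (r (?c p, ?e p) * r (?c p, ?f p))) \<in> borel_measurable borel" by measurable
  have m2 [measurable]: "(\<lambda>p. n (?d p) * (r (?d p, ?e p) * r (?d p, ?f p))) \<in> borel_measurable borel" by measurable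
  have m3 [measurable]: "(\<lambda>p. n (?e p) * (r (?e p, ?c p) * r (?e p, ?d p))) \<in> borel_measurable borel" by measurable
  have m4 [measurable]: "(\<lambda>p. n (?f p) * (r (?f p, ?c p) * r (?f p, ?d p))) \<in> borel_measurable borel" by measurable
  let ?B = "J\<^sup>2 * total_area * (\<integral>\<^sup>+x. n x \<partial>sphere_area)"
  have i1: "(\<integral>\<^sup>+p. n (?c p) * (r (?c p, ?e p) * r (?c p, ?f p)) \<partial>quad_measure) \<le> ?B"
    unfolding nn_integral_quad_measure(1)[OF m1] using st[of fst] by simp
  have i2: "(\<integral>\<^sup>+p. n (?d p) * (r (?d p, ?e p) * r (?d p, ?f p)) \<partial>quad_measure) \<le> ?B"
    unfolding nn_integral_quad_measure(1)[OF m2] using st[of snd] by simp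
  have i3: "(\<integral>\<^sup>+p. n (?e p) * (r (?e p, ?c p) * r (?e p, ?d p)) \<partial>quad_measure) \<le> ?B"
    unfolding nn_integral_quad_measure(2)[OF m3] using st[of fst] by simp
  have i4: "(\<integral>\<^sup>+p. n (?f p) * (r (?f p, ?c p) * r (?f p, ?d p)) \<partial>quad_measure) \<le> ?B"
    unfolding nn_integral_quad_measure(2)[OF m4] using st[of snd] by simp
  have "(\<integral>\<^sup>+p. (case p of ((x1, x2), (x3, x4)) \<Rightarrow>
     n x1 * (r (x1, x3) * r (x1, x4)) + n x2 * (r (x2, x3) * r (x2, x4)) +
     n x3 * (r (x1, x3) * r (x2, x3)) + n x4 * (r (x1, x4) * r (x2, x4))) \<partial>quad_measure) =
    (\<integral>\<^sup>+p. (n (?c p) * (r (?c p, ?e p) * r (?c p, ?f p)) + n (?d p) * (r (?d p, ?e p) * r (?d p, ?f p))) +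
      (n (?e p) * (r (?e p, ?c p) * r (?e p, ?d p)) + n (?f p) * (r (?f p, ?c p) * r (?f p, ?d p))) \<partial>quad_measure)"
    by (intro nn_integral_cong) (auto simp: sym add.assoc split: prod.split)
  also have "\<dots> \<le> (?B + ?B) + (?B + ?B)"
    by (subst nn_integral_add, measurable)+ (intro add_mono i1 i2 i3 i4)
  also have "\<dots> = 4 * ?B"
    by (simp flip: mult_2 mult.assoc)
  finally show ?thesis .
qed

context two_discs
begin

lemma Y_borel [measurable]: "Y \<in> sets borel"
proof -
  have "U \<in> sets borel" "V \<in> sets borel"
    using open_UV by (auto simp: openin_open)
  then have "Y \<in> sets ((borel \<Otimes>\<^sub>M borel) \<Otimes>\<^sub>M (borel \<Otimes>\<^sub>M borel))"
    unfolding Y_def by (intro pair_measureI)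
  then show ?thesis unfolding borel_prod .
qed

lemma W_measurable [measurable]:
  assumes "f \<in> mp_homeos" shows "W f \<in> borel_measurable borel"
  using W_is_lift[OF assms] Y_borel
  by (intro borel_measurable_continuous_on_const_outside[of Y _ 0]) (auto simp: is_lift_def W_def)

text \<open>An integral in \<open>ennreal\<close>, because no lift is known to be integrable;
  finiteness is established only for suitable differences.\<close>

definition dW :: "(real^3 \<Rightarrow> real^3) \<Rightarrow> (real^3 \<Rightarrow> real^3) \<Rightarrow> ennreal" where
  "dW f g = (\<integral>\<^sup>+p. ennreal \<bar>W f p - W g p\<bar> \<partial>quad_measure)"

text \<open>The phase of each quadruple is estimated along its path, and Tonelli exchanges time and
  quadruples. At a fixed time \<open>\<phi> t\<close> composed with \<open>u\<close> preserves area,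
  so the reciprocal distances integrate as for the identity; by the same invariance \<open>u\<close>
  disappears from the speed. Hence the bound does not depend on \<open>u\<close>.\<close>

lemma dW_isotopy_le:
  assumes c: "continuous_on ({0..1} \<times> S2) (\<lambda>(t, x). \<phi> t x)"
    and m: "\<And>t. t \<in> {0..1::real} \<Longrightarrow> \<phi> t \<in> mp_homeos"
    and X: "continuous_on ({0..1} \<times> S2) (\<lambda>(t, x). X t x)"
    and d: "\<And>t x. t \<in> {0..1} \<Longrightarrow> x \<in> S2 \<Longrightarrow> ((\<lambda>s. \<phi> s x) has_vector_derivative X t x) (at t within {0..1})"
    and u: "u \<in> mp_homeos"
  shows "dW (compose S2 (\<phi> 1) u) (compose S2 (\<phi> 0) u) \<le>
    ennreal 32 * ((ennreal (2 * pi\<^sup>2))\<^sup>2 * total_area *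
      (\<integral>\<^sup>+t. indicator {0..1} t * (\<integral>\<^sup>+x. indicator S2 x * ennreal (norm (X t x)) \<partial>sphere_area) \<partial>lborel))"
proof -
  note um = mp_homeosD[OF u]
  define \<psi> where "\<psi> t = compose S2 (\<phi> t) u" for t
  have psi: "\<psi> t \<in> mp_homeos" if "t \<in> {0..1}" for t
    unfolding \<psi>_def by (rule compose_in_mp_homeos[OF u m[OF that]])
  have psix: "\<psi> t x = \<phi> t (u x)" if "x \<in> S2" for t x using that by (simp add: \<psi>_def compose_def)
  have cpsi: "continuous_on ({0..1} \<times> S2) (\<lambda>(t, x). \<psi> t x)"
  proof -
    have "continuous_on ({0..1::real} \<times> S2) (\<lambda>q. (fst q, u (snd q)))"
      by (intro continuous_intros continuous_on_compose2[OF um(3)]) auto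
    moreover have "(\<lambda>q. (fst q, u (snd q))) ` ({0..1} \<times> S2) \<subseteq> {0..1} \<times> S2" using um(1) by auto
    ultimately have "continuous_on ({0..1} \<times> S2) (\<lambda>q. case (fst q, u (snd q)) of (t, x) \<Rightarrow> \<phi> t x)"
      by (rule continuous_on_compose2[OF c])
    then show ?thesis by (rule continuous_on_eq) (auto simp: psix)
  qed
  \<comment> \<open>Extension by 0 off the compact domain gives functions that are Borel jointly in
    time and point, as Tonelli requires.\<close>
  define E where "E q = (if q \<in> {0..1} \<times> S2 then \<phi> (fst q) (snd q) else 0)" for q
  define N where "N q = (if q \<in> {0..1} \<times> S2 then norm (X (fst q) (snd q)) else 0)" for q
  have cS: "{0..1::real} \<times> S2 \<in> sets borel" by (intro borel_closed closed_Times) auto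
  have "continuous_on ({0..1} \<times> S2) E"
    using c by (rule continuous_on_eq) (auto simp: E_def)
  then have "E \<in> borel_measurable borel"
    by (rule borel_measurable_continuous_on_const_outside[OF _ cS]) (simp add: E_def)
  then have Em [measurable]: "E \<in> borel_measurable (borel \<Otimes>\<^sub>M borel)" by (simp add: borel_prod)
  have "continuous_on ({0..1} \<times> S2) N"
    using continuous_on_norm[OF X] by (rule continuous_on_eq) (auto simp: N_def)
  then have "N \<in> borel_measurable borel"
    by (rule borel_measurable_continuous_on_const_outside[OF _ cS]) (simp add: N_def)
  then have Nm [measurable]: "N \<in> borel_measurable (borel \<Otimes>\<^sub>M borel)" by (simp add: borel_prod)
  have u' [measurable]: "u \<in> borel_measurable borel" by (rule um)
  define R where "R t q = 1 / dist (E (t, u (fst q))) (E (t, u (snd q)))" for t q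
  \<comment> \<open>\<open>8 * G\<close> is the bound of \<open>K_path_derivative\<close> divided by
    \<open>cmod K\<close>: the 8 is the coefficient 1/2 there over the 1/16 in
    \<open>norm_K\<close>.\<close>
  define G where "G t = (\<lambda>((x1, x2), (x3, x4)).
     N (t, u x1) * (R t (x1, x3) * R t (x1, x4)) + N (t, u x2) * (R t (x2, x3) * R t (x2, x4)) +
     N (t, u x3) * (R t (x1, x3) * R t (x2, x3)) + N (t, u x4) * (R t (x1, x4) * R t (x2, x4)))" for t
  have N0: "0 \<le> N q" for q by (simp add: N_def)
  have R0: "0 \<le> R t q" for t q by (simp add: R_def)
  have G0: "0 \<le> G t p" for t p by (auto simp: G_def N0 R0 split: prod.split intro!: add_nonneg_nonneg mult_nonneg_nonneg)
  have Gm [measurable]: "(\<lambda>q. G (fst q) (snd q)) \<in> borel_measurable (borel \<Otimes>\<^sub>M ((borel \<Otimes>\<^sub>M borel) \<Otimes>\<^sub>M (borel \<Otimes>\<^sub>M borel)))"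
    unfolding G_def R_def split_beta by measurable
  have pw: "ennreal \<bar>W (\<psi> 1) p - W (\<psi> 0) p\<bar> \<le> (\<integral>\<^sup>+t. ennreal (8 * G t p) * indicator {0..1} t \<partial>lborel)" for p
  proof (cases "p \<in> Y")
    case False
    then show ?thesis by (simp add: W_def)
  next
    case True
    then obtain x1 x2 x3 x4 where p: "p = ((x1, x2), (x3, x4))"
      "x1 \<in> S2" "x2 \<in> S2" "x3 \<in> S2" "x4 \<in> S2" "x1 \<noteq> x3" "x1 \<noteq> x4" "x2 \<noteq> x3" "x2 \<noteq> x4"
      using YE by metis
    define y1 y2 y3 y4 where y: "y1 = u x1" "y2 = u x2" "y3 = u x3" "y4 = u x4"
    have yS: "y1 \<in> S2" "y2 \<in> S2" "y3 \<in> S2" "y4 \<in> S2" using p um(1) unfolding y by blast+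
    have yn: "y1 \<noteq> y3" "y1 \<noteq> y4" "y2 \<noteq> y3" "y2 \<noteq> y4"
      using p um(2) unfolding y inj_on_def by blast+
    define k where "k t = Kq (quad (\<psi> t) p)" for t
    have kK: "k t = K (\<phi> t y1) (\<phi> t y2) (\<phi> t y3) (\<phi> t y4)" for t
      using p by (simp add: k_def Kq_def psix y)
    have kn: "k t \<noteq> 0" if "t \<in> {0..1}" for t
      unfolding k_def using mp_homeosD(2,4)[OF psi[OF that]] by (intro Kq_nonzero[OF True]) auto
    have pS: "\<phi> t y \<in> S2" if "t \<in> {0..1}" "y \<in> S2" for t y using mp_homeosD(1)[OF m[OF that(1)] that(2)] .
    have dn: "dist (\<phi> t y) (\<phi> t z) > 0" if "t \<in> {0..1}" "y \<in> S2" "z \<in> S2" "y \<noteq> z" for t y z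
      using inj_onD[OF mp_homeosD(2)[OF m[OF that(1)]], of y z] that by auto
    have Gy: "G t p = norm (X t y1) * (1 / dist (\<phi> t y1) (\<phi> t y3) * (1 / dist (\<phi> t y1) (\<phi> t y4)))
      + norm (X t y2) * (1 / dist (\<phi> t y2) (\<phi> t y3) * (1 / dist (\<phi> t y2) (\<phi> t y4)))
      + norm (X t y3) * (1 / dist (\<phi> t y1) (\<phi> t y3) * (1 / dist (\<phi> t y2) (\<phi> t y3)))
      + norm (X t y4) * (1 / dist (\<phi> t y1) (\<phi> t y4) * (1 / dist (\<phi> t y2) (\<phi> t y4)))" if "t \<in> {0..1}" for t
      using that yS by (simp add: G_def p(1) R_def E_def N_def flip: y)
    have cphi: "continuous_on {0..1} (\<lambda>t. \<phi> t y)" "continuous_on {0..1} (\<lambda>t. X t y)" if "y \<in> S2" for y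
    proof -
      have tc: "continuous_on {0..1::real} (\<lambda>t. (t, y))" by (intro continuous_intros)
      have im: "(\<lambda>t. (t, y)) ` {0..1::real} \<subseteq> {0..1} \<times> S2" using that by auto
      show "continuous_on {0..1} (\<lambda>t. \<phi> t y)" "continuous_on {0..1} (\<lambda>t. X t y)"
        using continuous_on_compose2[OF c tc im] continuous_on_compose2[OF X tc im] by simp_all
    qed
    have cG: "continuous_on {0..1} (\<lambda>t. 8 * G t p)"
    proof -
      have "continuous_on {0..1} (\<lambda>t. 8 * (norm (X t y1) * (1 / dist (\<phi> t y1) (\<phi> t y3) * (1 / dist (\<phi> t y1) (\<phi> t y4)))
      + norm (X t y2) * (1 / dist (\<phi> t y2) (\<phi> t y3) * (1 / dist (\<phi> t y2) (\<phi> t y4)))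
      + norm (X t y3) * (1 / dist (\<phi> t y1) (\<phi> t y3) * (1 / dist (\<phi> t y2) (\<phi> t y3)))
      + norm (X t y4) * (1 / dist (\<phi> t y1) (\<phi> t y4) * (1 / dist (\<phi> t y2) (\<phi> t y4)))))"
        by (intro continuous_intros cphi yS) (use dn yS yn in \<open>fastforce\<close>)+
      then show ?thesis by (rule continuous_on_eq) (simp add: Gy)
    qed
    have kd: "\<exists>D. (k has_vector_derivative D) (at t within {0..1}) \<and> cmod D \<le> 8 * G t p * cmod (k t)" if t: "t \<in> {0..1}" for t
    proof -
      obtain D where D: "((\<lambda>t. K (\<phi> t y1) (\<phi> t y2) (\<phi> t y3) (\<phi> t y4)) has_vector_derivative D) (at t within {0..1})"
        "cmod D \<le> norm (X t y1) * dist (\<phi> t y2) (\<phi> t y3) * dist (\<phi> t y2) (\<phi> t y4) / 2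
            + norm (X t y2) * dist (\<phi> t y1) (\<phi> t y3) * dist (\<phi> t y1) (\<phi> t y4) / 2
            + norm (X t y3) * dist (\<phi> t y1) (\<phi> t y4) * dist (\<phi> t y2) (\<phi> t y4) / 2
            + norm (X t y4) * dist (\<phi> t y1) (\<phi> t y3) * dist (\<phi> t y2) (\<phi> t y3) / 2"
        by (rule K_path_derivative[OF d[OF t yS(1)] d[OF t yS(2)] d[OF t yS(3)] d[OF t yS(4)]
              pS[OF t yS(1)] pS[OF t yS(2)] pS[OF t yS(3)] pS[OF t yS(4)]])
      have eq: "8 * (X1 * (1 / a * (1 / b)) + X2 * (1 / c' * (1 / d')) + X3 * (1 / a * (1 / c')) + X4 * (1 / b * (1 / d'))) * (a * c' * d' * b / 16)
         = X1 * c' * d' / 2 + X2 * a * b / 2 + X3 * b * d' / 2 + X4 * a * c' / 2"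
        if "a > 0" "b > 0" "c' > 0" "d' > 0" for X1 X2 X3 X4 a b c' d' :: real
        using that by (simp add: field_simps)
      have "8 * G t p * cmod (k t) = norm (X t y1) * dist (\<phi> t y2) (\<phi> t y3) * dist (\<phi> t y2) (\<phi> t y4) / 2
            + norm (X t y2) * dist (\<phi> t y1) (\<phi> t y3) * dist (\<phi> t y1) (\<phi> t y4) / 2
            + norm (X t y3) * dist (\<phi> t y1) (\<phi> t y4) * dist (\<phi> t y2) (\<phi> t y4) / 2
            + norm (X t y4) * dist (\<phi> t y1) (\<phi> t y3) * dist (\<phi> t y2) (\<phi> t y3) / 2"
        unfolding Gy[OF t] kK norm_K[OF pS[OF t yS(1)] pS[OF t yS(2)] pS[OF t yS(3)] pS[OF t yS(4)]]
        by (rule eq) (use dn[OF t] yS yn in auto)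
      then have "cmod D \<le> 8 * G t p * cmod (k t)" using D(2) by linarith
      moreover have "(k has_vector_derivative D) (at t within {0..1})" using D(1) unfolding kK[abs_def] .
      ultimately show ?thesis by blast
    qed
    show ?thesis
    proof (rule lift_difference_le[of "\<lambda>t. W (\<psi> t) p" k])
      show "continuous_on {0..1} (\<lambda>t. W (\<psi> t) p)" by (rule W_isotopy_continuous[OF cpsi psi True])
      show "k s = of_real (cmod (k s)) * cis (W (\<psi> s) p)" if "s \<in> {0..1}" for s
        using W_is_lift[OF psi[OF that]] True unfolding is_lift_def k_def by blast
    qed (use kn kd cG G0 in auto)
  qed
  have "dW (\<psi> 1) (\<psi> 0) \<le> (\<integral>\<^sup>+p. (\<integral>\<^sup>+t. ennreal (8 * G t p) * indicator {0..1} t \<partial>lborel) \<partial>quad_measure)"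
    unfolding dW_def by (intro nn_integral_mono pw)
  also have "\<dots> = (\<integral>\<^sup>+t. (\<integral>\<^sup>+p. ennreal (8 * G t p) * indicator {0..1} t \<partial>quad_measure) \<partial>lborel)"
  proof -
    interpret PQ: pair_sigma_finite lborel quad_measure ..
    have "sets (lborel \<Otimes>\<^sub>M quad_measure) = sets (borel \<Otimes>\<^sub>M ((borel \<Otimes>\<^sub>M borel) \<Otimes>\<^sub>M (borel \<Otimes>\<^sub>M borel)))"
    proof (rule sets_pair_measure_cong)
      show "sets quad_measure = sets ((borel \<Otimes>\<^sub>M borel) \<Otimes>\<^sub>M (borel \<Otimes>\<^sub>M borel))"
        unfolding borel_prod by simp
    qed simp
    from measurable_cong_sets[OF this refl]
    have "(\<lambda>q. G (fst q) (snd q)) \<in> borel_measurable (lborel \<Otimes>\<^sub>M quad_measure)" using Gm by blast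
    then have "(\<lambda>(t, p). ennreal (8 * G t p) * indicator {0..1} t) \<in> borel_measurable (lborel \<Otimes>\<^sub>M quad_measure)"
      unfolding split_beta by measurable
    from PQ.Fubini'[OF this] show ?thesis .
  qed
  \<comment> \<open>The 8 multiplies \<open>G\<close>, and the 4 counts its stars, one for each
    moving point.\<close>
  also have "\<dots> \<le> (\<integral>\<^sup>+t. 8 * (4 * ((ennreal (2 * pi\<^sup>2))\<^sup>2 * total_area * (indicator {0..1} t * (\<integral>\<^sup>+x. indicator S2 x * ennreal (norm (X t x)) \<partial>sphere_area)))) \<partial>lborel)"
  proof (rule nn_integral_mono)
    fix t :: real
    show "(\<integral>\<^sup>+p. ennreal (8 * G t p) * indicator {0..1} t \<partial>quad_measure) \<le>
      8 * (4 * ((ennreal (2 * pi\<^sup>2))\<^sup>2 * total_area * (indicator {0..1} t * (\<integral>\<^sup>+x. indicator S2 x * ennreal (norm (X t x)) \<partial>sphere_area))))"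
    proof (cases "t \<in> {0..1}")
      case False then show ?thesis by simp
    next
      case t: True
      have Rm: "(\<lambda>q. ennreal (R t q)) \<in> borel_measurable borel"
        unfolding R_def borel_prod[symmetric] by measurable
      have nm: "(\<lambda>x. ennreal (N (t, u x))) \<in> borel_measurable borel" by measurable
      have nm': "(\<lambda>x. ennreal (N (t, x))) \<in> borel_measurable borel" by measurable
      have Gt: "G t \<in> borel_measurable borel"
        unfolding G_def R_def split_beta borel_prod[symmetric] by measurable
      \<comment> \<open>Substituting \<open>\<psi> t\<close>, which preserves area, turns distances
        between image points into the distance from one fixed point of the sphere.\<close>
      have J: "(\<integral>\<^sup>+y. ennreal (R t (x, y)) \<partial>sphere_area) \<le> ennreal (2 * pi\<^sup>2)" if x: "x \<in> S2" for x
      proof -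
        have "(\<integral>\<^sup>+y. ennreal (R t (x, y)) \<partial>sphere_area) = (\<integral>\<^sup>+y. ennreal (1 / dist (\<psi> t x) (\<psi> t y)) \<partial>sphere_area)"
        proof (rule nn_integral_cong_AE)
          have E: "E (t, u z) = \<psi> t z" if "z \<in> S2" for z
            using t um(1)[OF that] by (simp add: E_def psix[OF that])
          show "AE y in sphere_area. ennreal (R t (x, y)) = ennreal (1 / dist (\<psi> t x) (\<psi> t y))"
            using AE_sphere_area by eventually_elim (simp only: R_def fst_conv snd_conv E x)
        qed
        also have "\<dots> = (\<integral>\<^sup>+y. ennreal (1 / dist (\<psi> t x) y) \<partial>sphere_area)"
          by (rule nn_integral_mp_homeos[OF psi[OF t]]) measurable
        also have "\<dots> \<le> ennreal (2 * pi\<^sup>2)"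
          by (rule nn_integral_inverse_dist_le) (rule mp_homeosD(1)[OF psi[OF t] x])
        finally show ?thesis .
      qed
      have "(\<integral>\<^sup>+p. ennreal (8 * G t p) * indicator {0..1} t \<partial>quad_measure) = 8 * (\<integral>\<^sup>+p. ennreal (G t p) \<partial>quad_measure)"
        using t G0 Gt by (simp add: ennreal_mult nn_integral_cmult cong: measurable_cong_sets)
      also have "(\<integral>\<^sup>+p. ennreal (G t p) \<partial>quad_measure) \<le> 4 * ((ennreal (2 * pi\<^sup>2))\<^sup>2 * total_area * (\<integral>\<^sup>+x. ennreal (N (t, u x)) \<partial>sphere_area))"
      proof -
        have e: "ennreal (G t p) = (case p of ((x1, x2), (x3, x4)) \<Rightarrow>
           ennreal (N (t, u x1)) * (ennreal (R t (x1, x3)) * ennreal (R t (x1, x4))) + ennreal (N (t, u x2)) * (ennreal (R t (x2, x3)) * ennreal (R t (x2, x4))) +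
           ennreal (N (t, u x3)) * (ennreal (R t (x1, x3)) * ennreal (R t (x2, x3))) + ennreal (N (t, u x4)) * (ennreal (R t (x1, x4)) * ennreal (R t (x2, x4))))" for p
          by (auto simp: G_def N0 R0 ennreal_mult ennreal_plus split: prod.split)
        show ?thesis unfolding e
          by (rule nn_integral_star_le[OF nm Rm J]) (auto simp: R_def dist_commute)
      qed
      also have "(\<integral>\<^sup>+x. ennreal (N (t, u x)) \<partial>sphere_area) = (\<integral>\<^sup>+x. ennreal (N (t, x)) \<partial>sphere_area)"
        by (rule nn_integral_mp_homeos[OF u nm'])
      also have "\<dots> = (\<integral>\<^sup>+x. indicator S2 x * ennreal (norm (X t x)) \<partial>sphere_area)"
        by (intro nn_integral_cong) (use t in \<open>auto simp: N_def indicator_def\<close>)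
      finally show ?thesis using t by (simp add: mult_left_mono)
    qed
  qed
  also have "\<dots> = ennreal 32 * ((ennreal (2 * pi\<^sup>2))\<^sup>2 * total_area *
      (\<integral>\<^sup>+t. indicator {0..1} t * (\<integral>\<^sup>+x. indicator S2 x * ennreal (norm (X t x)) \<partial>sphere_area) \<partial>lborel))"
  proof -
    have "(\<lambda>q. ennreal (N q)) \<in> borel_measurable (lborel \<Otimes>\<^sub>M sphere_area)"
    proof -
      have "sets (lborel \<Otimes>\<^sub>M sphere_area) = sets (borel \<Otimes>\<^sub>M borel)"
        by (rule sets_pair_measure_cong) simp_all
      from measurable_cong_sets[OF this refl]
      have "N \<in> borel_measurable (lborel \<Otimes>\<^sub>M sphere_area)" using Nm by blast
      then show ?thesis by measurable
    qed
    then have "(\<lambda>t. \<integral>\<^sup>+x. ennreal (N (t, x)) \<partial>sphere_area) \<in> borel_measurable lborel"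
      by (rule sphere_area.borel_measurable_nn_integral_fst)
    moreover have "(\<integral>\<^sup>+x. ennreal (N (t, x)) \<partial>sphere_area) = indicator {0..1} t * (\<integral>\<^sup>+x. indicator S2 x * ennreal (norm (X t x)) \<partial>sphere_area)" for t
    proof (cases "t \<in> {0..1}")
      case True
      then show ?thesis by (auto intro!: nn_integral_cong simp: N_def indicator_def)
    next
      case False
      then have "N (t, x) = 0" for x by (auto simp: N_def)
      then show ?thesis using False by simp
    qed
    ultimately have m: "(\<lambda>t. indicator {0..1} t * (\<integral>\<^sup>+x. indicator S2 x * ennreal (norm (X t x)) \<partial>sphere_area)) \<in> borel_measurable lborel"
      by simp
    show ?thesis
      unfolding mult.assoc[symmetric, of 8 4]
      by (subst nn_integral_cmult, use m in measurable) (subst nn_integral_cmult, use m in \<open>auto simp: mult.assoc\<close>)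
  qed
  finally show ?thesis unfolding \<psi>_def .
qed

end

section \<open>Smooth functions of time and space, and paths in the C-infinity topology\<close>

text \<open>Smoothness of all orders is proved without a higher chain rule: a class of functions of time and
  space whose members have spatial derivatives in the same class consists of smooth functions. The
  generators \<open>iter_deriv ws F (x / |x|)\<close> make the radial extension of \<open>F\<close> a member.\<close>

inductive_set SM :: "(real^3 \<Rightarrow> real^3) \<Rightarrow> (real \<Rightarrow> real^3 \<Rightarrow> real) set" for F where
  SM_const: "(\<lambda>t x. c) \<in> SM F"
| SM_time: "(\<lambda>t x. t) \<in> SM F"
| SM_lin: "(\<lambda>t x. x \<bullet> b) \<in> SM F"
| SM_inorm: "(\<lambda>t x. inverse (norm x)) \<in> SM F"
| SM_comp: "(\<lambda>t x. iter_deriv ws F (x /\<^sub>R norm x) \<bullet> b) \<in> SM F"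
| SM_add: "G \<in> SM F \<Longrightarrow> H \<in> SM F \<Longrightarrow> (\<lambda>t x. G t x + H t x) \<in> SM F"
| SM_mult: "G \<in> SM F \<Longrightarrow> H \<in> SM F \<Longrightarrow> (\<lambda>t x. G t x * H t x) \<in> SM F"
| SM_sin: "G \<in> SM F \<Longrightarrow> (\<lambda>t x. sin (G t x)) \<in> SM F"
| SM_cos: "G \<in> SM F \<Longrightarrow> (\<lambda>t x. cos (G t x)) \<in> SM F"

lemma SM_minus: "G \<in> SM F \<Longrightarrow> (\<lambda>t x. - G t x) \<in> SM F"
  using SM_mult[OF SM_const[of "-1"]] by simp

lemma SM_diff: "G \<in> SM F \<Longrightarrow> H \<in> SM F \<Longrightarrow> (\<lambda>t x. G t x - H t x) \<in> SM F"
  using SM_add[OF _ SM_minus] by simp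

lemma SM_sum: "finite A \<Longrightarrow> (\<And>i. i \<in> A \<Longrightarrow> G i \<in> SM F) \<Longrightarrow> (\<lambda>t x. \<Sum>i\<in>A. G i t x) \<in> SM F"
  by (induction A rule: finite_induct) (auto intro: SM_const SM_add)

definition radial_dom :: "(real^3) set \<Rightarrow> (real^3) set" where
  "radial_dom U = {x. x \<noteq> 0 \<and> x /\<^sub>R norm x \<in> U}"

lemma open_radial_dom: "open U \<Longrightarrow> open (radial_dom U)"
  unfolding radial_dom_def by (rule open_normalize_preimage)

lemma iter_deriv_differentiable:
  assumes "smooth_on_open U F" "x \<in> U"
  shows "iter_deriv ws F differentiable (at x)"
  using assms by (simp add: smooth_on_open_def)

lemma has_derivative_normalize:
  fixes x :: "real^3" assumes "x \<noteq> 0"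
  shows "((\<lambda>y. y /\<^sub>R norm y) has_derivative
    (\<lambda>v. v /\<^sub>R norm x - ((x \<bullet> v) * inverse (norm x) ^ 3) *\<^sub>R x)) (at x)"
proof -
  have "((\<lambda>y. inverse (norm y)) has_derivative (\<lambda>v. - (inverse (norm x) * (v \<bullet> sgn x) * inverse (norm x)))) (at x)"
    using assms by (intro Deriv.has_derivative_inverse has_derivative_norm) auto
  from has_derivative_scaleR[OF this has_derivative_ident]
  show ?thesis
    by (rule has_derivative_eq_rhs)
       (auto simp: fun_eq_iff sgn_div_norm power3_eq_cube inner_commute mult_ac)
qed

lemma SM_has_derivative:
  assumes F: "smooth_on_open U F" and H: "H \<in> SM F"
  shows "\<exists>D. (\<forall>v. (\<lambda>t x. D t x v) \<in> SM F) \<and> (\<forall>t. \<forall>x\<in>radial_dom U. (H t has_derivative D t x) (at x))"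
  using H
proof induction
  case (SM_const c)
  show ?case by (rule exI[of _ "\<lambda>t x v. 0"]) (auto intro: SM.SM_const)
next
  case SM_time
  show ?case by (rule exI[of _ "\<lambda>t x v. 0"]) (auto intro: SM.SM_const)
next
  case (SM_lin b)
  show ?case by (rule exI[of _ "\<lambda>t x v. v \<bullet> b"]) (auto intro: SM.SM_const intro!: derivative_eq_intros)
next
  case SM_inorm
  let ?D = "\<lambda>(t::real) (x::real^3) v. - (inverse (norm x) * ((x \<bullet> v) * inverse (norm x)) * inverse (norm x))"
  have "(\<lambda>t x. ?D t x v) \<in> SM F" for v
    by (intro SM_minus SM.SM_mult SM.SM_lin SM.SM_inorm)
  moreover have "((\<lambda>x. inverse (norm x)) has_derivative ?D t x) (at x)" if "x \<in> radial_dom U" for t :: real and x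
  proof -
    have "x \<noteq> 0" using that by (simp add: radial_dom_def)
    then have "((\<lambda>y. inverse (norm y)) has_derivative (\<lambda>v. - (inverse (norm x) * (v \<bullet> sgn x) * inverse (norm x)))) (at x)"
      by (intro Deriv.has_derivative_inverse has_derivative_norm) auto
    moreover have "v \<bullet> sgn x = (x \<bullet> v) * inverse (norm x)" for v
      by (simp add: sgn_div_norm inner_commute[of v x])
    ultimately show ?thesis by simp
  qed
  ultimately show ?case by (intro exI[of _ ?D]) blast
next
  \<comment> \<open>Chain rule through the normalisation: expanding its derivative in the standard
    basis expresses everything by \<open>iter_deriv (c # ws) F\<close> at the normalised point,
    again a generator, of the next order.\<close>
  case (SM_comp ws b)
  let ?n = "\<lambda>x::real^3. x /\<^sub>R norm x"
  let ?dn = "\<lambda>(x::real^3) v. v /\<^sub>R norm x - ((x \<bullet> v) * inverse (norm x) ^ 3) *\<^sub>R x"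
  let ?D = "\<lambda>(t::real) x v. \<Sum>c\<in>Basis. ((v \<bullet> c) * inverse (norm x) - (x \<bullet> v) * (inverse (norm x) * inverse (norm x) * inverse (norm x)) * (x \<bullet> c))
     * (iter_deriv (c # ws) F (?n x) \<bullet> b)"
  have "(\<lambda>t x. ?D t x v) \<in> SM F" for v
    by (intro SM_sum SM_diff SM.SM_mult SM.SM_lin SM.SM_inorm SM.SM_const SM.SM_comp finite_Basis)
  moreover have "((\<lambda>x. iter_deriv ws F (?n x) \<bullet> b) has_derivative ?D t x) (at x)" if x: "x \<in> radial_dom U" for t :: real and x
  proof -
    have x0: "x \<noteq> 0" "?n x \<in> U" using x by (auto simp: radial_dom_def)
    let ?f = "frechet_derivative (iter_deriv ws F) (at (?n x))"
    have f: "(iter_deriv ws F has_derivative ?f) (at (?n x))"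
      using iter_deriv_differentiable[OF F x0(2)] frechet_derivative_works by blast
    then have lin: "linear ?f" using has_derivative_linear by blast
    have "((\<lambda>x. iter_deriv ws F (?n x)) has_derivative (\<lambda>v. ?f (?dn x v))) (at x)"
      by (rule has_derivative_compose[OF has_derivative_normalize[OF x0(1)] f])
    then have "((\<lambda>x. iter_deriv ws F (?n x) \<bullet> b) has_derivative (\<lambda>v. ?f (?dn x v) \<bullet> b)) (at x)"
      by (rule has_derivative_inner_left)
    moreover have "?f (?dn x v) \<bullet> b = ?D t x v" for v :: "real^3"
    proof -
      have "?f (?dn x v) = ?f (\<Sum>c\<in>Basis. (?dn x v \<bullet> c) *\<^sub>R c)" by (simp only: euclidean_representation)
      also have "\<dots> = (\<Sum>c\<in>Basis. (?dn x v \<bullet> c) *\<^sub>R ?f c)"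
        by (simp only: linear_sum[OF lin] linear_scale[OF lin])
      finally have "?f (?dn x v) \<bullet> b = (\<Sum>c\<in>Basis. (?dn x v \<bullet> c) * (?f c \<bullet> b))"
        by (simp only: inner_sum_left inner_scaleR_left)
      also have "\<dots> = ?D t x v"
        by (intro sum.cong refl) (simp add: inner_diff_left power3_eq_cube mult_ac)
      finally show ?thesis .
    qed
    ultimately show ?thesis by simp
  qed
  ultimately show ?case by (intro exI[of _ ?D]) blast
next
  case (SM_add G H)
  then obtain D E where D: "\<And>v. (\<lambda>t x. D t x v) \<in> SM F" "\<And>t x. x \<in> radial_dom U \<Longrightarrow> (G t has_derivative D t x) (at x)"
    and E: "\<And>v. (\<lambda>t x. E t x v) \<in> SM F" "\<And>t x. x \<in> radial_dom U \<Longrightarrow> (H t has_derivative E t x) (at x)" by metis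
  show ?case
    by (rule exI[of _ "\<lambda>t x v. D t x v + E t x v"]) (auto intro!: SM.SM_add D E has_derivative_add)
next
  case (SM_mult G H)
  then obtain D E where D: "\<And>v. (\<lambda>t x. D t x v) \<in> SM F" "\<And>t x. x \<in> radial_dom U \<Longrightarrow> (G t has_derivative D t x) (at x)"
    and E: "\<And>v. (\<lambda>t x. E t x v) \<in> SM F" "\<And>t x. x \<in> radial_dom U \<Longrightarrow> (H t has_derivative E t x) (at x)" by metis
  show ?case
    by (rule exI[of _ "\<lambda>t x v. G t x * E t x v + D t x v * H t x"])
       (auto intro!: SM.SM_add SM.SM_mult D E SM_mult.hyps has_derivative_mult)
next
  case (SM_sin G)
  then obtain D where D: "\<And>v. (\<lambda>t x. D t x v) \<in> SM F" "\<And>t x. x \<in> radial_dom U \<Longrightarrow> (G t has_derivative D t x) (at x)" by metis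
  have "((\<lambda>y. sin (G t y)) has_derivative (\<lambda>v. cos (G t x) * D t x v)) (at x)" if "x \<in> radial_dom U" for t x
    using has_derivative_sin[OF D(2)[OF that]] by (simp add: mult.commute)
  then show ?case
    by (intro exI[of _ "\<lambda>t x v. cos (G t x) * D t x v"] conjI allI ballI SM.SM_mult SM.SM_cos D SM_sin.hyps)
next
  case (SM_cos G)
  then obtain D where D: "\<And>v. (\<lambda>t x. D t x v) \<in> SM F" "\<And>t x. x \<in> radial_dom U \<Longrightarrow> (G t has_derivative D t x) (at x)" by metis
  have "((\<lambda>y. cos (G t y)) has_derivative (\<lambda>v. - (sin (G t x) * D t x v))) (at x)" if "x \<in> radial_dom U" for t x
    using has_derivative_cos[OF D(2)[OF that]] by (simp add: mult.commute)
  then show ?case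
    by (intro exI[of _ "\<lambda>t x v. - (sin (G t x) * D t x v)"] conjI allI ballI SM_minus SM.SM_mult SM.SM_sin D SM_cos.hyps)
qed

lemma SM_continuous:
  assumes F: "smooth_on_open U F" and H: "H \<in> SM F"
  shows "continuous_on (UNIV \<times> radial_dom U) (\<lambda>(t, x). H t x)"
  using H
proof induction
  case (SM_comp ws b)
  have c: "continuous_on U (iter_deriv ws F)"
    by (meson F continuous_at_imp_continuous_on differentiable_imp_continuous_within iter_deriv_differentiable)
  have n: "continuous_on (UNIV \<times> radial_dom U) (\<lambda>q::real \<times> (real^3). snd q /\<^sub>R norm (snd q))"
    by (intro continuous_intros) (auto simp: radial_dom_def)
  have "continuous_on (UNIV \<times> radial_dom U) (\<lambda>q::real \<times> (real^3). iter_deriv ws F (snd q /\<^sub>R norm (snd q)))"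
    by (rule continuous_on_compose2[OF c n]) (auto simp: radial_dom_def)
  then show ?case unfolding split_beta by (intro continuous_intros)
qed (auto simp: split_beta radial_dom_def intro!: continuous_intros)

definition VSM :: "(real^3 \<Rightarrow> real^3) \<Rightarrow> (real \<Rightarrow> real^3 \<Rightarrow> real^3) set" where
  "VSM F = {G. \<forall>i. (\<lambda>t x. G t x $ i) \<in> SM F}"

lemma VSM_has_derivative:
  assumes F: "smooth_on_open U F" and G: "G \<in> VSM F"
  shows "\<exists>D. (\<forall>v. (\<lambda>t x. D t x v) \<in> VSM F) \<and> (\<forall>t. \<forall>x\<in>radial_dom U. (G t has_derivative D t x) (at x))"
proof -
  have "\<forall>i. \<exists>D. (\<forall>v. (\<lambda>t x. D t x v) \<in> SM F) \<and> (\<forall>t. \<forall>x\<in>radial_dom U. ((\<lambda>x. G t x $ i) has_derivative D t x) (at x))"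
    using SM_has_derivative[OF F] G unfolding VSM_def by blast
  then obtain D where D: "\<And>i v. (\<lambda>t x. D i t x v) \<in> SM F"
    "\<And>i t x. x \<in> radial_dom U \<Longrightarrow> ((\<lambda>x. G t x $ i) has_derivative D i t x) (at x)"
    by metis
  have "(G t has_derivative (\<lambda>v. \<chi> i. D i t x v)) (at x)" if "x \<in> radial_dom U" for t x
  proof (subst has_derivative_componentwise_within, intro ballI)
    fix c :: "real^3" assume "c \<in> Basis"
    then obtain i where "c = axis i 1" by (auto simp: Basis_vec_def)
    then show "((\<lambda>x. G t x \<bullet> c) has_derivative (\<lambda>v. (\<chi> i. D i t x v) \<bullet> c)) (at x)"
      using D(2)[OF that, of t i] by (simp add: inner_axis)
  qed
  then show ?thesis using D(1) by (intro exI[of _ "\<lambda>t x v. \<chi> i. D i t x v"]) (auto simp: VSM_def)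
qed

lemma VSM_continuous:
  assumes F: "smooth_on_open U F" and G: "G \<in> VSM F"
  shows "continuous_on (UNIV \<times> radial_dom U) (\<lambda>(t, x). G t x)"
proof -
  have "continuous_on (UNIV \<times> radial_dom U) (\<lambda>q. G (fst q) (snd q) $ i)" for i
    using SM_continuous[OF F, of "\<lambda>t x. G t x $ i"] G by (simp add: VSM_def split_beta)
  then have "continuous_on (UNIV \<times> radial_dom U) (\<lambda>q. \<chi> i. G (fst q) (snd q) $ i)"
    by (rule continuous_on_vec_lambda)
  then show ?thesis by (simp add: split_beta)
qed

lemma frechet_derivative_eq_on_open:
  assumes "open U" "x \<in> U" "\<And>y. y \<in> U \<Longrightarrow> f y = g y"
  shows "frechet_derivative f (at x) = frechet_derivative g (at x)"
proof -
  have "(f has_derivative D) (at x) \<longleftrightarrow> (g has_derivative D) (at x)" for D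
    using has_derivative_transform_within_open[of f D x UNIV U g]
      has_derivative_transform_within_open[of g D x UNIV U f] assms by auto
  then show ?thesis by (simp add: frechet_derivative_def)
qed

lemma iter_deriv_eq_on_open:
  assumes "open U" "\<And>y. y \<in> U \<Longrightarrow> f y = g y" "x \<in> U"
  shows "iter_deriv vs f x = iter_deriv vs g x"
  using assms(3)
proof (induction vs arbitrary: x)
  case Nil then show ?case using assms by simp
next
  case (Cons v vs)
  then show ?case using frechet_derivative_eq_on_open[OF assms(1) Cons.prems Cons.IH] by simp
qed

text \<open>The member \<open>H\<close> serves all times at once, so every spatial derivative is
  jointly continuous in time and space. Continuity of a path in the C-infinity topology rests on
  this.\<close>

lemma VSM_iter_deriv:
  assumes F: "smooth_on_open U F" and G: "G \<in> VSM F"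
  shows "\<exists>H\<in>VSM F. \<forall>t. \<forall>x\<in>radial_dom U. iter_deriv vs (G t) x = H t x"
proof (induction vs)
  case Nil then show ?case using G by auto
next
  case (Cons v vs)
  have op: "open (radial_dom U)" using F by (simp add: smooth_on_open_def open_radial_dom)
  obtain H where H: "H \<in> VSM F" "\<And>t x. x \<in> radial_dom U \<Longrightarrow> iter_deriv vs (G t) x = H t x" using Cons by blast
  obtain D where D: "\<And>v. (\<lambda>t x. D t x v) \<in> VSM F" "\<And>t x. x \<in> radial_dom U \<Longrightarrow> (H t has_derivative D t x) (at x)"
    using VSM_has_derivative[OF F H(1)] by metis
  have "iter_deriv (v # vs) (G t) x = D t x v" if x: "x \<in> radial_dom U" for t x
  proof -
    have "frechet_derivative (iter_deriv vs (G t)) (at x) = frechet_derivative (H t) (at x)"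
      by (rule frechet_derivative_eq_on_open[OF op x]) (rule H(2))
    also have "\<dots> = D t x" using frechet_derivative_at[OF D(2)[OF x]] by simp
    finally show ?thesis by simp
  qed
  then show ?case using D(1) by (intro bexI[of _ "\<lambda>t x. D t x v"]) auto
qed

lemma VSM_smooth:
  assumes F: "smooth_on_open U F" and G: "G \<in> VSM F"
  shows "smooth_on_open (radial_dom U) (G t)"
  unfolding smooth_on_open_def
proof (intro conjI allI ballI)
  show op: "open (radial_dom U)" using F by (simp add: smooth_on_open_def open_radial_dom)
  fix vs x assume x: "x \<in> radial_dom U"
  obtain H where H: "H \<in> VSM F" "\<And>t x. x \<in> radial_dom U \<Longrightarrow> iter_deriv vs (G t) x = H t x"
    using VSM_iter_deriv[OF F G] by blast
  obtain D where D: "(H t has_derivative D) (at x)"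
    using VSM_has_derivative[OF F H(1)] x by blast
  have "(iter_deriv vs (G t) has_derivative D) (at x)"
    by (rule has_derivative_transform_within_open[OF D op x]) (simp add: H(2))
  then show "iter_deriv vs (G t) differentiable (at x)" unfolding differentiable_def by blast
qed

text \<open>Near a point of the sphere the radial extension is a local smooth extension composed
  with the normalisation, which is the generator with the empty list of directions.\<close>

lemma iter_deriv_radial_ext_continuous_on:
  assumes f: "smooth_on S2 f"
  shows "continuous_on S2 (iter_deriv vs (radial_ext f))"
proof (rule continuous_at_imp_continuous_on, intro ballI)
  fix x :: "real^3" assume x: "x \<in> S2"
  then have nx: "x \<noteq> 0" "x /\<^sub>R norm x = x" by auto
  obtain U F where U: "x \<in> U" "smooth_on_open U F" "\<forall>y \<in> U \<inter> S2. F y = f y"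
    using f x unfolding smooth_on_def by blast
  have op: "open (radial_dom U)" using U by (simp add: smooth_on_open_def open_radial_dom)
  have xd: "x \<in> radial_dom U" using U(1) nx by (simp add: radial_dom_def)
  define G where "G = (\<lambda>(t::real) x. F (x /\<^sub>R norm x))"
  have "(\<lambda>t x. G t x $ i) \<in> SM F" for i
    using SM_comp[of "[]" F "axis i 1"] by (simp add: G_def inner_axis)
  then have G: "G \<in> VSM F" by (simp add: VSM_def)
  have eq: "radial_ext f y = G 0 y" if "y \<in> radial_dom U" for y
  proof -
    have "y /\<^sub>R norm y \<in> U \<inter> S2" using that by (simp add: radial_dom_def)
    then show ?thesis using U(3) by (simp add: radial_ext_def G_def)
  qed
  have "iter_deriv vs (G 0) differentiable (at x)"
    by (rule iter_deriv_differentiable[OF VSM_smooth[OF U(2) G] xd])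
  then have c: "isCont (iter_deriv vs (G 0)) x" by (rule differentiable_imp_continuous_within)
  have ev: "\<forall>\<^sub>F y in nhds x. iter_deriv vs (radial_ext f) y = iter_deriv vs (G 0) y"
    unfolding eventually_nhds by (intro exI[of _ "radial_dom U"] conjI op xd ballI iter_deriv_eq_on_open[OF op eq])
  then show "isCont (iter_deriv vs (radial_ext f)) x" using isCont_cong[OF ev] c by simp
qed

text \<open>A subbasic neighbourhood tests finitely many derivatives, as \<open>Basis\<close> is
  finite and the order is bounded. For each of them the set of admissible times is open, because the
  derivative is jointly continuous and the sphere is compact.\<close>

lemma Cinf_continuous_path:
  assumes F: "smooth_on_open U F" "S2 \<subseteq> U" and G: "G \<in> VSM F"
    and g: "\<And>t. t \<in> T \<Longrightarrow> g t \<in> area_diffeos" "\<And>t x. t \<in> T \<Longrightarrow> x \<noteq> 0 \<Longrightarrow> radial_ext (g t) x = G t x"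
  shows "continuous_map (top_of_set T) Cinf_topology g"
  unfolding Cinf_topology_def
proof (rule continuous_on_generated_topo)
  have S2: "S2 \<subseteq> radial_dom U" using F(2) by (auto simp: radial_dom_def)
  show "g ` topspace (top_of_set T) \<subseteq> \<Union> {Cinf_nhd f n \<epsilon> | f n \<epsilon>. f \<in> area_diffeos \<and> 0 < \<epsilon>}"
  proof
    fix h assume "h \<in> g ` topspace (top_of_set T)"
    then have h: "h \<in> area_diffeos" using g by auto
    then have "h \<in> Cinf_nhd h 0 1" by (simp add: Cinf_nhd_def)
    moreover have "Cinf_nhd h 0 1 \<in> {Cinf_nhd f n \<epsilon> | f n \<epsilon>. f \<in> area_diffeos \<and> 0 < \<epsilon>}"
      using h by (intro CollectI exI[of _ h] exI[of _ "0::nat"] exI[of _ "1::real"]) simp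
    ultimately show "h \<in> \<Union> {Cinf_nhd f n \<epsilon> | f n \<epsilon>. f \<in> area_diffeos \<and> 0 < \<epsilon>}" by (rule UnionI[rotated])
  qed
  fix N assume "N \<in> {Cinf_nhd f n \<epsilon> | f n \<epsilon>. f \<in> area_diffeos \<and> 0 < \<epsilon>}"
  then obtain f n \<epsilon> where N: "N = Cinf_nhd f n \<epsilon>" "f \<in> area_diffeos" "0 < \<epsilon>" by blast
  define L where "L = {vs \<in> lists (Basis :: (real^3) set). length vs \<le> n}"
  have "L = {vs. set vs \<subseteq> Basis \<and> length vs \<le> n}" by (auto simp: L_def lists_eq_set)
  then have finL: "finite L" by (simp add: finite_lists_length_le)
  define A where "A vs = {t \<in> T. \<forall>x\<in>S2. norm (iter_deriv vs (G t) x - iter_deriv vs (radial_ext f) x) < \<epsilon>}" for vs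
  have opA: "openin (top_of_set T) (A vs)" for vs
  proof -
    obtain H where H: "H \<in> VSM F" "\<And>t x. x \<in> radial_dom U \<Longrightarrow> iter_deriv vs (G t) x = H t x"
      using VSM_iter_deriv[OF F(1) G] by blast
    define d where "d q = norm (H (snd q) (fst q) - iter_deriv vs (radial_ext f) (fst q))" for q
    have sf: "smooth_on S2 f" using N(2) by (simp add: area_diffeos_def sphere_diffeo_def)
    have sw: "continuous_on (S2 \<times> T) (\<lambda>q. (snd q, fst q))" by (intro continuous_intros)
    have "(\<lambda>q. (snd q, fst q)) ` (S2 \<times> T) \<subseteq> UNIV \<times> radial_dom U" using S2 by auto
    from continuous_on_compose2[OF VSM_continuous[OF F(1) H(1)] sw this]
    have "continuous_on (S2 \<times> T) (\<lambda>q. H (snd q) (fst q))" by simp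
    moreover have "continuous_on (S2 \<times> T) (\<lambda>q. iter_deriv vs (radial_ext f) (fst q))"
      by (rule continuous_on_compose2[OF iter_deriv_radial_ext_continuous_on[OF sf]]) (auto intro!: continuous_intros)
    ultimately have cd: "continuous_on (S2 \<times> T) d" unfolding d_def by (intro continuous_intros)
    \<comment> \<open>The bad times are the projection of a closed set along the compact sphere,
      hence closed.\<close>
    have "closedin (top_of_set (S2 \<times> T)) ((S2 \<times> T) \<inter> d -` {\<epsilon>..})"
      by (rule continuous_closedin_preimage[OF cd]) auto
    from closedin_compact_projection[OF compact_sphere this]
    have "closedin (top_of_set T) {t. \<exists>x. x \<in> S2 \<and> (x, t) \<in> (S2 \<times> T) \<inter> d -` {\<epsilon>..}}" .
    then have op: "openin (top_of_set T) (T - {t. \<exists>x. x \<in> S2 \<and> (x, t) \<in> (S2 \<times> T) \<inter> d -` {\<epsilon>..}})"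
      by (rule openin_diff[OF openin_subtopology_self])
    have e1: "T - {t. \<exists>x. x \<in> S2 \<and> (x, t) \<in> (S2 \<times> T) \<inter> d -` {\<epsilon>..}} = {t \<in> T. \<forall>x\<in>S2. d (x, t) < \<epsilon>}"
      by (auto simp: Ball_def not_le[symmetric])
    have deq: "d (x, t) = norm (iter_deriv vs (G t) x - iter_deriv vs (radial_ext f) x)" if "x \<in> S2" for t x
      using H(2)[of x] S2 that by (auto simp: d_def)
    have "{t \<in> T. \<forall>x\<in>S2. d (x, t) < \<epsilon>} = A vs"
      unfolding A_def by (intro Collect_cong conj_cong refl ball_cong) (simp only: deq)
    then show ?thesis using op unfolding e1 by simp
  qed
  have "g -` N \<inter> topspace (top_of_set T) = (\<Inter>vs\<in>L. A vs) \<inter> T"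
  proof -
    have it: "iter_deriv vs (radial_ext (g t)) x = iter_deriv vs (G t) x" if "t \<in> T" "x \<in> S2" for t x vs
      by (rule iter_deriv_eq_on_open[of "- {0}"]) (use that g in auto)
    show ?thesis
    proof (intro subset_antisym subsetI)
      fix t assume "t \<in> g -` N \<inter> topspace (top_of_set T)"
      then have t: "t \<in> T" "g t \<in> N" by auto
      have "t \<in> A vs" if "vs \<in> L" for vs
        using t that unfolding N(1) Cinf_nhd_def A_def L_def by (simp add: it del: mem_sphere_0)
      then show "t \<in> (\<Inter>vs\<in>L. A vs) \<inter> T" using t by simp
    next
      fix t assume "t \<in> (\<Inter>vs\<in>L. A vs) \<inter> T"
      then have t: "t \<in> T" "\<And>vs. vs \<in> L \<Longrightarrow> t \<in> A vs" by auto
      have "norm (iter_deriv vs (radial_ext (g t)) x - iter_deriv vs (radial_ext f) x) < \<epsilon>"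
        if "vs \<in> lists Basis" "length vs \<le> n" "x \<in> S2" for vs x
        using t(2)[of vs] that it[OF t(1) that(3), of vs] unfolding A_def L_def by (simp del: mem_sphere_0)
      then show "t \<in> g -` N \<inter> topspace (top_of_set T)"
        using t(1) g(1)[OF t(1)] unfolding N(1) Cinf_nhd_def by (simp del: mem_sphere_0)
    qed
  qed
  also have "openin (top_of_set T) \<dots>"
  proof (cases "L = {}")
    case False
    then show ?thesis using finL opA by (intro openin_Int openin_INT2 openin_subtopology_self) auto
  qed simp
  finally show "openin (top_of_set T) (g -` N \<inter> topspace (top_of_set T))" .
qed

section \<open>The twist flow about the axis of the frame\<close>

context orthonormal_frame
begin

definition twist_ext :: "real \<Rightarrow> real^3 \<Rightarrow> real^3" where
  "twist_ext t x =
     (cos (t * (e \<bullet> x)) * (a \<bullet> x) - sin (t * (e \<bullet> x)) * (b \<bullet> x)) *\<^sub>R a +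
     (sin (t * (e \<bullet> x)) * (a \<bullet> x) + cos (t * (e \<bullet> x)) * (b \<bullet> x)) *\<^sub>R b + (e \<bullet> x) *\<^sub>R e"

definition twist :: "real \<Rightarrow> real^3 \<Rightarrow> real^3" where
  "twist t = restrict (twist_ext t) S2"

lemma frame_coords:
  "a \<bullet> (p *\<^sub>R a + q *\<^sub>R b + r *\<^sub>R e) = p" "b \<bullet> (p *\<^sub>R a + q *\<^sub>R b + r *\<^sub>R e) = q"
  "e \<bullet> (p *\<^sub>R a + q *\<^sub>R b + r *\<^sub>R e) = r"
  using unit orth by (simp_all add: inner_add_right inner_commute[of b a] inner_commute[of e a] inner_commute[of e b])

lemma twist_ext_frame:
  "a \<bullet> twist_ext t x = cos (t * (e \<bullet> x)) * (a \<bullet> x) - sin (t * (e \<bullet> x)) * (b \<bullet> x)"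
  "b \<bullet> twist_ext t x = sin (t * (e \<bullet> x)) * (a \<bullet> x) + cos (t * (e \<bullet> x)) * (b \<bullet> x)"
  "e \<bullet> twist_ext t x = e \<bullet> x"
  unfolding twist_ext_def by (rule frame_coords)+

lemma zeta_twist_ext: "zeta (twist_ext t x) = cis (t * ht x) * zeta x"
  by (simp add: zeta_def ht_def twist_ext_frame complex_eq_iff)

lemma ht_twist_ext: "ht (twist_ext t x) = ht x"
  by (simp add: ht_def twist_ext_frame)

lemma norm_twist_ext: "norm (twist_ext t x) = norm x"
proof -
  have "(norm (twist_ext t x))\<^sup>2 = (norm x)\<^sup>2"
    by (simp only: norm_frame zeta_twist_ext ht_twist_ext norm_mult norm_cis mult_1_left)
  then show ?thesis by (rule power2_eq_imp_eq) simp_all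
qed

lemma frame_eqI:
  assumes "zeta x = zeta y" "ht x = ht y" shows "x = y"
proof -
  have "a \<bullet> x = a \<bullet> y" "b \<bullet> x = b \<bullet> y" "e \<bullet> x = e \<bullet> y" using assms by (auto simp: zeta_def ht_def)
  then show ?thesis using frame_expand[of x] frame_expand[of y] by simp
qed

lemma twist_ext_add: "twist_ext s (twist_ext t x) = twist_ext (s + t) x"
  by (rule frame_eqI) (simp_all add: zeta_twist_ext ht_twist_ext cis_mult distrib_right flip: mult.assoc)

lemma twist_ext_0: "twist_ext 0 x = x"
  by (rule frame_eqI) (simp_all add: zeta_twist_ext ht_twist_ext)

lemma twist_in_sphere: "x \<in> S2 \<Longrightarrow> twist_ext t x \<in> S2"
  by (simp add: norm_twist_ext)

lemma bij_betw_twist: "bij_betw (twist t) S2 S2"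
  by (rule bij_betw_byWitness[of _ "twist (- t)"])
     (auto simp: twist_def norm_twist_ext twist_ext_add twist_ext_0)

lemma twist_add: "x \<in> S2 \<Longrightarrow> twist s (twist t x) = twist (s + t) x"
  by (simp add: twist_def norm_twist_ext twist_ext_add)

lemma twist_0: "twist 0 = restrict id S2"
  by (auto simp: twist_def twist_ext_0 fun_eq_iff)

lemma twist_funpow: "restrict (twist 1 ^^ k) S2 = twist (real k)"
proof -
  have "(twist 1 ^^ k) x = twist (real k) x" if "x \<in> S2" for x
  proof (induction k)
    case 0 then show ?case using that by (simp add: twist_0)
  next
    case (Suc k) then show ?case using that by (simp add: twist_add add.commute)
  qed
  then show ?thesis by (auto simp: fun_eq_iff twist_def)
qed

definition radial_twist :: "real \<Rightarrow> real^3 \<Rightarrow> real^3" where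
  "radial_twist t x = twist_ext t (x /\<^sub>R norm x)"

lemma radial_ext_twist: "x \<noteq> 0 \<Longrightarrow> radial_ext (twist t) x = radial_twist t x"
  by (simp add: radial_ext_def radial_twist_def twist_def)

lemma smooth_zero: "smooth_on_open UNIV (\<lambda>_::real^3. 0::real^3)"
proof -
  have "iter_deriv vs (\<lambda>_::real^3. 0::real^3) = (\<lambda>_. 0)" for vs
    by (induction vs) (auto simp: frechet_derivative_const)
  then show ?thesis by (simp add: smooth_on_open_def)
qed

text \<open>The twist is an explicit trigonometric expression in time, coordinates and the inverse
  norm, so the class generated over the zero map already contains it.\<close>

lemma radial_twist_VSM: "radial_twist \<in> VSM (\<lambda>_. 0)"
proof -
  let ?i = "\<lambda>x::real^3. inverse (norm x)"
  have eq: "radial_twist t x $ i =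
     (cos (t * ((x \<bullet> e) * ?i x)) * ((x \<bullet> a) * ?i x) - sin (t * ((x \<bullet> e) * ?i x)) * ((x \<bullet> b) * ?i x)) * (a $ i) +
     (sin (t * ((x \<bullet> e) * ?i x)) * ((x \<bullet> a) * ?i x) + cos (t * ((x \<bullet> e) * ?i x)) * ((x \<bullet> b) * ?i x)) * (b $ i) +
     ((x \<bullet> e) * ?i x) * (e $ i)" for t x i
    unfolding radial_twist_def twist_ext_def
    by (simp add: inner_commute[of _ x] mult.commute)
  show ?thesis unfolding VSM_def mem_Collect_eq eq
    by (intro allI SM_add SM_diff SM_mult SM_cos SM_sin SM_time SM_lin SM_inorm SM_const)
qed

lemma smooth_twist: "smooth_on S2 (twist t)"
proof -
  have "smooth_on_open (radial_dom UNIV) (radial_twist t)"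
    by (rule VSM_smooth[OF smooth_zero radial_twist_VSM])
  moreover have "radial_twist t x = twist t x" if "x \<in> S2" for x
    using that by (simp add: radial_twist_def twist_def)
  ultimately show ?thesis
    unfolding smooth_on_def by (intro ballI exI[of _ "radial_dom UNIV"] exI[of _ "radial_twist t"]) (auto simp: radial_dom_def)
qed

lemma inv_into_twist: "x \<in> S2 \<Longrightarrow> inv_into S2 (twist t) x = twist (- t) x"
  using bij_betw_twist[of t]
  by (intro inv_into_f_eq) (auto simp: bij_betw_def twist_add twist_0 twist_def norm_twist_ext twist_ext_add twist_ext_0)

lemma smooth_on_cong:
  assumes "smooth_on S f" "\<And>x. x \<in> S \<Longrightarrow> f x = g x" shows "smooth_on S g"
  unfolding smooth_on_def
proof
  fix x assume "x \<in> S"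
  then obtain U F where "x \<in> U" "smooth_on_open U F" "\<forall>y \<in> U \<inter> S. F y = f y"
    using assms(1) unfolding smooth_on_def by blast
  then show "\<exists>U F. x \<in> U \<and> smooth_on_open U F \<and> (\<forall>y \<in> U \<inter> S. F y = g y)"
    using assms(2) by (intro exI[of _ U] exI[of _ F]) auto
qed

lemma sphere_diffeo_twist: "sphere_diffeo (twist t)"
  unfolding sphere_diffeo_def
proof (intro conjI bij_betw_twist smooth_twist)
  show "twist t \<in> S2 \<rightarrow>\<^sub>E S2" by (auto simp: twist_def norm_twist_ext)
  show "smooth_on S2 (inv_into S2 (twist t))"
    by (rule smooth_on_cong[OF smooth_twist[of "- t"]]) (rule inv_into_twist[symmetric])
qed

lemma triple_frame:
  "(p1 *\<^sub>R a + p2 *\<^sub>R b + p3 *\<^sub>R e) \<bullet> cross3 (q1 *\<^sub>R a + q2 *\<^sub>R b + q3 *\<^sub>R e) (r1 *\<^sub>R a + r2 *\<^sub>R b + r3 *\<^sub>R e)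
   = (a \<bullet> cross3 b e) * (r3 * (p1 * q2 - p2 * q1) - q3 * (p1 * r2 - p2 * r1) + p3 * (q1 * r2 - q2 * r1))"
proof -
  define T where "T = (\<lambda>w::real^3. w$1 *\<^sub>R a + w$2 *\<^sub>R b + w$3 *\<^sub>R e)"
  have lin: "linear T" unfolding T_def by (rule linearI) (simp_all add: algebra_simps)
  have "det (matrix T) = a \<bullet> cross3 b e"
    unfolding matrix_of_columns_det by (simp add: T_def axis_def)
  then have "T (vector [p1, p2, p3]) \<bullet> cross3 (T (vector [q1, q2, q3])) (T (vector [r1, r2, r3])) =
    (a \<bullet> cross3 b e) * (vector [p1, p2, p3] \<bullet> cross3 (vector [q1, q2, q3]) (vector [r1, r2, r3]))"
    by (simp only: cross_triple_linear_image[OF lin])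
  also have "(vector [p1, p2, p3] :: real^3) \<bullet> cross3 (vector [q1, q2, q3]) (vector [r1, r2, r3]) =
     r3 * (p1 * q2 - p2 * q1) - q3 * (p1 * r2 - p2 * r1) + p3 * (q1 * r2 - q2 * r1)"
    by (simp add: cross3_def inner_vec_def sum_3 algebra_simps)
  finally show ?thesis by (simp add: T_def)
qed

text \<open>The rotated vector plus a shear: the change of the angle with height pushes along the
  circle of latitude by \<open>t * (e \<bullet> v)\<close>.\<close>

definition twist_deriv :: "real \<Rightarrow> real^3 \<Rightarrow> real^3 \<Rightarrow> real^3" where
  "twist_deriv t x v = (let c = cos (t * (e \<bullet> x)); s = sin (t * (e \<bullet> x)) in
     ((c * (a \<bullet> v) - s * (b \<bullet> v)) - t * (e \<bullet> v) * (s * (a \<bullet> x) + c * (b \<bullet> x))) *\<^sub>R a +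
     ((s * (a \<bullet> v) + c * (b \<bullet> v)) + t * (e \<bullet> v) * (c * (a \<bullet> x) - s * (b \<bullet> x))) *\<^sub>R b + (e \<bullet> v) *\<^sub>R e)"

lemma twist_ext_has_derivative: "(twist_ext t has_derivative twist_deriv t x) (at x)"
  unfolding twist_ext_def[abs_def] twist_deriv_def[abs_def] Let_def
  by (rule has_derivative_eq_rhs, (rule derivative_intros)+) (simp add: fun_eq_iff algebra_simps)

lemma sphere_deriv_twist:
  assumes x: "x \<in> S2" and v: "v \<in> tangent x"
  shows "sphere_deriv (twist t) x v = twist_deriv t x v"
proof -
  have x0: "x \<noteq> 0" "x /\<^sub>R norm x = x" using x by auto
  let ?n = "\<lambda>v. v /\<^sub>R norm x - ((x \<bullet> v) * inverse (norm x) ^ 3) *\<^sub>R x"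
  have t: "(twist_ext t has_derivative twist_deriv t x) (at (x /\<^sub>R norm x))"
    unfolding x0(2) by (rule twist_ext_has_derivative)
  have "((\<lambda>y. twist_ext t (y /\<^sub>R norm y)) has_derivative (\<lambda>v. twist_deriv t x (?n v))) (at x)"
    by (rule has_derivative_compose[OF has_derivative_normalize[OF x0(1)] t])
  then have "(radial_ext (twist t) has_derivative (\<lambda>v. twist_deriv t x (?n v))) (at x)"
    by (rule has_derivative_transform_within_open[of _ _ _ _ "- {0}"])
       (use x0 in \<open>auto simp: radial_ext_twist radial_twist_def\<close>)
  then have "sphere_deriv (twist t) x = (\<lambda>v. twist_deriv t x (?n v))"
    unfolding sphere_deriv_def by (rule frechet_derivative_at[symmetric])
  moreover have "?n v = v" using x v by (simp add: tangent_def)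
  ultimately show ?thesis by simp
qed

text \<open>The differential is a rotation followed by a shear along the circles of latitude. The
  rotation leaves the frame determinant unchanged, and the shear contributes nothing on vectors
  tangent to the sphere.\<close>

lemma area_preserving_twist: "area_preserving (twist t)"
  unfolding area_preserving_def
proof (intro ballI)
  fix x u v assume x: "x \<in> S2" and u: "u \<in> tangent x" and v: "v \<in> tangent x"
  define c s where "c = cos (t * (e \<bullet> x))" and "s = sin (t * (e \<bullet> x))"
  define \<alpha> \<beta> z where "\<alpha> = a \<bullet> x" and "\<beta> = b \<bullet> x" and "z = e \<bullet> x"
  define u1 u2 u3 where "u1 = a \<bullet> u" and "u2 = b \<bullet> u" and "u3 = e \<bullet> u"
  define v1 v2 v3 where "v1 = a \<bullet> v" and "v2 = b \<bullet> v" and "v3 = e \<bullet> v"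
  define A B where "A = c * \<alpha> - s * \<beta>" and "B = s * \<alpha> + c * \<beta>"
  define U1 U2 where "U1 = c * u1 - s * u2" and "U2 = s * u1 + c * u2"
  define V1 V2 where "V1 = c * v1 - s * v2" and "V2 = s * v1 + c * v2"
  have cs: "c * c + s * s = 1" using sin_cos_squared_add[of "t * (e \<bullet> x)"] by (simp add: c_def s_def power2_eq_square)
  have rot: "(c * p - s * q) * (s * p' + c * q') - (s * p + c * q) * (c * p' - s * q') = p * q' - q * p'"
    "(c * p - s * q) * (c * p' - s * q') + (s * p + c * q) * (s * p' + c * q') = p * p' + q * q'" for p q p' q'
  proof -
    have "(c * p - s * q) * (s * p' + c * q') - (s * p + c * q) * (c * p' - s * q') = (c * c + s * s) * (p * q' - q * p')"
      "(c * p - s * q) * (c * p' - s * q') + (s * p + c * q) * (s * p' + c * q') = (c * c + s * s) * (p * p' + q * q')"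
      by (simp_all add: algebra_simps)
    then show "(c * p - s * q) * (s * p' + c * q') - (s * p + c * q) * (c * p' - s * q') = p * q' - q * p'"
      "(c * p - s * q) * (c * p' - s * q') + (s * p + c * q) * (s * p' + c * q') = p * p' + q * q'"
      unfolding cs by simp_all
  qed
  have "\<alpha> * u1 + \<beta> * u2 + z * u3 = 0" "\<alpha> * v1 + \<beta> * v2 + z * v3 = 0"
    using u v inner_frame[of x u] inner_frame[of x v] by (simp_all add: tangent_def \<alpha>_def \<beta>_def z_def u1_def u2_def u3_def v1_def v2_def v3_def)
  then have tan: "A * U1 + B * U2 = - z * u3" "A * V1 + B * V2 = - z * v3"
    unfolding A_def B_def U1_def U2_def V1_def V2_def rot(2) by linarith+
  have ro: "A * U2 - B * U1 = \<alpha> * u2 - \<beta> * u1" "A * V2 - B * V1 = \<alpha> * v2 - \<beta> * v1" "U1 * V2 - U2 * V1 = u1 * v2 - u2 * v1"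
    unfolding A_def B_def U1_def U2_def V1_def V2_def by (rule rot)+
  have px: "twist t x = A *\<^sub>R a + B *\<^sub>R b + z *\<^sub>R e"
    using x by (simp add: twist_def twist_ext_def A_def B_def c_def s_def \<alpha>_def \<beta>_def z_def)
  have pu: "sphere_deriv (twist t) x u = (U1 - t * u3 * B) *\<^sub>R a + (U2 + t * u3 * A) *\<^sub>R b + u3 *\<^sub>R e"
    unfolding sphere_deriv_twist[OF x u] twist_deriv_def Let_def
    by (simp add: A_def B_def U1_def U2_def c_def s_def \<alpha>_def \<beta>_def u1_def u2_def u3_def)
  have pv: "sphere_deriv (twist t) x v = (V1 - t * v3 * B) *\<^sub>R a + (V2 + t * v3 * A) *\<^sub>R b + v3 *\<^sub>R e"
    unfolding sphere_deriv_twist[OF x v] twist_deriv_def Let_def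
    by (simp add: A_def B_def V1_def V2_def c_def s_def \<alpha>_def \<beta>_def v1_def v2_def v3_def)
  \<comment> \<open>Terms quadratic in \<open>t\<close> cancel outright. The terms linear in
    \<open>t\<close> collect into the last summand, which vanishes by \<open>tan\<close>, the
    rotated form of tangency.\<close>
  have "v3 * (A * (U2 + t * u3 * A) - B * (U1 - t * u3 * B)) - u3 * (A * (V2 + t * v3 * A) - B * (V1 - t * v3 * B))
      + z * ((U1 - t * u3 * B) * (V2 + t * v3 * A) - (U2 + t * u3 * A) * (V1 - t * v3 * B))
    = v3 * (A * U2 - B * U1) - u3 * (A * V2 - B * V1) + z * (U1 * V2 - U2 * V1)
      + t * z * (v3 * (A * U1 + B * U2) - u3 * (A * V1 + B * V2))"
    by (simp add: algebra_simps)
  also have "\<dots> = v3 * (\<alpha> * u2 - \<beta> * u1) - u3 * (\<alpha> * v2 - \<beta> * v1) + z * (u1 * v2 - u2 * v1)"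
    unfolding ro tan by simp
  finally have "area_form (twist t x) (sphere_deriv (twist t) x u) (sphere_deriv (twist t) x v) =
      (\<alpha> *\<^sub>R a + \<beta> *\<^sub>R b + z *\<^sub>R e) \<bullet> cross3 (u1 *\<^sub>R a + u2 *\<^sub>R b + u3 *\<^sub>R e) (v1 *\<^sub>R a + v2 *\<^sub>R b + v3 *\<^sub>R e)"
    unfolding area_form_def px pu pv triple_frame by simp
  also have "\<dots> = area_form x u v"
    unfolding area_form_def \<alpha>_def \<beta>_def z_def u1_def u2_def u3_def v1_def v2_def v3_def frame_expand[symmetric] ..
  finally show "area_form (twist t x) (sphere_deriv (twist t) x u) (sphere_deriv (twist t) x v) = area_form x u v" .
qed

lemma twist_in_area_diffeos: "twist t \<in> area_diffeos"
  by (simp add: area_diffeos_def sphere_diffeo_twist area_preserving_twist)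

text \<open>The twists are the continuous image of the connected real line and include the identity
  at time 0.\<close>

lemma twist_in_area_diffeos0: "twist t \<in> area_diffeos0"
proof -
  have "continuous_map (top_of_set UNIV) Cinf_topology twist"
    by (rule Cinf_continuous_path[OF smooth_zero _ radial_twist_VSM])
       (auto simp: twist_in_area_diffeos radial_ext_twist)
  moreover have "connectedin (top_of_set UNIV) (UNIV :: real set)" by simp
  ultimately have "connectedin Cinf_topology (twist ` UNIV)"
    by (rule connectedin_continuous_map_image)
  then have "connected_component_of Cinf_topology (twist 0) (twist t)"
    unfolding connected_component_of_def by blast
  then show ?thesis by (simp add: area_diffeos0_def twist_0)
qed

end

section \<open>Isotopies, their velocities and their length\<close>

lemma area_diffeos0_subset: "area_diffeos0 \<subseteq> area_diffeos"
proof -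
  have "area_diffeos0 \<subseteq> topspace Cinf_topology"
    unfolding area_diffeos0_def by (rule connected_component_of_subset_topspace)
  also have "\<dots> \<subseteq> area_diffeos"
    unfolding Cinf_topology_def topology_generated_by_topspace by (auto simp: Cinf_nhd_def)
  finally show ?thesis .
qed

lemma mp_homeos_of_area_diffeos0: "f \<in> area_diffeos0 \<Longrightarrow> f \<in> mp_homeos"
  using area_diffeos0_subset area_diffeos_subset_mp_homeos by blast

text \<open>The Lagrangian velocity, attached to the starting point \<open>x\<close>; the Eulerian
  field of \<open>generating_field\<close> is the same vector attached to
  \<open>\<phi> t x\<close>.\<close>

definition velocity :: "(real \<Rightarrow> real^3 \<Rightarrow> real^3) \<Rightarrow> real \<Rightarrow> real^3 \<Rightarrow> real^3" where
  "velocity \<phi> t x = vector_derivative (\<lambda>s. \<phi> s x) (at t within {0..1})"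

text \<open>Locally the isotopy is the restriction of a smooth map \<open>F\<close> of time and
  space, so its velocity is the derivative of \<open>F\<close> in the direction
  \<open>(1, 0)\<close>, which is continuous. Derivatives within the unit interval are unique, so
  the local formulas agree, also at the endpoints.\<close>

lemma isotopy_regular:
  assumes "isotopy_from_id \<phi>"
  shows isotopy_continuous: "continuous_on ({0..1} \<times> S2) (\<lambda>(t, x). \<phi> t x)"
    and isotopy_mp_homeos: "\<And>t. t \<in> {0..1} \<Longrightarrow> \<phi> t \<in> mp_homeos"
    and velocity_continuous: "continuous_on ({0..1} \<times> S2) (\<lambda>(t, x). velocity \<phi> t x)"
    and velocity_derivative: "\<And>t x. t \<in> {0..1} \<Longrightarrow> x \<in> S2 \<Longrightarrow>
      ((\<lambda>s. \<phi> s x) has_vector_derivative velocity \<phi> t x) (at t within {0..1})"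
proof -
  let ?f = "\<lambda>(t, x). \<phi> t x" let ?S = "{0..1::real} \<times> S2"
  have sm: "smooth_on ?S ?f" and m: "\<And>t. t \<in> {0..1} \<Longrightarrow> \<phi> t \<in> area_diffeos0"
    using assms by (auto simp: isotopy_from_id_def)
  show "continuous_on ?S ?f" by (rule smooth_on_imp_continuous_on[OF sm])
  show "\<And>t. t \<in> {0..1} \<Longrightarrow> \<phi> t \<in> mp_homeos" using m mp_homeos_of_area_diffeos0 by blast
  have loc: "\<exists>U F. open U \<and> q \<in> U \<and> continuous_on U (\<lambda>y. frechet_derivative F (at y) (1, 0)) \<and>
      (\<forall>t x. (t, x) \<in> U \<inter> ?S \<longrightarrow>
        ((\<lambda>s. \<phi> s x) has_vector_derivative frechet_derivative F (at (t, x)) (1, 0)) (at t within {0..1}))"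
    if q: "q \<in> ?S" for q
  proof -
    obtain U F where U: "open U" "q \<in> U" "\<And>y. y \<in> U \<Longrightarrow> F differentiable (at y)" "\<And>y. y \<in> U \<inter> ?S \<Longrightarrow> F y = ?f y"
      "\<And>v. continuous_on U (\<lambda>y. frechet_derivative F (at y) v)"
      by (rule smooth_on_imp_local[OF sm q]) blast
    have "((\<lambda>s. \<phi> s x) has_vector_derivative frechet_derivative F (at (t, x)) (1, 0)) (at t within {0..1})"
      if tx: "(t, x) \<in> U \<inter> ?S" for t x
    proof -
      have F: "(F has_derivative frechet_derivative F (at (t, x))) (at (t, x))"
        using U(3)[of "(t, x)"] tx frechet_derivative_works by blast
      then have lin: "linear (frechet_derivative F (at (t, x)))" by (rule has_derivative_linear)
      have g: "((\<lambda>s. (s, x)) has_derivative (\<lambda>h. (h, 0))) (at t within {0..1})"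
        by (auto intro!: derivative_eq_intros)
      have "((\<lambda>s. F (s, x)) has_derivative (\<lambda>h. frechet_derivative F (at (t, x)) (h, 0))) (at t within {0..1})"
        by (rule has_derivative_compose[OF g F])
      moreover have "(\<lambda>h. frechet_derivative F (at (t, x)) (h, 0)) = (\<lambda>h. h *\<^sub>R frechet_derivative F (at (t, x)) (1, 0))"
      proof
        fix h :: real
        have "(h, 0::real^3) = h *\<^sub>R (1, 0)" by simp
        then show "frechet_derivative F (at (t, x)) (h, 0) = h *\<^sub>R frechet_derivative F (at (t, x)) (1, 0)"
          by (simp only: linear_scale[OF lin])
      qed
      ultimately have d: "((\<lambda>s. F (s, x)) has_vector_derivative frechet_derivative F (at (t, x)) (1, 0)) (at t within {0..1})"
        by (simp only: has_vector_derivative_def)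
      have "open ((\<lambda>s. (s, x)) -` U)" by (intro open_vimage U continuous_intros)
      moreover have "t \<in> (\<lambda>s. (s, x)) -` U" using tx by simp
      ultimately obtain \<delta> where \<delta>: "\<delta> > 0" "ball t \<delta> \<subseteq> (\<lambda>s. (s, x)) -` U" by (metis openE)
      show ?thesis
      proof (rule has_vector_derivative_transform_within[OF d \<delta>(1)])
        show "t \<in> {0..1}" using tx by simp
        fix s assume "s \<in> {0..1}" "dist s t < \<delta>"
        then have "(s, x) \<in> U" using \<delta>(2) by (auto simp: dist_commute subset_iff)
        then show "F (s, x) = \<phi> s x" using U(4)[of "(s, x)"] tx \<open>s \<in> {0..1}\<close> by simp
      qed
    qed
    then show ?thesis using U by blast
  qed
  have vd: "((\<lambda>s. \<phi> s x) has_vector_derivative D) (at t within {0..1}) \<Longrightarrow> velocity \<phi> t x = D"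
    if "t \<in> {0..1}" for t x D
    unfolding velocity_def using that by (intro vector_derivative_within_cbox[of 0 1, unfolded box_real]) auto
  show "((\<lambda>s. \<phi> s x) has_vector_derivative velocity \<phi> t x) (at t within {0..1})"
    if "t \<in> {0..1}" "x \<in> S2" for t x
  proof -
    have q: "(t, x) \<in> ?S" using that by simp
    obtain U F where "(t, x) \<in> U" and UF: "\<forall>t x. (t, x) \<in> U \<inter> ?S \<longrightarrow>
        ((\<lambda>s. \<phi> s x) has_vector_derivative frechet_derivative F (at (t, x)) (1, 0)) (at t within {0..1})"
      using loc[OF q] by blast
    then have D: "((\<lambda>s. \<phi> s x) has_vector_derivative frechet_derivative F (at (t, x)) (1, 0)) (at t within {0..1})"
      using q by simp
    then show ?thesis unfolding vd[OF that(1) D] .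
  qed
  show "continuous_on ?S (\<lambda>(t, x). velocity \<phi> t x)"
  proof (subst continuous_on_eq_continuous_within, intro ballI)
    fix q assume q: "q \<in> ?S"
    obtain U F where U: "open U" "q \<in> U" "continuous_on U (\<lambda>y. frechet_derivative F (at y) (1, 0))"
      "\<And>t x. (t, x) \<in> U \<inter> ?S \<Longrightarrow> ((\<lambda>s. \<phi> s x) has_vector_derivative frechet_derivative F (at (t, x)) (1, 0)) (at t within {0..1})"
      using loc[OF q] by blast
    have eq: "frechet_derivative F (at y) (1, 0) = (\<lambda>(t, x). velocity \<phi> t x) y" if y: "y \<in> U \<inter> ?S" for y
    proof -
      obtain t x where tx: "y = (t, x)" by force
      then show ?thesis using vd[OF _ U(4)[of t x]] y by simp
    qed
    have "isCont (\<lambda>y. frechet_derivative F (at y) (1, 0)) q"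
      using U by (simp add: continuous_on_eq_continuous_at)
    then have "continuous (at q within ?S) (\<lambda>y. frechet_derivative F (at y) (1, 0))"
      by (rule continuous_at_imp_continuous_at_within)
    then have "((\<lambda>y. frechet_derivative F (at y) (1, 0)) \<longlongrightarrow> frechet_derivative F (at q) (1, 0)) (at q within ?S)"
      unfolding continuous_within .
    moreover have "\<forall>\<^sub>F y in at q within ?S. frechet_derivative F (at y) (1, 0) = (\<lambda>(t, x). velocity \<phi> t x) y"
      unfolding eventually_at_topological by (intro exI[of _ U] conjI U impI allI ballI eq) auto
    ultimately have "((\<lambda>(t, x). velocity \<phi> t x) \<longlongrightarrow> frechet_derivative F (at q) (1, 0)) (at q within ?S)"
      by (rule Lim_transform_eventually)
    then show "continuous (at q within ?S) (\<lambda>(t, x). velocity \<phi> t x)"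
      unfolding continuous_within using eq[of q] q U(2) by simp
  qed
qed

text \<open>Differentiate the constant squared norm of \<open>\<phi> s x\<close>.\<close>

lemma velocity_tangent:
  assumes i: "isotopy_from_id \<phi>" and t: "t \<in> {0..1}" and x: "x \<in> S2"
  shows "velocity \<phi> t x \<in> tangent (\<phi> t x)"
proof -
  note d = velocity_derivative[OF i t x, unfolded has_vector_derivative_def]
  have "((\<lambda>s. \<phi> s x \<bullet> \<phi> s x) has_derivative (\<lambda>h. 2 * (\<phi> t x \<bullet> (h *\<^sub>R velocity \<phi> t x)))) (at t within {0..1})"
    by (rule has_derivative_eq_rhs, rule has_derivative_inner[OF d d]) (simp add: fun_eq_iff inner_commute)
  then have "((\<lambda>s. \<phi> s x \<bullet> \<phi> s x) has_vector_derivative 2 * (\<phi> t x \<bullet> velocity \<phi> t x)) (at t within {0..1})"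
    by (simp add: has_vector_derivative_def mult_ac)
  moreover have "((\<lambda>s. \<phi> s x \<bullet> \<phi> s x) has_vector_derivative 0) (at t within {0..1})"
  proof (rule has_vector_derivative_transform[OF t _ has_vector_derivative_const])
    fix s :: real assume "s \<in> {0..1}"
    then have "\<phi> s x \<in> S2" using mp_homeosD(1)[OF isotopy_mp_homeos[OF i] x] by blast
    then show "\<phi> s x \<bullet> \<phi> s x = 1" by (simp add: dot_square_norm)
  qed
  ultimately have "2 * (\<phi> t x \<bullet> velocity \<phi> t x) = 0"
    using t by (intro vector_derivative_unique_within_closed_interval[of 0 1 t]) (auto simp: box_real)
  then show ?thesis by (simp add: tangent_def)
qed

text \<open>The tangential part of a coordinate vector. Smoothness of a Riemannian metric is known
  only on smooth vector fields, so the metric is tested on these three, which span every tangent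
  plane.\<close>

definition basic_field :: "3 \<Rightarrow> real^3 \<Rightarrow> real^3" where
  "basic_field i x = axis i 1 - (x $ i) *\<^sub>R x"

lemma smooth_on_polynomial_field: "smooth_on_open UNIV (basic_field i)"
proof -
  \<comment> \<open>The induction is over fields of this four-parameter shape: a directional
    derivative of such a field has the shape again, with vanishing quadratic coefficient.\<close>
  have "iter_deriv vs (basic_field i) \<in> {(\<lambda>x. c + (x $ i) *\<^sub>R p + k *\<^sub>R x + (q * x $ i) *\<^sub>R x) | c p k q. True}" for vs
  proof (induction vs)
    case Nil
    show ?case
      by (intro CollectI exI[of _ "axis i 1"] exI[of _ 0] exI[of _ "0::real"] exI[of _ "-1"]) (auto simp: basic_field_def fun_eq_iff)
  next
    case (Cons v vs)
    then obtain c p k q where f: "iter_deriv vs (basic_field i) = (\<lambda>x. c + (x $ i) *\<^sub>R p + k *\<^sub>R x + (q * x $ i) *\<^sub>R x)" by blast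
    have "((\<lambda>x. c + (x $ i) *\<^sub>R p + k *\<^sub>R x + (q * x $ i) *\<^sub>R x) has_derivative
       (\<lambda>v. (v $ i) *\<^sub>R p + k *\<^sub>R v + ((q * x $ i) *\<^sub>R v + (q * v $ i) *\<^sub>R x))) (at x)" for x
      by (rule has_derivative_eq_rhs,
          (rule derivative_intros bounded_linear_imp_has_derivative[OF bounded_linear_vec_nth])+) (simp add: fun_eq_iff)
    from frechet_derivative_at[OF this, symmetric]
    have fd: "frechet_derivative (\<lambda>x. c + (x $ i) *\<^sub>R p + k *\<^sub>R x + (q * x $ i) *\<^sub>R x) (at x) =
       (\<lambda>v. (v $ i) *\<^sub>R p + k *\<^sub>R v + ((q * x $ i) *\<^sub>R v + (q * v $ i) *\<^sub>R x))" for x .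
    have "iter_deriv (v # vs) (basic_field i) = (\<lambda>x. (v $ i) *\<^sub>R p + k *\<^sub>R v + ((q * x $ i) *\<^sub>R v + (q * v $ i) *\<^sub>R x))"
      by (simp only: iter_deriv.simps f fd)
    also have "\<dots> = (\<lambda>x. ((v $ i) *\<^sub>R p + k *\<^sub>R v) + (x $ i) *\<^sub>R (q *\<^sub>R v) + (q * v $ i) *\<^sub>R x + (0 * x $ i) *\<^sub>R x)"
      by (rule ext) (simp add: mult.commute[of q])
    finally have "iter_deriv (v # vs) (basic_field i) =
        (\<lambda>x. ((v $ i) *\<^sub>R p + k *\<^sub>R v) + (x $ i) *\<^sub>R (q *\<^sub>R v) + (q * v $ i) *\<^sub>R x + (0 * x $ i) *\<^sub>R x)" .
    then show ?case by (intro CollectI exI conjI TrueI)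
  qed
  then have ex: "\<exists>c p k q. iter_deriv vs (basic_field i) = (\<lambda>x. c + (x $ i) *\<^sub>R p + k *\<^sub>R x + (q * x $ i) *\<^sub>R x)" for vs by blast
  have df: "(\<lambda>x. c + (x $ i) *\<^sub>R p + k *\<^sub>R x + (q * x $ i) *\<^sub>R x) differentiable (at x)" for c p k q and x :: "real^3"
    by (intro derivative_intros bounded_linear_imp_differentiable[OF bounded_linear_vec_nth])
  have "iter_deriv vs (basic_field i) differentiable (at x)" for vs x
  proof -
    obtain c p k q where f: "iter_deriv vs (basic_field i) = (\<lambda>x. c + (x $ i) *\<^sub>R p + k *\<^sub>R x + (q * x $ i) *\<^sub>R x)"
      using ex by blast
    show ?thesis unfolding f by (rule df)
  qed
  then show ?thesis unfolding smooth_on_open_def by blast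
qed

lemma smooth_basic_field: "smooth_vector_field (basic_field i)"
proof -
  have "smooth_on S2 (basic_field i)"
    unfolding smooth_on_def
    by (intro ballI exI[of _ UNIV] exI[of _ "basic_field i"] conjI smooth_on_polynomial_field UNIV_I) simp
  moreover have "x \<bullet> basic_field i x = 0" if "x \<in> S2" for x
    using that by (simp add: basic_field_def inner_diff_right inner_axis dot_square_norm)
  ultimately show ?thesis by (simp add: smooth_vector_field_def tangent_def)
qed

lemma tangent_expand:
  assumes "u \<in> tangent x" shows "u = (\<Sum>i\<in>UNIV. (u $ i) *\<^sub>R basic_field i x)"
proof -
  have z: "(\<Sum>i\<in>UNIV. u $ i * x $ i) = 0" using assms by (simp add: tangent_def inner_vec_def mult.commute)
  have "(\<Sum>i\<in>UNIV. (u $ i) *\<^sub>R basic_field i x) = (\<Sum>i\<in>UNIV. (u $ i) *\<^sub>R axis i 1) - (\<Sum>i\<in>UNIV. u $ i * x $ i) *\<^sub>R x"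
    by (simp add: basic_field_def scaleR_diff_right sum_subtractf scaleR_sum_left)
  also have "(\<Sum>i\<in>UNIV. (u $ i) *\<^sub>R axis i 1) = u"
    by (simp add: vec_eq_iff axis_def sum_3 forall_3)
  finally show ?thesis using z by simp
qed

text \<open>The metric on the diagonal, expanded in the three basic fields. They are linearly
  dependent at each point, but the coordinates of a tangent vector are admissible coefficients by
  \<open>tangent_expand\<close>. In this form continuity in base point and vector is
  visible.\<close>

definition gram :: "(real^3 \<Rightarrow> real^3 \<Rightarrow> real^3 \<Rightarrow> real) \<Rightarrow> real^3 \<Rightarrow> real^3 \<Rightarrow> real" where
  "gram \<rho> x u = (\<Sum>i\<in>UNIV. \<Sum>j\<in>UNIV. u $ i * (u $ j * \<rho> x (basic_field i x) (basic_field j x)))"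

lemma riemannian_eq_gram:
  assumes \<rho>: "riemannian_metric \<rho>" and x: "x \<in> S2" and u: "u \<in> tangent x"
  shows "\<rho> x u u = gram \<rho> x u"
proof -
  have sym: "\<And>u v. u \<in> tangent x \<Longrightarrow> v \<in> tangent x \<Longrightarrow> \<rho> x u v = \<rho> x v u"
    and lin: "\<And>u v w c d. u \<in> tangent x \<Longrightarrow> v \<in> tangent x \<Longrightarrow> w \<in> tangent x \<Longrightarrow>
        \<rho> x (c *\<^sub>R u + d *\<^sub>R v) w = c * \<rho> x u w + d * \<rho> x v w"
    using \<rho> x unfolding riemannian_metric_def by blast+
  have bf: "basic_field i x \<in> tangent x" for i using smooth_basic_field x by (simp add: smooth_vector_field_def)
  have add: "v + w \<in> tangent x" "c *\<^sub>R v \<in> tangent x" if "v \<in> tangent x" "w \<in> tangent x" for v w c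
    using that by (auto simp: tangent_def inner_add_right)
  have E: "\<rho> x u w = (\<Sum>i\<in>UNIV. u $ i * \<rho> x (basic_field i x) w)" if "u \<in> tangent x" "w \<in> tangent x" for u w
  proof -
    have "u = u $ 1 *\<^sub>R basic_field 1 x + 1 *\<^sub>R (u $ 2 *\<^sub>R basic_field 2 x + u $ 3 *\<^sub>R basic_field 3 x)"
      using tangent_expand[OF that(1)] by (simp add: sum_3 add.assoc)
    then have "\<rho> x u w = u $ 1 * \<rho> x (basic_field 1 x) w + 1 * \<rho> x (u $ 2 *\<^sub>R basic_field 2 x + u $ 3 *\<^sub>R basic_field 3 x) w"
      using lin[OF bf[of 1] add(1)[OF add(2)[OF bf[of 2] bf] add(2)[OF bf[of 3] bf]] that(2), where c = "u $ 1" and d = 1]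
      by metis
    also have "\<rho> x (u $ 2 *\<^sub>R basic_field 2 x + u $ 3 *\<^sub>R basic_field 3 x) w = u $ 2 * \<rho> x (basic_field 2 x) w + u $ 3 * \<rho> x (basic_field 3 x) w"
      by (rule lin[OF bf bf that(2)])
    finally show ?thesis by (simp add: sum_3)
  qed
  have "\<rho> x u u = (\<Sum>i\<in>UNIV. u $ i * \<rho> x (basic_field i x) u)" by (rule E[OF u u])
  also have "\<dots> = (\<Sum>i\<in>UNIV. u $ i * (\<Sum>j\<in>UNIV. u $ j * \<rho> x (basic_field i x) (basic_field j x)))"
    by (intro sum.cong refl arg_cong2[where f = "(*)"]) (simp add: sym[OF bf u] sym[OF bf bf] E[OF u bf])
  finally show ?thesis by (simp add: gram_def sum_distrib_left)
qed

lemma gram_continuous_on: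
  assumes \<rho>: "riemannian_metric \<rho>" and f: "continuous_on S f" "f ` S \<subseteq> S2" and g: "continuous_on S g"
  shows "continuous_on S (\<lambda>q. gram \<rho> (f q) (g q))"
proof -
  have c: "continuous_on S2 (\<lambda>x. \<rho> x (basic_field i x) (basic_field j x))" for i j
    using \<rho> smooth_basic_field smooth_on_imp_continuous_on unfolding riemannian_metric_def by blast
  show ?thesis unfolding gram_def
    by (intro continuous_on_sum continuous_on_mult continuous_on_compose2[OF c f] continuous_on_component g)
qed

text \<open>The unit tangent bundle is compact, and \<open>gram \<rho>\<close> is continuous and
  positive on it; homogeneity of degree two extends the bound to all tangent vectors. It replaces
  the auxiliary metric by the Euclidean norm.\<close>

lemma riemannian_lower_bound:
  assumes \<rho>: "riemannian_metric \<rho>"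
  obtains c where "c > 0" "\<And>x u. x \<in> S2 \<Longrightarrow> u \<in> tangent x \<Longrightarrow> c * norm u \<le> sqrt (\<rho> x u u)"
proof -
  define Q where "Q = {q \<in> S2 \<times> S2. fst q \<bullet> snd q = (0::real)}"
  have cl: "closed {q::(real^3) \<times> (real^3). fst q \<bullet> snd q = 0}"
    by (intro closed_Collect_eq continuous_intros)
  have cQ: "compact Q"
  proof -
    have "Q = (S2 \<times> S2) \<inter> {q. fst q \<bullet> snd q = 0}" unfolding Q_def by blast
    then show ?thesis using compact_Int_closed[OF compact_Times[OF compact_sphere compact_sphere] cl] by (simp only:)
  qed
  have cont: "continuous_on Q (\<lambda>q. gram \<rho> (fst q) (snd q))"
  proof (rule gram_continuous_on[OF \<rho>])
    show "continuous_on Q fst" "continuous_on Q snd" by (intro continuous_intros)+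
    show "fst ` Q \<subseteq> S2" by (auto simp: Q_def)
  qed
  have pos: "\<rho> x u u > 0" if "x \<in> S2" "u \<in> tangent x" "u \<noteq> 0" for x u
    using \<rho> that unfolding riemannian_metric_def by blast
  have Qt: "snd q \<in> tangent (fst q)" "fst q \<in> S2" "snd q \<noteq> 0" if "q \<in> Q" for q
    using that by (auto simp: Q_def tangent_def)
  have "\<exists>m>0. \<forall>q\<in>Q. m \<le> gram \<rho> (fst q) (snd q)"
  proof (cases "Q = {}")
    case True then show ?thesis by (intro exI[of _ 1]) auto
  next
    case False
    from continuous_attains_inf[OF cQ False cont]
    obtain q0 where q0: "q0 \<in> Q" "\<forall>q\<in>Q. gram \<rho> (fst q0) (snd q0) \<le> gram \<rho> (fst q) (snd q)" ..
    have "0 < \<rho> (fst q0) (snd q0) (snd q0)"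
      by (rule pos[OF Qt(2)[OF q0(1)] Qt(1)[OF q0(1)] Qt(3)[OF q0(1)]])
    then have "0 < gram \<rho> (fst q0) (snd q0)"
      by (simp only: riemannian_eq_gram[OF \<rho> Qt(2)[OF q0(1)] Qt(1)[OF q0(1)]])
    then show ?thesis using q0(2) by (intro exI conjI)
  qed
  then obtain m where m: "m > 0" "\<And>q. q \<in> Q \<Longrightarrow> m \<le> gram \<rho> (fst q) (snd q)" by blast
  have "sqrt m * norm u \<le> sqrt (\<rho> x u u)" if x: "x \<in> S2" and u: "u \<in> tangent x" for x u
  proof (cases "u = 0")
    case True
    then show ?thesis using riemannian_eq_gram[OF \<rho> x u] by (simp add: gram_def)
  next
    case False
    define v where "v = u /\<^sub>R norm u"
    have "(x, v) \<in> Q" using x u False by (simp add: Q_def v_def tangent_def)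
    then have "m \<le> gram \<rho> x v" using m(2)[of "(x, v)"] by simp
    moreover have "gram \<rho> x u = (norm u)\<^sup>2 * gram \<rho> x v"
    proof -
      have "u $ i = norm u * v $ i" for i using False by (simp add: v_def)
      then show ?thesis unfolding gram_def by (simp add: sum_distrib_left power2_eq_square mult_ac)
    qed
    ultimately have "m * (norm u)\<^sup>2 \<le> \<rho> x u u"
      using riemannian_eq_gram[OF \<rho> x u] mult_right_mono[of m "gram \<rho> x v" "(norm u)\<^sup>2"]
      by (simp add: mult.commute)
    then have "sqrt (m * (norm u)\<^sup>2) \<le> sqrt (\<rho> x u u)" by (rule real_sqrt_le_mono)
    then show ?thesis by (simp add: real_sqrt_mult)
  qed
  then show thesis using m(1) by (intro that[of "sqrt m"]) auto
qed

text \<open>\<open>L1_length\<close> is built from Bochner integrals, whose value is 0 when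
  integrability fails. Continuity on a compact set excludes this and allows the passage to
  non-negative integrals.\<close>

lemma nn_integral_eq_iterated_LINT:
  fixes h :: "real \<times> (real^3) \<Rightarrow> real"
  assumes h: "continuous_on ({0..1} \<times> S2) h" and h0: "\<And>q. q \<in> {0..1} \<times> S2 \<Longrightarrow> 0 \<le> h q"
  shows "ennreal (LINT t:{0..1}|lborel. LINT y:S2|sphere_area. h (t, y)) =
      (\<integral>\<^sup>+t. indicator {0..1} t * (\<integral>\<^sup>+y. indicator S2 y * ennreal (h (t, y)) \<partial>sphere_area) \<partial>lborel)"
proof -
  define H where "H q = (if q \<in> {0..1} \<times> S2 then h q else 0)" for q
  have cS: "{0..1::real} \<times> S2 \<in> sets borel" by (intro borel_closed closed_Times) auto
  have "continuous_on ({0..1} \<times> S2) H" using h by (rule continuous_on_eq) (auto simp: H_def)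
  then have "H \<in> borel_measurable borel"
    by (rule borel_measurable_continuous_on_const_outside[OF _ cS]) (simp add: H_def)
  then have Hm: "H \<in> borel_measurable (borel \<Otimes>\<^sub>M borel)" by (simp add: borel_prod)
  have "sets (lborel \<Otimes>\<^sub>M sphere_area) = sets (borel \<Otimes>\<^sub>M borel)" by (rule sets_pair_measure_cong) simp_all
  from measurable_cong_sets[OF this refl]
  have Hm' [measurable]: "H \<in> borel_measurable (lborel \<Otimes>\<^sub>M sphere_area)" using Hm by blast
  have "bounded (h ` ({0..1} \<times> S2))"
    by (intro compact_imp_bounded compact_continuous_image h compact_Times) auto
  then obtain B where B: "\<And>q. q \<in> {0..1} \<times> S2 \<Longrightarrow> norm (h q) \<le> B" by (metis bounded_iff imageI)
  define B' where "B' = max B 0"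
  have HB: "H q \<le> B'" and H0: "0 \<le> H q" for q
    using B[of q] h0[of q] by (auto simp: H_def B'_def)
  have mt: "(\<lambda>y. H (t, y)) \<in> borel_measurable sphere_area" for t by measurable
  have int1: "integrable sphere_area (\<lambda>y. H (t, y))" for t
    by (rule sphere_area.integrable_const_bound[of _ B']) (use HB H0 mt in auto)
  have nn1: "(\<integral>\<^sup>+y. ennreal (H (t, y)) \<partial>sphere_area) = ennreal (LINT y|sphere_area. H (t, y))" for t
    by (rule nn_integral_eq_integral[OF int1]) (simp add: H0)
  have m2: "(\<lambda>t. LINT y|sphere_area. H (t, y)) \<in> borel_measurable lborel"
    using sphere_area.borel_measurable_lebesgue_integral[of "\<lambda>t y. H (t, y)" lborel] by simp
  have nn0: "0 \<le> (LINT y|sphere_area. H (t, y))" for t by (simp add: H0)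
  have fin: "(\<integral>\<^sup>+t. ennreal (LINT y|sphere_area. H (t, y)) \<partial>lborel) < \<infinity>"
  proof -
    have le: "ennreal (LINT y|sphere_area. H (t, y)) \<le> (ennreal B' * total_area) * indicator {0..1} t" for t
    proof (cases "t \<in> {0..1}")
      case True
      have "(\<integral>\<^sup>+y. ennreal (H (t, y)) \<partial>sphere_area) \<le> (\<integral>\<^sup>+y. ennreal B' \<partial>sphere_area)"
        by (intro nn_integral_mono ennreal_leI HB)
      then show ?thesis using True by (simp add: nn1 total_area_def)
    next
      case False
      then have "H (t, y) = 0" for y by (auto simp: H_def)
      then show ?thesis by simp
    qed
    have "(\<integral>\<^sup>+t. ennreal (LINT y|sphere_area. H (t, y)) \<partial>lborel) \<le> (\<integral>\<^sup>+t. (ennreal B' * total_area) * indicator {0..1} (t::real) \<partial>lborel)"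
      by (intro nn_integral_mono le)
    also have "\<dots> = ennreal B' * total_area" by (subst nn_integral_cmult_indicator) auto
    also have "\<dots> < \<infinity>"
    proof -
      have "emeasure sphere_area UNIV < top" using sphere_area.emeasure_finite[of UNIV] less_top by blast
      then show ?thesis by (simp add: total_area_def ennreal_mult_less_top)
    qed
    finally show ?thesis .
  qed
  have int2: "integrable lborel (\<lambda>t. LINT y|sphere_area. H (t, y))"
    by (rule integrableI_nonneg[OF m2 _ fin]) (simp add: nn0)
  have e: "indicator {0..1} t *\<^sub>R (LINT y:S2|sphere_area. h (t, y)) = (LINT y|sphere_area. H (t, y))" for t
  proof (cases "t \<in> {0..1}")
    case True
    then show ?thesis unfolding set_lebesgue_integral_def
      by (simp add: H_def indicator_def if_distrib cong: if_cong) (intro Bochner_Integration.integral_cong; auto)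
  next
    case False
    then have "H (t, y) = 0" for y by (auto simp: H_def)
    then show ?thesis using False by simp
  qed
  have "ennreal (LINT t:{0..1}|lborel. LINT y:S2|sphere_area. h (t, y)) = ennreal (LINT t|lborel. LINT y|sphere_area. H (t, y))"
    unfolding set_lebesgue_integral_def[of lborel] e ..
  also have "\<dots> = (\<integral>\<^sup>+t. ennreal (LINT y|sphere_area. H (t, y)) \<partial>lborel)"
    by (rule nn_integral_eq_integral[OF int2, symmetric]) (simp add: nn0)
  also have "\<dots> = (\<integral>\<^sup>+t. indicator {0..1} t * (\<integral>\<^sup>+y. indicator S2 y * ennreal (h (t, y)) \<partial>sphere_area) \<partial>lborel)"
  proof (rule nn_integral_cong)
    fix t :: real
    show "ennreal (LINT y|sphere_area. H (t, y)) = indicator {0..1} t * (\<integral>\<^sup>+y. indicator S2 y * ennreal (h (t, y)) \<partial>sphere_area)"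
    proof (cases "t \<in> {0..1}")
      case True
      then show ?thesis unfolding nn1[symmetric]
        by (auto intro!: nn_integral_cong simp: H_def indicator_def)
    next
      case False
      then have "H (t, y) = 0" for y by (auto simp: H_def)
      then show ?thesis using False by simp
    qed
  qed
  finally show ?thesis .
qed

text \<open>At each time the area-preserving substitution by \<open>\<phi> t\<close> turns the
  integral of the velocity into that of the generating field; the lower bound for the metric then
  applies pointwise.\<close>

lemma L1_length_lower_bound:
  assumes \<rho>: "riemannian_metric \<rho>" and c: "c > 0" "\<And>x u. x \<in> S2 \<Longrightarrow> u \<in> tangent x \<Longrightarrow> c * norm u \<le> sqrt (\<rho> x u u)"
    and i: "isotopy_from_id \<phi>"
  shows "ennreal c * (\<integral>\<^sup>+t. indicator {0..1} t * (\<integral>\<^sup>+x. indicator S2 x * ennreal (norm (velocity \<phi> t x)) \<partial>sphere_area) \<partial>lborel)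
    \<le> ennreal (L1_length \<rho> \<phi>) \<and> 0 \<le> L1_length \<rho> \<phi>"
proof -
  let ?S = "{0..1::real} \<times> S2"
  note m = isotopy_mp_homeos[OF i]
  \<comment> \<open>\<open>P\<close> is a continuous bijection of a compact space, hence a
    homeomorphism; its inverse transports the joint continuity of the velocity to the generating
    field.\<close>
  define P where "P = (\<lambda>(t, x). (t, \<phi> t x))"
  have cP: "continuous_on ?S P"
    using isotopy_continuous[OF i] unfolding P_def split_beta by (intro continuous_intros)
  have iP: "inj_on P ?S"
  proof (rule inj_onI)
    fix p q assume p: "p \<in> ?S" and q: "q \<in> ?S" and e: "P p = P q"
    obtain t x s y where tx: "p = (t, x)" "q = (s, y)" by (metis prod.exhaust)
    have "t = s" "\<phi> t x = \<phi> t y" using e tx by (auto simp: P_def)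
    moreover have "inj_on (\<phi> t) S2" using mp_homeosD(2)[OF m] p tx by simp
    ultimately show "p = q" using p q tx by (auto simp: inj_on_def)
  qed
  have sP: "P ` ?S = ?S"
  proof -
    have im: "\<phi> t ` S2 = S2" if "t \<in> {0..1}" for t by (rule mp_homeosD(4)[OF m[OF that]])
    show ?thesis
    proof (intro subset_antisym subsetI)
      fix q assume "q \<in> P ` ?S"
      then obtain t x where q: "t \<in> {0..1}" "x \<in> S2" "q = (t, \<phi> t x)" by (auto simp: P_def)
      have "\<phi> t x \<in> S2" using im[OF q(1)] q(2) by blast
      then show "q \<in> ?S" using q by simp
    next
      fix q assume q: "q \<in> ?S"
      then have "snd q \<in> \<phi> (fst q) ` S2" using im[of "fst q"] by auto
      then obtain x where "x \<in> S2" "snd q = \<phi> (fst q) x" by blast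
      then show "q \<in> P ` ?S" using q by (intro image_eqI[of _ _ "(fst q, x)"]) (auto simp: P_def prod_eq_iff)
    qed
  qed
  define G where "G = generating_field \<phi>"
  have GX: "G t (\<phi> t x) = velocity \<phi> t x" if "t \<in> {0..1}" "x \<in> S2" for t x
    using inv_into_f_f[OF mp_homeosD(2)[OF m[OF that(1)]] that(2)]
    by (simp add: G_def generating_field_def velocity_def)
  have "continuous_on (P ` ?S) (the_inv_into ?S P)"
    by (intro continuous_on_inv_into cP iP compact_Times) auto
  then have ci: "continuous_on ?S (the_inv_into ?S P)" unfolding sP .
  have Gv: "(\<lambda>(t, x). velocity \<phi> t x) (the_inv_into ?S P q) = G (fst q) (snd q)" if q: "q \<in> ?S" for q
  proof -
    obtain p where p: "p \<in> ?S" "q = P p" using q sP by blast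
    then have "the_inv_into ?S P q = p" by (simp add: the_inv_into_f_f[OF iP])
    then show ?thesis using p GX by (auto simp: P_def)
  qed
  have "continuous_on ?S (\<lambda>q. (\<lambda>(t, x). velocity \<phi> t x) (the_inv_into ?S P q))"
  proof (rule continuous_on_compose2[OF velocity_continuous[OF i] ci])
    show "the_inv_into ?S P ` ?S \<subseteq> ?S"
      using the_inv_into_into[OF iP, of _ ?S] sP by blast
  qed
  then have cG: "continuous_on ?S (\<lambda>q. G (fst q) (snd q))"
    by (rule continuous_on_eq) (rule Gv)
  have Gt: "G t y \<in> tangent y" if t: "t \<in> {0..1}" and y: "y \<in> S2" for t y
  proof -
    have "y \<in> \<phi> t ` S2" using mp_homeosD(4)[OF m[OF t]] y by simp
    then obtain x where x: "x \<in> S2" "y = \<phi> t x" by blast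
    show ?thesis unfolding x(2) GX[OF t x(1)] by (rule velocity_tangent[OF i t x(1)])
  qed
  define h where "h q = sqrt (gram \<rho> (snd q) (G (fst q) (snd q)))" for q
  have ch: "continuous_on ?S h"
    unfolding h_def by (intro continuous_on_real_sqrt gram_continuous_on[OF \<rho>] cG continuous_intros) auto
  have hr: "h (t, y) = sqrt (\<rho> y (G t y) (G t y))" if "t \<in> {0..1}" "y \<in> S2" for t y
    using riemannian_eq_gram[OF \<rho> that(2) Gt[OF that]] by (simp add: h_def)
  have hc: "c * norm (G t y) \<le> h (t, y)" if "t \<in> {0..1}" "y \<in> S2" for t y
    unfolding hr[OF that] by (rule c(2)[OF that(2) Gt[OF that]])
  have h0: "0 \<le> h q" if "q \<in> ?S" for q
  proof -
    obtain t y where q: "q = (t, y)" by force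
    have "0 \<le> c * norm (G t y)" using c(1) by simp
    also have "\<dots> \<le> h (t, y)" by (rule hc) (use that q in auto)
    finally show ?thesis by (simp add: q)
  qed
  have in_eq: "(\<integral>\<^sup>+x. indicator S2 x * ennreal (norm (velocity \<phi> t x)) \<partial>sphere_area) =
      (\<integral>\<^sup>+y. indicator S2 y * ennreal (norm (G t y)) \<partial>sphere_area)" if t: "t \<in> {0..1}" for t
  proof -
    have "continuous_on S2 (\<lambda>y. G t y)"
    proof -
      have tc: "continuous_on S2 (\<lambda>y. (t, y))" by (intro continuous_intros)
      have "(\<lambda>y. (t, y)) ` S2 \<subseteq> ?S" using t by auto
      from continuous_on_compose2[OF cG tc this] show ?thesis by simp
    qed
    from continuous_on_norm[OF this]
    have "continuous_on S2 (\<lambda>y. norm (if y \<in> S2 then G t y else 0))"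
      by (rule continuous_on_eq) simp
    then have "(\<lambda>y. norm (if y \<in> S2 then G t y else 0)) \<in> borel_measurable borel"
      by (rule borel_measurable_continuous_on_const_outside[where c = 0]) (auto intro!: borel_closed)
    then have gm: "(\<lambda>y. ennreal (norm (if y \<in> S2 then G t y else 0))) \<in> borel_measurable borel" by measurable
    have "(\<integral>\<^sup>+x. indicator S2 x * ennreal (norm (velocity \<phi> t x)) \<partial>sphere_area) =
      (\<integral>\<^sup>+x. ennreal (norm (if \<phi> t x \<in> S2 then G t (\<phi> t x) else 0)) \<partial>sphere_area)"
    proof (rule nn_integral_cong_AE)
      show "AE x in sphere_area. indicator S2 x * ennreal (norm (velocity \<phi> t x)) =
          ennreal (norm (if \<phi> t x \<in> S2 then G t (\<phi> t x) else 0))"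
        using AE_sphere_area
      proof eventually_elim
        case (elim x)
        then show ?case using GX[OF t elim] mp_homeosD(1)[OF m[OF t] elim] by simp
      qed
    qed
    also have "\<dots> = (\<integral>\<^sup>+y. ennreal (norm (if y \<in> S2 then G t y else 0)) \<partial>sphere_area)"
      by (rule nn_integral_mp_homeos[OF m[OF t] gm])
    also have "\<dots> = (\<integral>\<^sup>+y. indicator S2 y * ennreal (norm (G t y)) \<partial>sphere_area)"
      by (intro nn_integral_cong) (auto simp: indicator_def)
    finally show ?thesis .
  qed
  have "ennreal c * (\<integral>\<^sup>+t. indicator {0..1} t * (\<integral>\<^sup>+x. indicator S2 x * ennreal (norm (velocity \<phi> t x)) \<partial>sphere_area) \<partial>lborel)
    = ennreal c * (\<integral>\<^sup>+t. indicator {0..1} t * (\<integral>\<^sup>+y. indicator S2 y * ennreal (norm (G t y)) \<partial>sphere_area) \<partial>lborel)"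
  proof -
    have "indicator {0..1} t * (\<integral>\<^sup>+x. indicator S2 x * ennreal (norm (velocity \<phi> t x)) \<partial>sphere_area) =
        indicator {0..1} t * (\<integral>\<^sup>+y. indicator S2 y * ennreal (norm (G t y)) \<partial>sphere_area)" for t
      by (cases "t \<in> {0..1}") (simp_all add: in_eq)
    then show ?thesis by (simp only:)
  qed
  also have "\<dots> \<le> ennreal (LINT t:{0..1}|lborel. LINT y:S2|sphere_area. h (t, y))"
  proof -
    have "continuous_on ?S (\<lambda>q. c * norm (G (fst q) (snd q)))" by (intro continuous_intros cG)
    note eq = nn_integral_eq_iterated_LINT[OF this]
    have "ennreal c * (\<integral>\<^sup>+t. indicator {0..1} t * (\<integral>\<^sup>+y. indicator S2 y * ennreal (norm (G t y)) \<partial>sphere_area) \<partial>lborel)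
      = ennreal c * ennreal (LINT t:{0..1}|lborel. LINT y:S2|sphere_area. norm (G (fst (t, y)) (snd (t, y))))"
      using nn_integral_eq_iterated_LINT[of "\<lambda>q. norm (G (fst q) (snd q))", OF continuous_on_norm[OF cG] norm_ge_zero]
      by (simp only: fst_conv snd_conv)
    also have "\<dots> = ennreal (LINT t:{0..1}|lborel. LINT y:S2|sphere_area. c * norm (G (fst (t, y)) (snd (t, y))))"
      using c(1) by (simp add: set_integral_mult_right ennreal_mult')
    also have "\<dots> = (\<integral>\<^sup>+t. indicator {0..1} t * (\<integral>\<^sup>+y. indicator S2 y * ennreal (c * norm (G (fst (t, y)) (snd (t, y)))) \<partial>sphere_area) \<partial>lborel)"
      by (rule eq) (use c(1) in auto)
    also have "\<dots> \<le> (\<integral>\<^sup>+t. indicator {0..1} t * (\<integral>\<^sup>+y. indicator S2 y * ennreal (h (t, y)) \<partial>sphere_area) \<partial>lborel)"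
    proof (rule nn_integral_mono)
      fix t :: real
      show "indicator {0..1} t * (\<integral>\<^sup>+y. indicator S2 y * ennreal (c * norm (G (fst (t, y)) (snd (t, y)))) \<partial>sphere_area)
        \<le> indicator {0..1} t * (\<integral>\<^sup>+y. indicator S2 y * ennreal (h (t, y)) \<partial>sphere_area)"
      proof (cases "t \<in> {0..1}")
        case True
        show ?thesis
          by (rule mult_left_mono[OF nn_integral_mono])
             (auto simp: indicator_def intro!: ennreal_leI hc[OF True, simplified])
      qed simp
    qed
    also have "\<dots> = ennreal (LINT t:{0..1}|lborel. LINT y:S2|sphere_area. h (t, y))"
      by (rule nn_integral_eq_iterated_LINT[OF ch h0, symmetric])
    finally show ?thesis .
  qed
  also have Lh: "(LINT t:{0..1}|lborel. LINT y:S2|sphere_area. h (t, y)) = L1_length \<rho> \<phi>"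
  proof -
    have S2b: "S2 \<in> sets sphere_area" unfolding sets_sphere_area by (rule borel_closed) simp
    have inner: "(LINT y:S2|sphere_area. h (t, y)) = (LINT y:S2|sphere_area. sqrt (\<rho> y (G t y) (G t y)))" if "t \<in> {0..1}" for t
      by (rule set_lebesgue_integral_cong[OF S2b]) (intro allI impI hr[OF that])
    show ?thesis unfolding L1_length_def G_def[symmetric]
      by (rule set_lebesgue_integral_cong) (simp, intro allI impI inner)
  qed
  finally have 1: "ennreal c * (\<integral>\<^sup>+t. indicator {0..1} t * (\<integral>\<^sup>+x. indicator S2 x * ennreal (norm (velocity \<phi> t x)) \<partial>sphere_area) \<partial>lborel)
    \<le> ennreal (L1_length \<rho> \<phi>)" .
  have "0 \<le> L1_length \<rho> \<phi>"
    unfolding Lh[symmetric] set_lebesgue_integral_def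
  proof (rule Bochner_Integration.integral_nonneg)
    fix t :: real
    show "0 \<le> indicator {0..1} t *\<^sub>R (LINT y|sphere_area. indicator S2 y *\<^sub>R h (t, y))"
    proof (cases "t \<in> {0..1}")
      case True
      have "0 \<le> (LINT y|sphere_area. indicator S2 y *\<^sub>R h (t, y))"
        by (rule Bochner_Integration.integral_nonneg) (use True h0 in \<open>auto simp: indicator_def\<close>)
      then show ?thesis by simp
    qed simp
  qed
  with 1 show ?thesis by blast
qed

section \<open>Displacement of lifts bounded by the length of an isotopy\<close>

context two_discs
begin

text \<open>The estimate by the Euclidean speed is chained with the comparison of speed and length.
  The constant depends on the metric and the total area, but neither on the isotopy nor on
  \<open>u\<close>.\<close>

lemma dW_le_L1_length:
  assumes \<rho>: "riemannian_metric \<rho>"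
  obtains D where "D > 0"
    "\<And>\<phi> u. isotopy_from_id \<phi> \<Longrightarrow> u \<in> mp_homeos \<Longrightarrow> dW (compose S2 (\<phi> 1) u) u \<le> ennreal (D * L1_length \<rho> \<phi>)"
    "\<And>\<phi>. isotopy_from_id \<phi> \<Longrightarrow> 0 \<le> L1_length \<rho> \<phi>"
proof -
  obtain c where c: "c > 0" "\<And>x u. x \<in> S2 \<Longrightarrow> u \<in> tangent x \<Longrightarrow> c * norm u \<le> sqrt (\<rho> x u u)"
    by (rule riemannian_lower_bound[OF \<rho>]) blast
  define A where "A = measure sphere_area UNIV"
  have A: "total_area = ennreal A" unfolding total_area_def A_def by (rule sphere_area.emeasure_eq_measure)
  have A0: "A \<ge> 0" by (simp add: A_def)
  define M where "M = 32 * ((2 * pi\<^sup>2)\<^sup>2 * A)"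
  have M0: "M \<ge> 0" using A0 by (simp add: M_def)
  \<comment> \<open>\<open>M\<close> is only known to be non-negative; the added 1 makes
    \<open>D\<close> positive, so that later it can be moved across the infimum defining the
    norm.\<close>
  define D where "D = (M + 1) / c"
  have D0: "D > 0" using M0 c(1) by (simp add: D_def)
  have "dW (compose S2 (\<phi> 1) u) u \<le> ennreal (D * L1_length \<rho> \<phi>)" if i: "isotopy_from_id \<phi>" and u: "u \<in> mp_homeos" for \<phi> u
  proof -
    let ?V = "(\<integral>\<^sup>+t. indicator {0..1} t * (\<integral>\<^sup>+x. indicator S2 x * ennreal (norm (velocity \<phi> t x)) \<partial>sphere_area) \<partial>lborel)"
    have "\<phi> 0 = restrict id S2" using i by (simp add: isotopy_from_id_def)
    moreover have "compose S2 (restrict id S2) u = u"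
      using mp_homeosD(1,5)[OF u] by (auto simp: compose_def fun_eq_iff extensional_def)
    ultimately have e0: "compose S2 (\<phi> 0) u = u" by (simp only:)
    have "dW (compose S2 (\<phi> 1) u) (compose S2 (\<phi> 0) u) \<le> ennreal 32 * ((ennreal (2 * pi\<^sup>2))\<^sup>2 * total_area * ?V)"
      by (rule dW_isotopy_le[OF isotopy_continuous[OF i] isotopy_mp_homeos[OF i] velocity_continuous[OF i] velocity_derivative[OF i] u])
    then have "dW (compose S2 (\<phi> 1) u) u \<le> ennreal 32 * ((ennreal (2 * pi\<^sup>2))\<^sup>2 * total_area * ?V)"
      unfolding e0 .
    also have "\<dots> = ennreal M * ?V"
      using A0 unfolding A M_def by (simp add: ennreal_mult ennreal_power mult.assoc)
    also have "\<dots> \<le> ennreal (M + 1) * ?V" by (intro mult_right_mono ennreal_leI) auto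
    also have "\<dots> = ennreal D * (ennreal c * ?V)"
      using c(1) M0 by (simp add: D_def mult.assoc[symmetric] ennreal_mult[symmetric])
    also have "\<dots> \<le> ennreal D * ennreal (L1_length \<rho> \<phi>)"
      by (intro mult_left_mono conjunct1[OF L1_length_lower_bound[OF \<rho> c i]]) auto
    also have "\<dots> = ennreal (D * L1_length \<rho> \<phi>)" using D0 by (simp add: ennreal_mult')
    finally show ?thesis .
  qed
  then show thesis using D0 conjunct2[OF L1_length_lower_bound[OF \<rho> c]] by (intro that)
qed

end

section \<open>The functional \<open>Phi\<close> and its estimates\<close>

context two_discs
begin

lemma dW_commute: "dW f g = dW g f"
  by (simp add: dW_def abs_minus_commute)

lemma dW_triangle:
  assumes [measurable]: "f \<in> mp_homeos" "g \<in> mp_homeos" "h \<in> mp_homeos"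
  shows "dW f h \<le> dW f g + dW g h"
proof -
  have "dW f h \<le> (\<integral>\<^sup>+p. ennreal \<bar>W f p - W g p\<bar> + ennreal \<bar>W g p - W h p\<bar> \<partial>quad_measure)"
    unfolding dW_def by (intro nn_integral_mono) (simp flip: ennreal_plus)
  also have "\<dots> = dW f g + dW g h"
    unfolding dW_def by (rule nn_integral_add) (use W_measurable assms in measurable)
  finally show ?thesis .
qed

lemma dW_self: "dW f f = 0"
  by (simp add: dW_def)

text \<open>Bounded displacement of \<open>W\<close>. Endpoints of isotopies have it by
  \<open>dW_le_L1_length\<close>, the twist by a direct estimate. The uniformity in \<open>u\<close>
  is what makes it stable under composition and cancellation.\<close>

definition good :: "(real^3 \<Rightarrow> real^3) \<Rightarrow> bool" where
  "good f \<longleftrightarrow> f \<in> mp_homeos \<and> (\<exists>K. K \<noteq> top \<and> (\<forall>u\<in>mp_homeos. dW (compose S2 f u) u \<le> K))"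

lemma compose_compose_mp:
  assumes "u \<in> mp_homeos"
  shows "compose S2 g (compose S2 f u) = compose S2 (compose S2 g f) u"
  using mp_homeosD(1)[OF assms] by (auto simp: compose_def fun_eq_iff)

lemma compose_id_left: "u \<in> mp_homeos \<Longrightarrow> compose S2 (restrict id S2) u = u"
  using mp_homeosD(1,5)[of u] by (auto simp: compose_def fun_eq_iff extensional_def)

lemma compose_id_right: "u \<in> mp_homeos \<Longrightarrow> compose S2 u (restrict id S2) = u"
  using mp_homeosD(5)[of u] by (auto simp: compose_def fun_eq_iff extensional_def)

lemma good_compose:
  assumes g: "good g" and f: "good f"
  shows "good (compose S2 g f)"
proof -
  obtain K K' where K: "K \<noteq> top" "\<And>u. u \<in> mp_homeos \<Longrightarrow> dW (compose S2 g u) u \<le> K"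
    and K': "K' \<noteq> top" "\<And>u. u \<in> mp_homeos \<Longrightarrow> dW (compose S2 f u) u \<le> K'"
    using g f unfolding good_def by blast
  have mp: "g \<in> mp_homeos" "f \<in> mp_homeos" using g f by (auto simp: good_def)
  have "dW (compose S2 (compose S2 g f) u) u \<le> K + K'" if u: "u \<in> mp_homeos" for u
  proof -
    have fu: "compose S2 f u \<in> mp_homeos" by (rule compose_in_mp_homeos[OF u mp(2)])
    have "dW (compose S2 (compose S2 g f) u) u \<le> dW (compose S2 g (compose S2 f u)) (compose S2 f u) + dW (compose S2 f u) u"
      unfolding compose_compose_mp[OF u, symmetric]
      by (rule dW_triangle[OF compose_in_mp_homeos[OF fu mp(1)] fu u])
    also have "\<dots> \<le> K + K'" by (intro add_mono K K' fu u)
    finally show ?thesis .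
  qed
  moreover have "K + K' \<noteq> top" using K(1) K'(1) by simp
  ultimately show ?thesis unfolding good_def using compose_in_mp_homeos[OF mp(2,1)] by blast
qed

text \<open>The lift for \<open>f u\<close> is close to that for \<open>g f u\<close>, which is
  close to that for \<open>u\<close>. With \<open>good_compose\<close>: for good \<open>g\<close>,
  either both \<open>f\<close> and \<open>g f\<close> are good or neither is, so the default value
  of \<open>Phi\<close> occurs at both or at neither.\<close>

lemma good_cancel_left:
  assumes g: "good g" and gf: "good (compose S2 g f)" and f: "f \<in> mp_homeos"
  shows "good f"
proof -
  obtain K K' where K: "K \<noteq> top" "\<And>u. u \<in> mp_homeos \<Longrightarrow> dW (compose S2 g u) u \<le> K"
    and K': "K' \<noteq> top" "\<And>u. u \<in> mp_homeos \<Longrightarrow> dW (compose S2 (compose S2 g f) u) u \<le> K'"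
    using g gf unfolding good_def by blast
  have mp: "g \<in> mp_homeos" using g by (simp add: good_def)
  have "dW (compose S2 f u) u \<le> K + K'" if u: "u \<in> mp_homeos" for u
  proof -
    have fu: "compose S2 f u \<in> mp_homeos" by (rule compose_in_mp_homeos[OF u f])
    have gfu: "compose S2 g (compose S2 f u) \<in> mp_homeos" by (rule compose_in_mp_homeos[OF fu mp])
    have "dW (compose S2 f u) u \<le> dW (compose S2 f u) (compose S2 g (compose S2 f u)) + dW (compose S2 g (compose S2 f u)) u"
      by (rule dW_triangle[OF fu gfu u])
    also have "\<dots> \<le> K + K'"
      using K(2)[OF fu] K'(2)[OF u] unfolding compose_compose_mp[OF u] dW_commute[of "compose S2 f u"]
      by (intro add_mono) (simp_all add: compose_compose_mp[OF u])
    finally show ?thesis .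
  qed
  moreover have "K + K' \<noteq> top" using K(1) K'(1) by simp
  ultimately show ?thesis unfolding good_def using f by blast
qed

text \<open>Writing \<open>u\<close> as \<open>q v\<close> bounds the displacement of
  \<open>u\<close> under \<open>f\<close> by two known displacements, both of which start at
  \<open>v\<close>.\<close>

lemma good_cancel_right:
  assumes q: "good q" and fq: "good (compose S2 f q)" and f: "f \<in> mp_homeos"
  shows "good f"
proof -
  obtain K K' where K: "K \<noteq> top" "\<And>u. u \<in> mp_homeos \<Longrightarrow> dW (compose S2 q u) u \<le> K"
    and K': "K' \<noteq> top" "\<And>u. u \<in> mp_homeos \<Longrightarrow> dW (compose S2 (compose S2 f q) u) u \<le> K'"
    using q fq unfolding good_def by blast
  have mp: "q \<in> mp_homeos" using q by (simp add: good_def)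
  obtain r where r: "r \<in> mp_homeos" "\<And>x. x \<in> S2 \<Longrightarrow> q (r x) = x"
    using inverse_in_mp_homeos[OF mp] by metis
  have "dW (compose S2 f u) u \<le> K' + K" if u: "u \<in> mp_homeos" for u
  proof -
    define v where "v = compose S2 r u"
    have v: "v \<in> mp_homeos" unfolding v_def by (rule compose_in_mp_homeos[OF u r(1)])
    have qv: "compose S2 q v = u"
      using r(2) mp_homeosD(1,5)[OF u] by (auto simp: v_def compose_def fun_eq_iff extensional_def)
    have fu: "compose S2 f u \<in> mp_homeos" by (rule compose_in_mp_homeos[OF u f])
    have "dW (compose S2 f u) u \<le> dW (compose S2 f u) v + dW v u" by (rule dW_triangle[OF fu v u])
    also have "\<dots> \<le> K' + K"
    proof (rule add_mono)
      show "dW (compose S2 f u) v \<le> K'"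
        using K'(2)[OF v] unfolding compose_compose_mp[OF v, symmetric] qv .
      show "dW v u \<le> K" using K(2)[OF v] unfolding qv by (simp only: dW_commute)
    qed
    finally show ?thesis .
  qed
  moreover have "K' + K \<noteq> top" using K(1) K'(1) by simp
  ultimately show ?thesis unfolding good_def using f by blast
qed

lemma power_Suc_compose:
  assumes "f \<in> mp_homeos"
  shows "restrict (f ^^ Suc k) S2 = compose S2 f (restrict (f ^^ k) S2)"
  by (auto simp: compose_def fun_eq_iff)

lemma power_in_mp_homeos:
  assumes "f \<in> mp_homeos" shows "restrict (f ^^ k) S2 \<in> mp_homeos"
proof (induction k)
  case 0 show ?case unfolding funpow.simps(1) by (rule id_in_mp_homeos)
next
  case (Suc k) show ?case unfolding power_Suc_compose[OF assms] by (rule compose_in_mp_homeos[OF Suc assms])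
qed

definition stabilizer :: "(real^3) set \<Rightarrow> (real^3 \<Rightarrow> real^3) set" where
  "stabilizer L = {h \<in> mp_homeos. h ` L = L}"

text \<open>For good \<open>f\<close> the infimum is finite, being bounded by the distance to
  \<open>W\<close> of the identity. For all other maps it might be infinite, and 0 is a
  convention.\<close>

definition Phi :: "(real^3) set \<Rightarrow> (real^3 \<Rightarrow> real^3) \<Rightarrow> real" where
  "Phi L f = (if good f then enn2real (INF h\<in>stabilizer L. dW f h) else 0)"

lemma id_in_stabilizer: "L \<subseteq> S2 \<Longrightarrow> restrict id S2 \<in> stabilizer L"
  using id_in_mp_homeos by (auto simp: stabilizer_def subset_iff image_iff)

lemma Phi_nonneg: "0 \<le> Phi L f"
  by (simp add: Phi_def)

lemma ennreal_Phi:
  assumes f: "good f" and L: "L \<subseteq> S2"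
  shows "ennreal (Phi L f) = (INF h\<in>stabilizer L. dW f h)"
proof -
  obtain K where K: "K \<noteq> top" "\<And>u. u \<in> mp_homeos \<Longrightarrow> dW (compose S2 f u) u \<le> K"
    using f unfolding good_def by blast
  have mp: "f \<in> mp_homeos" using f by (simp add: good_def)
  have "(INF h\<in>stabilizer L. dW f h) \<le> dW f (restrict id S2)" by (rule INF_lower[OF id_in_stabilizer[OF L]])
  also have "\<dots> \<le> K" using K(2)[OF id_in_mp_homeos] unfolding compose_id_right[OF mp] .
  finally have "(INF h\<in>stabilizer L. dW f h) < top" using K(1) less_top le_less_trans by blast
  then show ?thesis using f by (simp add: Phi_def)
qed

text \<open>The distance to a set is 1-Lipschitz. The infimum is moved to the side of
  \<open>f\<close>, so that truncated subtraction in \<open>ennreal\<close> does no harm.\<close>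

lemma Phi_le_add:
  assumes f: "good f" and g: "good g" and L: "L \<subseteq> S2" and r: "0 \<le> r" "dW g f \<le> ennreal r"
  shows "Phi L g \<le> Phi L f + r"
proof -
  have mp: "f \<in> mp_homeos" "g \<in> mp_homeos" using f g by (simp_all add: good_def)
  have "ennreal (Phi L g - r) \<le> dW f h" if h: "h \<in> stabilizer L" for h
  proof (cases "dW f h")
    case (real d)
    have hm: "h \<in> mp_homeos" using h by (simp add: stabilizer_def)
    have "ennreal (Phi L g) \<le> dW g h" unfolding ennreal_Phi[OF g L] by (rule INF_lower[OF h])
    also have "\<dots> \<le> dW g f + dW f h" by (rule dW_triangle[OF mp(2,1) hm])
    also have "\<dots> \<le> ennreal r + ennreal d" using r(2) real by (intro add_mono) auto
    also have "\<dots> = ennreal (r + d)" using r real by simp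
    finally have "Phi L g \<le> r + d" by (rule ennreal_le_iff[THEN iffD1, rotated]) (use r real in simp)
    then show ?thesis unfolding real by (intro ennreal_leI) simp
  qed simp
  then have "ennreal (Phi L g - r) \<le> ennreal (Phi L f)"
    unfolding ennreal_Phi[OF f L] by (intro INF_greatest)
  then show ?thesis using Phi_nonneg[of L f] by (simp add: ennreal_le_iff)
qed

lemma Phi_stabilizer:
  assumes "h \<in> stabilizer L" shows "Phi L h = 0"
proof -
  have "(INF k\<in>stabilizer L. dW h k) \<le> dW h h" by (rule INF_lower[OF assms])
  then show ?thesis by (simp add: Phi_def dW_self)
qed

lemma power_stabilizer:
  assumes h: "h \<in> stabilizer L" and L: "L \<subseteq> S2" shows "restrict (h ^^ k) S2 \<in> stabilizer L"
proof (induction k)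
  case 0 show ?case unfolding funpow.simps(1) by (rule id_in_stabilizer[OF L])
next
  case (Suc k)
  have hm: "h \<in> mp_homeos" "h ` L = L" using h by (auto simp: stabilizer_def)
  have km: "restrict (h ^^ k) S2 \<in> mp_homeos" "restrict (h ^^ k) S2 ` L = L" using Suc by (simp_all only: stabilizer_def mem_Collect_eq)
  have "compose S2 h (restrict (h ^^ k) S2) ` L = h ` (restrict (h ^^ k) S2 ` L)"
    unfolding image_image by (rule image_cong) (use L in \<open>auto simp: compose_def subset_iff\<close>)
  then have "compose S2 h (restrict (h ^^ k) S2) ` L = L" unfolding km(2) hm(2) .
  then show ?case unfolding power_Suc_compose[OF hm(1)] stabilizer_def mem_Collect_eq
    using compose_in_mp_homeos[OF km(1) hm(1)] by (intro conjI)
qed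

lemma good_power: "good f \<Longrightarrow> good (restrict (f ^^ k) S2)"
proof (induction k)
  case 0
  have "good (restrict id S2)"
    unfolding good_def using id_in_mp_homeos
    by (intro conjI exI[of _ 0]) (auto simp: compose_id_left dW_self simp del: restrict_apply)
  then show ?case unfolding funpow.simps(1) .
next
  case (Suc k)
  then have "f \<in> mp_homeos" by (simp add: good_def)
  then show ?case unfolding power_Suc_compose[OF \<open>f \<in> mp_homeos\<close>] by (intro good_compose Suc)
qed

text \<open>Each further iterate is one more left factor \<open>f\<close>, which costs at most the
  uniform displacement \<open>c\<close>.\<close>

lemma Phi_power_le:
  assumes f: "good f" and L: "L \<subseteq> S2"
  obtains c where "0 \<le> c" "\<And>k. Phi L (restrict (f ^^ k) S2) \<le> c * real k"
proof -
  obtain K where K: "K \<noteq> top" "\<And>u. u \<in> mp_homeos \<Longrightarrow> dW (compose S2 f u) u \<le> K"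
    using f unfolding good_def by blast
  have mp: "f \<in> mp_homeos" using f by (simp add: good_def)
  define c where "c = enn2real K"
  have Kc: "K = ennreal c" using K(1) unfolding c_def by (simp add: less_top)
  have c0: "0 \<le> c" by (simp add: c_def)
  have "Phi L (restrict (f ^^ k) S2) \<le> c * real k" for k
  proof (induction k)
    case 0
    have "restrict (f ^^ 0) S2 \<in> stabilizer L" unfolding funpow.simps(1) by (rule id_in_stabilizer[OF L])
    then show ?case by (simp only: Phi_stabilizer of_nat_0 mult_zero_right order_refl)
  next
    case (Suc k)
    have "Phi L (restrict (f ^^ Suc k) S2) \<le> Phi L (restrict (f ^^ k) S2) + c"
    proof (rule Phi_le_add[OF good_power[OF f] good_power[OF f] L c0])
      show "dW (restrict (f ^^ Suc k) S2) (restrict (f ^^ k) S2) \<le> ennreal c"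
        unfolding power_Suc_compose[OF mp] Kc[symmetric] by (rule K(2)[OF power_in_mp_homeos[OF mp]])
    qed
    moreover have "c * real (Suc k) = c * real k + c" by (simp add: algebra_simps)
    ultimately show ?case using Suc by linarith
  qed
  then show thesis using that c0 by blast
qed

text \<open>Linear growth settles good \<open>f\<close>. For other \<open>f\<close>, two consecutive
  iterates cannot both be good, by right cancellation; so \<open>Phi\<close> takes its default value
  0 infinitely often and the liminf cannot be positive.\<close>

lemma liminf_mean_Phi_finite:
  assumes f: "f \<in> mp_homeos" and L: "L \<subseteq> S2"
  shows "\<bar>liminf_mean (Phi L) f\<bar> \<noteq> \<infinity>"
proof -
  let ?a = "\<lambda>k. ereal (Phi L (restrict (f ^^ k) S2) / real k)"
  have "0 \<le> liminf ?a"
    by (rule Liminf_bounded) (simp add: Phi_nonneg)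
  moreover have "\<exists>C::real. liminf ?a \<le> ereal C"
  proof (cases "good f")
    case True
    obtain c where c: "0 \<le> c" "\<And>k. Phi L (restrict (f ^^ k) S2) \<le> c * real k"
      by (rule Phi_power_le[OF True L]) blast
    \<comment> \<open>For \<open>k = 0\<close> the quotient is 0 by the convention for
      division.\<close>
    have "?a k \<le> ereal c" for k
      using c by (cases "k = 0") (auto simp: divide_simps)
    then have "liminf ?a \<le> liminf (\<lambda>k::nat. ereal c)" by (intro Liminf_mono always_eventually allI)
    then show ?thesis by (auto simp: Liminf_const)
  next
    case False
    have fr: "\<exists>\<^sub>F k in sequentially. ?a k \<le> 0"
      unfolding frequently_sequentially
    proof
      fix n
      have "\<not> (good (restrict (f ^^ n) S2) \<and> good (restrict (f ^^ Suc n) S2))"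
        using good_cancel_right[of "restrict (f ^^ n) S2" f] False f unfolding power_Suc_compose[OF f] by blast
      then have "Phi L (restrict (f ^^ n) S2) = 0 \<or> Phi L (restrict (f ^^ Suc n) S2) = 0"
        unfolding Phi_def by (simp del: funpow.simps)
      then show "\<exists>k\<ge>n. ?a k \<le> 0"
        by (elim disjE) (rule exI[of _ n], simp, rule exI[of _ "Suc n"], simp del: funpow.simps)
    qed
    have "liminf ?a \<le> 0"
    proof (rule ccontr)
      assume "\<not> liminf ?a \<le> 0"
      then have "0 < liminf ?a" by simp
      then have "\<forall>\<^sub>F k in sequentially. 0 < ?a k" by (rule less_LiminfD)
      then have "\<forall>\<^sub>F k in sequentially. \<not> ?a k \<le> 0" by (auto elim!: eventually_mono)
      with fr show False by (simp add: frequently_def)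
    qed
    then show ?thesis by (intro exI[of _ 0]) (simp add: zero_ereal_def)
  qed
  ultimately obtain C where "0 \<le> liminf ?a" "liminf ?a \<le> ereal C" by blast
  then show ?thesis unfolding liminf_mean_def by (cases "liminf ?a") auto
qed

lemma liminf_mean_Phi_stabilizer:
  assumes h: "h \<in> stabilizer L" and L: "L \<subseteq> S2"
  shows "liminf_mean (Phi L) h = 0"
  unfolding liminf_mean_def Phi_stabilizer[OF power_stabilizer[OF h L]]
  by (simp add: Liminf_const flip: zero_ereal_def)

text \<open>For an isotopy ending at \<open>g\<close>, with \<open>r\<close> the constant
  \<open>D\<close> times its length, the triangle inequality bounds both the change from
  \<open>f\<close> to \<open>g f\<close> and \<open>Phi L g\<close> itself by \<open>r\<close>; this
  is the origin of the factor 2. The infimum over isotopies gives the norm, and without any isotopy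
  the right-hand side is infinite.\<close>

lemma Phi_bounds:
  assumes D: "D > 0"
    "\<And>\<phi> u. isotopy_from_id \<phi> \<Longrightarrow> u \<in> mp_homeos \<Longrightarrow> dW (compose S2 (\<phi> 1) u) u \<le> ennreal (D * L1_length \<rho> \<phi>)"
    "\<And>\<phi>. isotopy_from_id \<phi> \<Longrightarrow> 0 \<le> L1_length \<rho> \<phi>"
    and L: "L \<subseteq> S2" and f: "f \<in> mp_homeos" and g: "g \<in> mp_homeos"
  shows "ereal \<bar>Phi L (compose S2 g f) - Phi L f - Phi L g\<bar> \<le> ereal (2 * D) * L1_norm \<rho> g"
    and "ereal \<bar>Phi L g\<bar> \<le> ereal D * L1_norm \<rho> g"
proof -
  have iso: "\<bar>Phi L (compose S2 g f) - Phi L f - Phi L g\<bar> \<le> 2 * D * L1_length \<rho> \<phi> \<and> \<bar>Phi L g\<bar> \<le> D * L1_length \<rho> \<phi>"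
    if \<phi>: "isotopy_from_id \<phi>" "\<phi> 1 = g" for \<phi>
  proof -
    define r where "r = D * L1_length \<rho> \<phi>"
    have r0: "0 \<le> r" using D(1) D(3)[OF \<phi>(1)] by (simp add: r_def)
    have dr: "dW (compose S2 g u) u \<le> ennreal r" if "u \<in> mp_homeos" for u
      using D(2)[OF \<phi>(1) that] by (simp add: \<phi>(2) r_def)
    have gg: "good g" unfolding good_def using g dr by (intro conjI exI[of _ "ennreal r"]) auto
    have gi: "good (restrict id S2)" using good_power[OF gg, of 0] unfolding funpow.simps(1) .
    have "dW g (restrict id S2) \<le> ennreal r" using dr[OF id_in_mp_homeos] unfolding compose_id_right[OF g] .
    from Phi_le_add[OF gi gg L r0 this] have 1: "Phi L g \<le> r"
      by (simp only: Phi_stabilizer[OF id_in_stabilizer[OF L]] add_0)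
    have "\<bar>Phi L (compose S2 g f) - Phi L f\<bar> \<le> r"
    proof (cases "good f")
      case True
      have gf: "good (compose S2 g f)" by (rule good_compose[OF gg True])
      show ?thesis
        using Phi_le_add[OF True gf L r0 dr[OF f]] Phi_le_add[OF gf True L r0] dr[OF f] dW_commute[of f] by simp
    next
      case False
      \<comment> \<open>If \<open>f\<close> has the default value then so has \<open>g f\<close>,
        and the difference vanishes.\<close>
      then have "\<not> good (compose S2 g f)" using good_cancel_left[OF gg _ f] by blast
      then show ?thesis using False r0 by (simp add: Phi_def)
    qed
    then show ?thesis using 1 Phi_nonneg[of L g] unfolding r_def[symmetric] mult.assoc by linarith
  qed
  \<comment> \<open>Division by the positive constant brings the estimate under the infimum, where
    it is checked one isotopy at a time.\<close>
  have inf: "ereal v \<le> ereal c * L1_norm \<rho> g"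
    if c: "c > 0" and v: "\<And>\<phi>. isotopy_from_id \<phi> \<Longrightarrow> \<phi> 1 = g \<Longrightarrow> v \<le> c * L1_length \<rho> \<phi>" for v c
  proof -
    have "ereal (v / c) \<le> L1_norm \<rho> g"
      unfolding L1_norm_def by (intro INF_greatest) (use v c in \<open>auto simp: divide_simps mult.commute\<close>)
    then have "ereal c * ereal (v / c) \<le> ereal c * L1_norm \<rho> g" using c by (intro ereal_mult_left_mono) auto
    then show ?thesis using c by simp
  qed
  show "ereal \<bar>Phi L (compose S2 g f) - Phi L f - Phi L g\<bar> \<le> ereal (2 * D) * L1_norm \<rho> g"
    by (rule inf) (use iso D(1) in auto)
  show "ereal \<bar>Phi L g\<bar> \<le> ereal D * L1_norm \<rho> g"
    by (rule inf) (use iso D(1) in auto)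
qed

end

section \<open>Linear growth of the phase under twists\<close>

lemma polar_Ln:
  fixes z :: complex assumes "z \<noteq> 0"
  shows "z = of_real (cmod z) * cis (Im (Ln z))"
proof -
  have "z = exp (Ln z)" using assms by simp
  also have "\<dots> = of_real (exp (Re (Ln z))) * cis (Im (Ln z))" by (rule exp_eq_polar)
  finally show ?thesis using assms by simp
qed

text \<open>Factoring out the dominant term leaves \<open>q t\<close> in the open disc of radius 1
  around 1, hence in the right half plane. There the principal argument is continuous and below
  \<open>pi / 2\<close> in modulus, so the two endpoint errors add up to at most
  \<open>pi\<close>.\<close>

lemma dominant_rotation_phase:
  fixes P Q :: complex and \<alpha> \<beta> :: real
  assumes PQ: "cmod Q < cmod P"
  obtains w where "continuous_on UNIV w"
    "\<And>t::real. P * cis (\<alpha> * t) + Q * cis (\<beta> * t) = of_real (cmod (P * cis (\<alpha> * t) + Q * cis (\<beta> * t))) * cis (w t)"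
    "\<bar>w 1 - w 0 - \<alpha>\<bar> \<le> pi"
proof -
  define q where "q t = 1 + Q / P * cis ((\<beta> - \<alpha>) * t)" for t
  have P0: "P \<noteq> 0" using PQ by auto
  have lt: "cmod (Q / P * cis ((\<beta> - \<alpha>) * t)) < 1" for t
    using PQ P0 by (simp add: norm_mult norm_divide)
  have re: "0 < Re (q t)" for t
    using lt[of t] abs_Re_le_cmod[of "Q / P * cis ((\<beta> - \<alpha>) * t)"] by (simp add: q_def)
  have q0: "q t \<noteq> 0" for t using re[of t] by auto
  define w where "w t = Im (Ln P) + \<alpha> * t + Im (Ln (q t))" for t
  have qc: "continuous_on UNIV q" unfolding q_def by (intro continuous_intros)
  have "continuous_on UNIV w" unfolding w_def
    by (intro continuous_intros qc) (use re in \<open>auto simp: complex_nonpos_Reals_iff not_le\<close>)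
  moreover have "P * cis (\<alpha> * t) + Q * cis (\<beta> * t) = of_real (cmod (P * cis (\<alpha> * t) + Q * cis (\<beta> * t))) * cis (w t)" for t
  proof -
    have b: "cis (\<beta> * t) = cis (\<alpha> * t) * cis ((\<beta> - \<alpha>) * t)" by (simp add: cis_mult algebra_simps)
    have e: "P * cis (\<alpha> * t) + Q * cis (\<beta> * t) = P * cis (\<alpha> * t) * q t"
      using P0 by (simp add: b q_def field_simps)
    have "P * cis (\<alpha> * t) * q t = (of_real (cmod P) * cis (Im (Ln P))) * cis (\<alpha> * t) * (of_real (cmod (q t)) * cis (Im (Ln (q t))))"
      using polar_Ln[OF P0] polar_Ln[OF q0[of t]] by metis
    also have "\<dots> = of_real (cmod (P * cis (\<alpha> * t) * q t)) * cis (w t)"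
      by (simp add: w_def norm_mult flip: cis_mult)
    finally show ?thesis unfolding e .
  qed
  moreover have "\<bar>w 1 - w 0 - \<alpha>\<bar> \<le> pi"
  proof -
    have "\<bar>Im (Ln (q t))\<bar> < pi / 2" for t using Re_Ln_pos_lt[OF q0[of t]] re[of t] by simp
    from this[of 0] this[of 1] show ?thesis unfolding w_def by (simp add: abs_if split: if_splits)
  qed
  ultimately show thesis by (rule that)
qed

context orthonormal_frame begin

text \<open>Off the south pole, where \<open>spinor\<close> jumps, the first coordinate depends on
  the height alone and the second is proportional to \<open>zeta\<close>.\<close>

lemma spinor_twist_ext:
  assumes "-1 < ht x"
  shows "spinor (twist_ext t x) = (fst (spinor x), cis (t * ht x) * snd (spinor x))"
  using assms by (simp add: spinor_def zeta_twist_ext ht_twist_ext)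

lemma hprod_twist:
  assumes "-1 < ht x" "-1 < ht y"
  shows "hprod (cospinor (twist_ext t x)) (spinor (twist_ext t y)) =
    fst (spinor x) * snd (spinor y) * cis (ht y * t) - fst (spinor y) * snd (spinor x) * cis (ht x * t)"
  by (simp add: hprod_def cospinor_def spinor_twist_ext[OF assms(1)] spinor_twist_ext[OF assms(2)] mult.commute mult.left_commute)

text \<open>The product is a sum of two rotating terms, with rates proportional to
  \<open>ht y\<close> and \<open>ht x\<close>. The squared moduli of their coefficients differ by
  \<open>(ht x - ht y) / 2\<close>, so the term that belongs to the lower height dominates.\<close>

lemma hprod_twist_phase:
  assumes x: "x \<in> S2" "-1 < ht x" and y: "y \<in> S2" "-1 < ht y" and ne: "ht x \<noteq> ht y"
  obtains w where "continuous_on UNIV w"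
    "\<And>t::real. hprod (cospinor (twist_ext (T * t) x)) (spinor (twist_ext (T * t) y)) =
      of_real (cmod (hprod (cospinor (twist_ext (T * t) x)) (spinor (twist_ext (T * t) y)))) * cis (w t)"
    "\<bar>w 1 - w 0 - T * min (ht x) (ht y)\<bar> \<le> pi"
proof -
  let ?A = "fst (spinor x) * snd (spinor y)" and ?B = "- (fst (spinor y) * snd (spinor x))"
  have n: "(cmod ?A)\<^sup>2 = (1 + ht x) * (1 - ht y) / 4" "(cmod ?B)\<^sup>2 = (1 + ht y) * (1 - ht x) / 4"
    unfolding norm_mult power_mult_distrib norm_minus_cancel spinor_facts(1,2)[OF x(1)] spinor_facts(1,2)[OF y(1)] by simp_all
  have S: "hprod (cospinor (twist_ext (T * t) x)) (spinor (twist_ext (T * t) y)) = ?A * cis ((T * ht y) * t) + ?B * cis ((T * ht x) * t)" for t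
    by (simp add: hprod_twist[OF x(2) y(2)] mult_ac)
  show thesis
  proof (cases "ht x < ht y")
    case True
    then have "(cmod ?A)\<^sup>2 < (cmod ?B)\<^sup>2" unfolding n by (intro divide_strict_right_mono) (simp_all add: algebra_simps)
    then have "cmod ?A < cmod ?B" by (rule power2_less_imp_less) simp
    then obtain w where "continuous_on UNIV w"
      "\<And>t::real. ?B * cis ((T * ht x) * t) + ?A * cis ((T * ht y) * t) = of_real (cmod (?B * cis ((T * ht x) * t) + ?A * cis ((T * ht y) * t))) * cis (w t)"
      "\<bar>w 1 - w 0 - T * ht x\<bar> \<le> pi" by (rule dominant_rotation_phase) blast
    with True show thesis by (intro that[of w]) (simp_all only: S add.commute min_def less_imp_le if_True)
  next
    case False
    with ne have lt: "ht y < ht x" by simp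
    then have "(cmod ?B)\<^sup>2 < (cmod ?A)\<^sup>2" unfolding n by (intro divide_strict_right_mono) (simp_all add: algebra_simps)
    then have "cmod ?B < cmod ?A" by (rule power2_less_imp_less) simp
    then obtain w where "continuous_on UNIV w"
      "\<And>t::real. ?A * cis ((T * ht y) * t) + ?B * cis ((T * ht x) * t) = of_real (cmod (?A * cis ((T * ht y) * t) + ?B * cis ((T * ht x) * t))) * cis (w t)"
      "\<bar>w 1 - w 0 - T * ht y\<bar> \<le> pi" by (rule dominant_rotation_phase) blast
    moreover have "min (ht x) (ht y) = ht y" using lt by simp
    ultimately show thesis by (intro that[of w]) (simp_all only: S)
  qed
qed

text \<open>Each factor contributes the lower of its two heights, with a sign from conjugation:
  \<open>ht x1 - ht x3 + ht x4 - ht x1\<close>. The nesting of the heights cancels \<open>x1\<close>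
  and leaves a positive rate; each of the four factors costs an error of \<open>pi\<close>.\<close>

lemma K_twist_phase:
  assumes S: "x1 \<in> S2" "x2 \<in> S2" "x3 \<in> S2" "x4 \<in> S2"
    and h: "-1 < ht x1" "ht x1 < ht x3" "ht x3 < ht x4" "ht x4 < ht x2"
  obtains w where "continuous_on UNIV w"
    "\<And>t::real. K (twist_ext (T * t) x1) (twist_ext (T * t) x2) (twist_ext (T * t) x3) (twist_ext (T * t) x4) =
      of_real (cmod (K (twist_ext (T * t) x1) (twist_ext (T * t) x2) (twist_ext (T * t) x3) (twist_ext (T * t) x4))) * cis (w t)"
    "\<bar>w 1 - w 0 - T * (ht x4 - ht x3)\<bar> \<le> 4 * pi"
proof -
  let ?H = "\<lambda>x y t. hprod (cospinor (twist_ext (T * t) x)) (spinor (twist_ext (T * t) y))"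
  obtain w13 where w13: "continuous_on UNIV w13" "\<And>t. ?H x1 x3 t = of_real (cmod (?H x1 x3 t)) * cis (w13 t)"
     "\<bar>w13 1 - w13 0 - T * min (ht x1) (ht x3)\<bar> \<le> pi"
    by (rule hprod_twist_phase[of x1 x3 T]) (use S h in \<open>auto\<close>)
  obtain w23 where w23: "continuous_on UNIV w23" "\<And>t. ?H x2 x3 t = of_real (cmod (?H x2 x3 t)) * cis (w23 t)"
     "\<bar>w23 1 - w23 0 - T * min (ht x2) (ht x3)\<bar> \<le> pi"
    by (rule hprod_twist_phase[of x2 x3 T]) (use S h in \<open>auto\<close>)
  obtain w24 where w24: "continuous_on UNIV w24" "\<And>t. ?H x2 x4 t = of_real (cmod (?H x2 x4 t)) * cis (w24 t)"
     "\<bar>w24 1 - w24 0 - T * min (ht x2) (ht x4)\<bar> \<le> pi"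
    by (rule hprod_twist_phase[of x2 x4 T]) (use S h in \<open>auto\<close>)
  obtain w14 where w14: "continuous_on UNIV w14" "\<And>t. ?H x1 x4 t = of_real (cmod (?H x1 x4 t)) * cis (w14 t)"
     "\<bar>w14 1 - w14 0 - T * min (ht x1) (ht x4)\<bar> \<le> pi"
    by (rule hprod_twist_phase[of x1 x4 T]) (use S h in \<open>auto\<close>)
  define w where "w t = w13 t - w23 t + w24 t - w14 t" for t
  have c: "hprod (spinor y) (cospinor x) = cnj (hprod (cospinor x) (spinor y))" for x y
    by (simp add: hprod_def split_beta mult.commute)
  have "continuous_on UNIV w" unfolding w_def by (intro continuous_intros w13 w23 w24 w14)
  moreover have "K (twist_ext (T * t) x1) (twist_ext (T * t) x2) (twist_ext (T * t) x3) (twist_ext (T * t) x4) =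
      of_real (cmod (K (twist_ext (T * t) x1) (twist_ext (T * t) x2) (twist_ext (T * t) x3) (twist_ext (T * t) x4))) * cis (w t)" for t
  proof -
    have E: "K (twist_ext (T * t) x1) (twist_ext (T * t) x2) (twist_ext (T * t) x3) (twist_ext (T * t) x4) =
      ?H x1 x3 t * cnj (?H x2 x3 t) * ?H x2 x4 t * cnj (?H x1 x4 t)"
      unfolding c[symmetric] by (rule K_spinor) (use S twist_in_sphere in blast)+
      have aux: "z1 * cnj z2 * z3 * cnj z4 = of_real (cmod (z1 * cnj z2 * z3 * cnj z4)) * cis (a1 - a2 + a3 - a4)"
        if "z1 = of_real (cmod z1) * cis a1" "z2 = of_real (cmod z2) * cis a2" "z3 = of_real (cmod z3) * cis a3"
          "z4 = of_real (cmod z4) * cis a4" for z1 z2 z3 z4 a1 a2 a3 a4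
      proof -
        have "z1 * cnj z2 * z3 * cnj z4 = (of_real (cmod z1) * cis a1) * cnj (of_real (cmod z2) * cis a2) * (of_real (cmod z3) * cis a3) * cnj (of_real (cmod z4) * cis a4)"
          using that by metis
        also have "\<dots> = of_real (cmod z1 * cmod z2 * cmod z3 * cmod z4) * (cis a1 * cis (- a2) * cis a3 * cis (- a4))"
          by (simp add: cis_cnj)
        also have "cis a1 * cis (- a2) * cis a3 * cis (- a4) = cis (a1 - a2 + a3 - a4)" by (simp add: cis_mult)
        finally show ?thesis by (simp add: norm_mult)
      qed
      show ?thesis unfolding E w_def by (rule aux[OF w13(2) w23(2) w24(2) w14(2)])
  qed
  moreover have "\<bar>w 1 - w 0 - T * (ht x4 - ht x3)\<bar> \<le> 4 * pi"
  proof -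
    have "min (ht x1) (ht x3) = ht x1" "min (ht x2) (ht x3) = ht x3" "min (ht x2) (ht x4) = ht x4" "min (ht x1) (ht x4) = ht x1"
      using h by auto
    note m = w13(3)[unfolded this] w23(3)[unfolded this] w24(3)[unfolded this] w14(3)[unfolded this]
    have "w 1 - w 0 - T * (ht x4 - ht x3) = (w13 1 - w13 0 - T * ht x1) - (w23 1 - w23 0 - T * ht x3)
      + (w24 1 - w24 0 - T * ht x4) - (w14 1 - w14 0 - T * ht x1)" by (simp add: w_def algebra_simps)
    with m show ?thesis by linarith
  qed
  ultimately show thesis by (rule that)
qed

end

lemma measurable_map_prod_self:
  assumes [measurable]: "f \<in> M \<rightarrow>\<^sub>M M"
  shows "map_prod f f \<in> M \<Otimes>\<^sub>M M \<rightarrow>\<^sub>M M \<Otimes>\<^sub>M M"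
  unfolding map_prod_def by measurable

lemma distr_map_prod:
  assumes "finite_measure M" "f \<in> M \<rightarrow>\<^sub>M M" "distr M M f = M"
  shows "distr (M \<Otimes>\<^sub>M M) (M \<Otimes>\<^sub>M M) (map_prod f f) = M \<Otimes>\<^sub>M M"
proof -
  interpret finite_measure M by fact
  have "sigma_finite_measure (distr M M f)" unfolding assms(3) by unfold_locales
  from pair_measure_distr[OF assms(2,2) this] show ?thesis
    unfolding assms(3) map_prod_def by simp
qed

text \<open>These are the two substitutions by which \<open>W_stabilizer\<close> expresses
  \<open>W h\<close> through the identity.\<close>

lemma distr_quad_measure:
  assumes h: "h \<in> mp_homeos"
  shows "distr quad_measure quad_measure (quad h) = quad_measure"
    "distr quad_measure quad_measure (prod.swap \<circ> quad h) = quad_measure"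
    "quad h \<in> quad_measure \<rightarrow>\<^sub>M quad_measure" "prod.swap \<circ> quad h \<in> quad_measure \<rightarrow>\<^sub>M quad_measure"
proof -
  let ?N = "sphere_area \<Otimes>\<^sub>M sphere_area"
  have hm: "h \<in> sphere_area \<rightarrow>\<^sub>M sphere_area"
    using mp_homeosD(6)[OF h] by (simp add: measurable_cong_sets[OF sets_sphere_area sets_sphere_area])
  have "distr sphere_area sphere_area h = distr sphere_area borel h" by (rule distr_cong) simp_all
  then have d1: "distr sphere_area sphere_area h = sphere_area" using h by (simp add: mp_homeos_def)
  have f1: "finite_measure sphere_area" by (rule finite_sphere_area)
  have m2: "map_prod h h \<in> ?N \<rightarrow>\<^sub>M ?N" using hm by (rule measurable_map_prod_self)
  have d2: "distr ?N ?N (map_prod h h) = ?N" by (rule distr_map_prod[OF f1 hm d1])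
  have f2: "finite_measure ?N" by (rule sphere_area2f.finite_measure_axioms)
  show m: "quad h \<in> quad_measure \<rightarrow>\<^sub>M quad_measure"
    unfolding quad_measure_def using m2 by (rule measurable_map_prod_self)
  show d: "distr quad_measure quad_measure (quad h) = quad_measure"
    unfolding quad_measure_def by (rule distr_map_prod[OF f2 m2 d2])
  have sw: "distr quad_measure quad_measure prod.swap = quad_measure"
    using sphere_area4.distr_pair_swap unfolding quad_measure_def prod.swap_def split_beta by (simp add: split_beta')
  have ms: "prod.swap \<in> quad_measure \<rightarrow>\<^sub>M quad_measure"
    unfolding quad_measure_def prod.swap_def[abs_def] by measurable
  show "distr quad_measure quad_measure (prod.swap \<circ> quad h) = quad_measure"
    unfolding distr_distr[OF ms m, symmetric] d by (rule sw)
  show "prod.swap \<circ> quad h \<in> quad_measure \<rightarrow>\<^sub>M quad_measure" by (rule measurable_comp[OF m ms])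
qed

context two_discs begin

lemma twist_in_mp_homeos: "twist t \<in> mp_homeos"
  by (rule mp_homeos_of_area_diffeos0[OF twist_in_area_diffeos0])

lemma continuous_on_twist: "continuous_on ({0..1} \<times> S2) (\<lambda>(t, x). twist (T * t) x)"
proof -
  have "continuous_on ({0..1} \<times> S2) (\<lambda>(t, x). twist_ext (T * t) x)"
    unfolding twist_ext_def split_beta by (intro continuous_intros)
  then show ?thesis
    by (rule continuous_on_cong[THEN iffD1, rotated 2]) (auto simp: twist_def)
qed

text \<open>Along the path \<open>twist (T * t)\<close> the explicit phase and the normalised lift
  have the same total change.\<close>

lemma W_twist:
  assumes p: "((x1, x2), (x3, x4)) \<in> Y"
    and h: "-1 < ht x1" "ht x1 < ht x3" "ht x3 < ht x4" "ht x4 < ht x2"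
  shows "\<bar>W (twist T) ((x1, x2), (x3, x4)) - W (restrict id S2) ((x1, x2), (x3, x4)) - T * (ht x4 - ht x3)\<bar> \<le> 4 * pi"
proof -
  let ?p = "((x1, x2), (x3, x4))"
  have S: "x1 \<in> S2" "x2 \<in> S2" "x3 \<in> S2" "x4 \<in> S2" using YE[OF p] by blast+
  obtain w where w: "continuous_on UNIV w"
    "\<And>t::real. K (twist_ext (T * t) x1) (twist_ext (T * t) x2) (twist_ext (T * t) x3) (twist_ext (T * t) x4) =
      of_real (cmod (K (twist_ext (T * t) x1) (twist_ext (T * t) x2) (twist_ext (T * t) x3) (twist_ext (T * t) x4))) * cis (w t)"
    "\<bar>w 1 - w 0 - T * (ht x4 - ht x3)\<bar> \<le> 4 * pi"
    by (rule K_twist_phase[OF S h, of T]) blast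
  have e: "Kq (quad (twist (T * t)) ?p) = K (twist_ext (T * t) x1) (twist_ext (T * t) x2) (twist_ext (T * t) x3) (twist_ext (T * t) x4)" for t
    unfolding Kq_def twist_def using S by simp
  have "W (twist (T * 1)) ?p - W (twist (T * 0)) ?p = w 1 - w 0"
  proof (rule W_isotopy_lift[OF continuous_on_twist twist_in_mp_homeos p])
    show "continuous_on {0..1} w" by (rule continuous_on_subset[OF w(1)]) simp
    show "Kq (quad (twist (T * t)) ?p) = of_real (cmod (Kq (quad (twist (T * t)) ?p))) * cis (w t)" for t
      unfolding e by (rule w(2))
  qed
  then show ?thesis using w(3) by (simp add: twist_0)
qed

text \<open>The path of twists is fed directly to \<open>dW_isotopy_le\<close>, which asks for
  continuity of the path and of its velocity \<open>X\<close>; this avoids verifying joint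
  smoothness in time and space.\<close>

lemma good_twist: "good (twist 1)"
proof -
  define X where "X t x = (e \<bullet> x) *\<^sub>R ((- sin (t * (e \<bullet> x)) * (a \<bullet> x) - cos (t * (e \<bullet> x)) * (b \<bullet> x)) *\<^sub>R a +
     (cos (t * (e \<bullet> x)) * (a \<bullet> x) - sin (t * (e \<bullet> x)) * (b \<bullet> x)) *\<^sub>R b)" for t :: real and x
  have cX: "continuous_on ({0..1} \<times> S2) (\<lambda>(t, x). X t x)"
    unfolding X_def split_beta by (intro continuous_intros)
  have d: "((\<lambda>s. twist s x) has_vector_derivative X t x) (at t within {0..1})" if "x \<in> S2" for t x
  proof -
    have "((\<lambda>s. twist_ext s x) has_vector_derivative X t x) (at t within {0..1})"
      unfolding twist_ext_def has_vector_derivative_def X_def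
      by (rule has_derivative_eq_rhs, (rule derivative_intros)+) (simp add: fun_eq_iff algebra_simps)
    then show ?thesis using that by (simp add: twist_def)
  qed
  have "compact ((\<lambda>(t, x). X t x) ` ({0..1} \<times> S2))"
    by (intro compact_continuous_image[OF cX] compact_Times compact_Icc compact_sphere)
  then have "bounded ((\<lambda>(t, x). X t x) ` ({0..1} \<times> S2))" by (rule compact_imp_bounded)
  then obtain B where B: "\<forall>y\<in>(\<lambda>(t, x). X t x) ` ({0..1} \<times> S2). norm y \<le> B"
    unfolding bounded_iff by (rule exE)
  have XB: "norm (X t x) \<le> B" if "t \<in> {0..1}" "x \<in> S2" for t x
    by (rule B[rule_format], rule image_eqI[of _ _ "(t, x)"]) (use that in simp_all)
  define c where "c = ennreal B * total_area"
  have ta: "total_area < top" unfolding total_area_def by (simp add: sphere_area.emeasure_finite less_top[symmetric])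
  have "(\<integral>\<^sup>+t. indicator {0..1} t * (\<integral>\<^sup>+x. indicator S2 x * ennreal (norm (X t x)) \<partial>sphere_area) \<partial>lborel)
    \<le> (\<integral>\<^sup>+t. c * indicator {0..1::real} t \<partial>lborel)"
  proof (rule nn_integral_mono)
    fix t :: real
    show "indicator {0..1} t * (\<integral>\<^sup>+x. indicator S2 x * ennreal (norm (X t x)) \<partial>sphere_area) \<le> c * indicator {0..1::real} t"
    proof (cases "t \<in> {0..1}")
      case True
      have "(\<integral>\<^sup>+x. indicator S2 x * ennreal (norm (X t x)) \<partial>sphere_area) \<le> (\<integral>\<^sup>+x. ennreal B \<partial>sphere_area)"
      proof (rule nn_integral_mono)
        fix x
        show "indicator S2 x * ennreal (norm (X t x)) \<le> ennreal B"
          using XB[OF True, of x] by (cases "x \<in> S2") (simp_all add: ennreal_leI)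
      qed
      also have "\<dots> = c" by (simp add: c_def total_area_def)
      finally show ?thesis using True by simp
    qed simp
  qed
  also have "\<dots> = c" by (simp add: nn_integral_cmult_indicator)
  also have "c < top" using ta by (simp add: c_def ennreal_mult_less_top)
  finally have fin: "(\<integral>\<^sup>+t. indicator {0..1} t * (\<integral>\<^sup>+x. indicator S2 x * ennreal (norm (X t x)) \<partial>sphere_area) \<partial>lborel) < top" .
  let ?I = "ennreal 32 * ((ennreal (2 * pi\<^sup>2))\<^sup>2 * total_area *
      (\<integral>\<^sup>+t. indicator {0..1} t * (\<integral>\<^sup>+x. indicator S2 x * ennreal (norm (X t x)) \<partial>sphere_area) \<partial>lborel))"
  have "?I < top" using fin ta by (intro ennreal_mult_less_top[THEN iffD2] disjI2 conjI) (simp_all add: power_less_top_ennreal)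
  moreover have "dW (compose S2 (twist 1) u) u \<le> ?I" if u: "u \<in> mp_homeos" for u
  proof -
    have "dW (compose S2 (twist 1) u) (compose S2 (twist 0) u) \<le> ?I"
      using continuous_on_twist[of 1] by (intro dW_isotopy_le twist_in_mp_homeos cX d u) simp_all
    then show ?thesis by (simp only: twist_0 compose_id_left[OF u])
  qed
  ultimately show ?thesis unfolding good_def using twist_in_mp_homeos by (intro conjI exI[of _ ?I]) auto
qed

text \<open>By \<open>W_stabilizer\<close>, \<open>W h\<close> is \<open>W\<close> of the identity
  after a measure-preserving substitution. Comparing tails makes the later lower bound uniform in
  \<open>h\<close>.\<close>

lemma stabilizer_tail:
  assumes h: "h \<in> stabilizer L" and L: "L \<subseteq> S2" "S2 - L = U \<union> V"
  shows "measure quad_measure {p \<in> Y. c < \<bar>W h p\<bar>} \<le> measure quad_measure {p \<in> Y. c < \<bar>W (restrict id S2) p\<bar>}"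
proof -
  have hm: "h \<in> mp_homeos" "h ` L = L" using h by (auto simp: stabilizer_def)
  note C = stabilizer_cases[OF hm L(2,1)]
  define s where "s = (if h ` U \<subseteq> U then quad h else prod.swap \<circ> quad h)"
  have s: "distr quad_measure quad_measure s = quad_measure" "s \<in> quad_measure \<rightarrow>\<^sub>M quad_measure"
    using distr_quad_measure[OF hm(1)] by (simp_all add: s_def)
  let ?A = "{p \<in> Y. c < \<bar>W (restrict id S2) p\<bar>}"
  have [measurable]: "W (restrict id S2) \<in> borel_measurable borel" by (rule W_measurable[OF id_in_mp_homeos])
  have A: "?A \<in> sets quad_measure" unfolding sets_quad_measure by measurable
  have sY: "s p \<in> Y" if "p \<in> Y" for p
  proof -
    have "(h ` U \<subseteq> U \<and> h ` V \<subseteq> V) \<or> (\<not> h ` U \<subseteq> U \<and> h ` U \<subseteq> V \<and> h ` V \<subseteq> U)"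
      using C ne_UV disjoint_UV by blast
    then show ?thesis using that by (auto simp: s_def Y_def image_subset_iff)
  qed
  have Wh: "W h p = W (restrict id S2) (s p)" if "p \<in> Y" for p
    using W_stabilizer[OF hm(1) that C] by (simp add: s_def)
  have "{p \<in> Y. c < \<bar>W h p\<bar>} \<subseteq> s -` ?A \<inter> space quad_measure"
    using sY Wh by auto
  then have "measure quad_measure {p \<in> Y. c < \<bar>W h p\<bar>} \<le> measure quad_measure (s -` ?A \<inter> space quad_measure)"
    by (rule quad_measure.finite_measure_mono) (rule measurable_sets[OF s(2) A])
  also have "\<dots> = measure (distr quad_measure quad_measure s) ?A" by (rule measure_distr[OF s(2) A, symmetric])
  finally show ?thesis unfolding s(1) .
qed

text \<open>A real-valued function on a finite measure space: the sets where it exceeds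
  \<open>n\<close> decrease to the empty set.\<close>

lemma W_tight:
  assumes "m > 0"
  obtains n :: nat where "measure quad_measure {p \<in> Y. real n < \<bar>W (restrict id S2) p\<bar>} < m"
proof -
  let ?A = "\<lambda>n::nat. {p \<in> Y. real n < \<bar>W (restrict id S2) p\<bar>}"
  have [measurable]: "W (restrict id S2) \<in> borel_measurable borel" by (rule W_measurable[OF id_in_mp_homeos])
  have A: "?A n \<in> sets quad_measure" for n unfolding sets_quad_measure by measurable
  have "(\<lambda>n. measure quad_measure (?A n)) \<longlonglongrightarrow> measure quad_measure (\<Inter>n. ?A n)"
  proof (rule quad_measure.finite_Lim_measure_decseq)
    show "range ?A \<subseteq> sets quad_measure" by (rule image_subsetI) (rule A)
    show "decseq ?A" unfolding decseq_def
    proof (intro allI impI subsetI)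
      fix i j p assume "i \<le> j" "p \<in> ?A j"
      moreover from \<open>i \<le> j\<close> have "real i \<le> real j" by simp
      ultimately show "p \<in> ?A i" unfolding mem_Collect_eq by (meson le_less_trans)
    qed
  qed
  moreover have "(\<Inter>n. ?A n) = {}"
  proof -
    have "\<not> (\<forall>n::nat. real n < \<bar>W (restrict id S2) p\<bar>)" for p
      using real_arch_simple[of "\<bar>W (restrict id S2) p\<bar>"] by (simp add: not_less)
    then show ?thesis by blast
  qed
  ultimately have "(\<lambda>n. measure quad_measure (?A n)) \<longlonglongrightarrow> 0" by (simp only: measure_empty)
  then have "\<forall>\<^sub>F n in sequentially. measure quad_measure (?A n) < m" by (rule order_tendstoD(2)[OF _ assms])
  then obtain k where "\<forall>n\<ge>k. measure quad_measure (?A n) < m" unfolding eventually_sequentially by (rule exE)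
  from this[rule_format, OF order_refl] show thesis by (rule that)
qed

lemma measure_box_pos:
  assumes o: "openin (top_of_set S2) U1" "openin (top_of_set S2) U2" "openin (top_of_set S2) V3" "openin (top_of_set S2) V4"
    and ne: "U1 \<noteq> {}" "U2 \<noteq> {}" "V3 \<noteq> {}" "V4 \<noteq> {}"
  shows "(U1 \<times> U2) \<times> (V3 \<times> V4) \<in> sets quad_measure" "0 < measure quad_measure ((U1 \<times> U2) \<times> (V3 \<times> V4))"
proof -
  have b: "X \<in> sets sphere_area" if "openin (top_of_set S2) X" for X
    using that by (auto simp: openin_open)
  have pos: "0 < emeasure sphere_area X" if X: "openin (top_of_set S2) X" "X \<noteq> {}" for X
  proof -
    obtain G where G: "open G" "X = G \<inter> S2" using X(1) by (auto simp: openin_open Int_commute)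
    obtain x where "x \<in> X" using X(2) by blast
    then have "x \<in> G" "x \<in> S2" using G(2) by blast+
    then show ?thesis unfolding G(2) by (rule emeasure_sphere_area_pos[OF G(1)])
  qed
  let ?N = "sphere_area \<Otimes>\<^sub>M sphere_area"
  have m2: "A \<times> B \<in> sets ?N" if "A \<in> sets sphere_area" "B \<in> sets sphere_area" for A B
    using that by (rule pair_measureI)
  have e2: "emeasure ?N (A \<times> B) = emeasure sphere_area A * emeasure sphere_area B"
    if "A \<in> sets sphere_area" "B \<in> sets sphere_area" for A B
    by (rule sigma_finite_measure.emeasure_pair_measure_Times[OF _ that]) unfold_locales
  show "(U1 \<times> U2) \<times> (V3 \<times> V4) \<in> sets quad_measure"
    unfolding quad_measure_def by (intro pair_measureI b o)
  have "emeasure quad_measure ((U1 \<times> U2) \<times> (V3 \<times> V4)) =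
    (emeasure sphere_area U1 * emeasure sphere_area U2) * (emeasure sphere_area V3 * emeasure sphere_area V4)"
    unfolding quad_measure_def e2[OF b[OF o(1)] b[OF o(2)], symmetric] e2[OF b[OF o(3)] b[OF o(4)], symmetric]
    by (rule sigma_finite_measure.emeasure_pair_measure_Times) (unfold_locales, intro m2 b o, intro m2 b o)
  also have "0 < \<dots>"
    using pos[OF o(1) ne(1)] pos[OF o(2) ne(2)] pos[OF o(3) ne(3)] pos[OF o(4) ne(4)]
    by (simp add: ennreal_zero_less_mult_iff)
  finally show "0 < measure quad_measure ((U1 \<times> U2) \<times> (V3 \<times> V4))"
    by (simp add: quad_measure.emeasure_eq_measure)
qed

text \<open>On a box of positive measure the phase of the iterated twist grows like \<open>k\<close>
  times the gap of heights, while all \<open>W h\<close> have tails controlled by \<open>W\<close>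
  of the identity. Removing small exceptional sets from the box leaves at least half of it, where
  every \<open>W h\<close> is far away.\<close>

lemma liminf_mean_twist:
  assumes L: "L \<subseteq> S2" "S2 - L = U \<union> V"
    and o: "openin (top_of_set S2) U1" "openin (top_of_set S2) U2" "openin (top_of_set S2) V3" "openin (top_of_set S2) V4"
    and ne: "U1 \<noteq> {}" "U2 \<noteq> {}" "V3 \<noteq> {}" "V4 \<noteq> {}"
    and sub: "U1 \<subseteq> U" "U2 \<subseteq> U" "V3 \<subseteq> V" "V4 \<subseteq> V" and \<delta>: "0 < \<delta>"
    and hts: "\<And>x1 x2 x3 x4. x1 \<in> U1 \<Longrightarrow> x2 \<in> U2 \<Longrightarrow> x3 \<in> V3 \<Longrightarrow> x4 \<in> V4 \<Longrightarrow>
      -1 < ht x1 \<and> ht x1 < ht x3 \<and> ht x3 + \<delta> \<le> ht x4 \<and> ht x4 < ht x2"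
  shows "liminf_mean (Phi L) (twist 1) \<noteq> 0"
proof -
  define N where "N = (U1 \<times> U2) \<times> (V3 \<times> V4)"
  define m where "m = measure quad_measure N"
  have Ns: "N \<in> sets quad_measure" and m0: "m > 0"
    unfolding m_def N_def using measure_box_pos[OF o ne] by simp_all
  have NY: "N \<subseteq> Y" unfolding N_def Y_def by (intro Sigma_mono sub)
  \<comment> \<open>Two sets of measure below \<open>m / 4\<close> will be removed from the box, one
    for the identity and one for \<open>h\<close>, so that measure \<open>m / 2\<close>
    stays.\<close>
  obtain n :: nat where n: "measure quad_measure {p \<in> Y. real n < \<bar>W (restrict id S2) p\<bar>} < m / 4"
    using W_tight[of "m / 4"] m0 by auto
  \<comment> \<open>\<open>4 * pi\<close> is the error in \<open>W_twist\<close>; the identity and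
    \<open>h\<close> account for one \<open>real n\<close> each. For small \<open>k\<close> the left
    side may be negative, and then \<open>Phi_nonneg\<close> suffices.\<close>
  have low: "(real k * \<delta> - 4 * pi - 2 * real n) * (m / 2) \<le> Phi L (twist (real k))" (is "?c * _ \<le> _") for k
  proof (cases "0 \<le> ?c")
    case False
    then have "?c * (m / 2) \<le> 0" using m0 by (intro mult_nonpos_nonneg) auto
    then show ?thesis using Phi_nonneg[of L "twist (real k)"] by linarith
  next
    case True
    have "ennreal (?c * (m / 2)) \<le> dW (twist (real k)) h" if h: "h \<in> stabilizer L" for h
    proof -
      let ?i = "restrict id S2"
      have hm: "h \<in> mp_homeos" using h by (simp add: stabilizer_def)
      have [measurable]: "W ?i \<in> borel_measurable borel" "W h \<in> borel_measurable borel"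
        by (intro W_measurable id_in_mp_homeos hm)+
      define A where "A = {p \<in> Y. real n < \<bar>W ?i p\<bar>}"
      define H where "H = {p \<in> Y. real n < \<bar>W h p\<bar>}"
      have As: "A \<in> sets quad_measure" and Hs: "H \<in> sets quad_measure"
        unfolding A_def H_def sets_quad_measure by measurable
      have mA: "measure quad_measure A < m / 4" using n by (simp add: A_def)
      have mH: "measure quad_measure H < m / 4"
        using stabilizer_tail[OF h L, of "real n"] n unfolding H_def by linarith
      define E where "E = N - (A \<union> H)"
      have Es: "E \<in> sets quad_measure" unfolding E_def using Ns As Hs by blast
      have "m \<le> measure quad_measure (E \<union> (A \<union> H))"
        unfolding m_def
      proof (rule quad_measure.finite_measure_mono)
        show "N \<subseteq> E \<union> (A \<union> H)" unfolding E_def by blast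
        show "E \<union> (A \<union> H) \<in> sets quad_measure" by (intro sets.Un Es As Hs)
      qed
      also have "\<dots> \<le> measure quad_measure E + measure quad_measure (A \<union> H)"
        by (rule measure_Un_le) (use As Hs Es in blast)+
      also have "measure quad_measure (A \<union> H) \<le> measure quad_measure A + measure quad_measure H"
        by (rule measure_Un_le) (use As Hs in blast)+
      finally have mE: "m / 2 \<le> measure quad_measure E" using mA mH by linarith
      have big: "?c \<le> \<bar>W (twist (real k)) p - W h p\<bar>" if p: "p \<in> E" for p
      proof -
        have pN: "p \<in> N" "p \<notin> A" "p \<notin> H" using p by (auto simp: E_def)
        have pY: "p \<in> Y" using pN NY by blast
        obtain x1 x2 x3 x4 where px: "p = ((x1, x2), (x3, x4))" "x1 \<in> U1" "x2 \<in> U2" "x3 \<in> V3" "x4 \<in> V4"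
          using pN(1) unfolding N_def by blast
        note hx = hts[OF px(2-5)]
        have "\<bar>W (twist (real k)) p - W ?i p - real k * (ht x4 - ht x3)\<bar> \<le> 4 * pi"
          unfolding px(1) by (rule W_twist) (use pY px(1) hx \<delta> in auto)
        moreover have "real k * \<delta> \<le> real k * (ht x4 - ht x3)" using hx by (intro mult_left_mono) auto
        moreover have "\<bar>W ?i p\<bar> \<le> real n" "\<bar>W h p\<bar> \<le> real n" using pN pY by (auto simp: A_def H_def)
        ultimately show ?thesis by linarith
      qed
      have "ennreal (?c * (m / 2)) \<le> ennreal (?c * measure quad_measure E)"
        by (intro ennreal_leI mult_left_mono mE True)
      also have "\<dots> = (\<integral>\<^sup>+p. ennreal ?c * indicator E p \<partial>quad_measure)"
        using True by (simp add: nn_integral_cmult_indicator[OF Es] quad_measure.emeasure_eq_measure ennreal_mult')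
      also have "\<dots> \<le> dW (twist (real k)) h"
        unfolding dW_def
      proof (rule nn_integral_mono)
        fix p show "ennreal ?c * indicator E p \<le> ennreal \<bar>W (twist (real k)) p - W h p\<bar>"
          using big[of p] by (cases "p \<in> E") (simp_all add: ennreal_leI)
      qed
      finally show ?thesis .
    qed
    then have "ennreal (?c * (m / 2)) \<le> (INF h\<in>stabilizer L. dW (twist (real k)) h)" by (rule INF_greatest)
    also have "\<dots> = ennreal (Phi L (twist (real k)))"
      by (rule ennreal_Phi[OF _ L(1), symmetric]) (use good_power[OF good_twist, of k] in \<open>simp only: twist_funpow\<close>)
    finally show ?thesis by (simp add: ennreal_le_iff Phi_nonneg)
  qed
  \<comment> \<open>From \<open>k0\<close> on the constant loss is at most half of
    \<open>real k * \<delta>\<close>, which leaves \<open>\<delta> * m / 4\<close> as a lower bound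
    for the quotients.\<close>
  obtain k0 :: nat where k0: "2 * (4 * pi + 2 * real n) / \<delta> \<le> real k0" using real_arch_simple by blast
  have "ereal (\<delta> * m / 4) \<le> ereal (Phi L (restrict (twist 1 ^^ k) S2) / real k)" if k: "k \<ge> Suc k0" for k
  proof -
    have kp: "0 < real k" using k by simp
    have "2 * (4 * pi + 2 * real n) \<le> real k0 * \<delta>" using k0 \<delta> by (simp add: pos_divide_le_eq)
    also have "\<dots> \<le> real k * \<delta>" using k \<delta> by (intro mult_right_mono) auto
    finally have kd: "2 * (4 * pi + 2 * real n) \<le> real k * \<delta>" .
    have half: "z / 2 \<le> z - 4 * pi - 2 * real n" if "2 * (4 * pi + 2 * real n) \<le> z" for z
    proof -
      have "4 * pi + 2 * real n \<le> z / 2" using that by (simp only: pos_le_divide_eq zero_less_numeral mult.commute)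
      moreover have "z = z / 2 + z / 2" by (rule field_sum_of_halves[symmetric])
      ultimately show ?thesis by linarith
    qed
    have "real k * \<delta> / 2 \<le> real k * \<delta> - 4 * pi - 2 * real n" by (rule half[OF kd])
    then have "real k * \<delta> / 2 * (m / 2) \<le> (real k * \<delta> - 4 * pi - 2 * real n) * (m / 2)"
      using m0 by (intro mult_right_mono) auto
    also have "\<dots> \<le> Phi L (twist (real k))" by (rule low)
    finally have le: "real k * \<delta> / 2 * (m / 2) \<le> Phi L (twist (real k))" .
    have eq: "\<delta> * m / 4 * real k = real k * \<delta> / 2 * (m / 2)" by (simp add: field_simps)
    have "\<delta> * m / 4 * real k \<le> Phi L (twist (real k))" unfolding eq by (rule le)
    then show ?thesis using kp by (simp only: twist_funpow ereal_less_eq pos_le_divide_eq)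
  qed
  then have "\<forall>\<^sub>F k in sequentially. ereal (\<delta> * m / 4) \<le> ereal (Phi L (restrict (twist 1 ^^ k) S2) / real k)"
    unfolding eventually_sequentially by blast
  then have "ereal (\<delta> * m / 4) \<le> liminf_mean (Phi L) (twist 1)"
    unfolding liminf_mean_def by (rule Liminf_bounded)
  moreover have "0 < ereal (\<delta> * m / 4)" using \<delta> m0 by simp
  ultimately have "0 < liminf_mean (Phi L) (twist 1)" by (rule less_le_trans[rotated])
  then show ?thesis by (rule less_imp_neq[THEN not_sym])
qed

end

section \<open>The discs of an equator and a frame adapted to them\<close>

lemma simply_connected_complementary_disc:
  fixes \<gamma> :: "real \<Rightarrow> real^3"
  assumes L: "compact L" "L \<subseteq> S2" and UV: "S2 - L = U \<union> V" "U \<inter> V = {}" "U \<noteq> {}" "V \<noteq> {}"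
    and op: "openin (top_of_set S2) U" "openin (top_of_set S2) V"
    and \<gamma>: "continuous_on {0..1} \<gamma>" "\<gamma> 1 = \<gamma> 0" "inj_on \<gamma> {0..<1}" "\<gamma> ` {0..1} = L"
  shows "simply_connected U"
proof -
  obtain v where v: "v \<in> V" using UV(4) by blast
  have US: "U \<subseteq> S2" "V \<subseteq> S2" using op openin_imp_subset by blast+
  \<comment> \<open>Removing a point of \<open>V\<close> turns the sphere into the plane and the
    loop into a Jordan curve; \<open>U\<close> will be identified with its inside, which is simply
    connected.\<close>
  have "(S2 - {v}) homeomorphic (UNIV :: complex set)"
    by (rule homeomorphic_punctured_sphere_affine) (use v US in \<open>auto simp: subset_iff\<close>)
  then obtain h k where hk: "homeomorphism (S2 - {v}) (UNIV :: complex set) h k" unfolding homeomorphic_def by blast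
  have ch: "continuous_on (S2 - {v}) h" and inj: "inj_on h (S2 - {v})" and sur: "h ` (S2 - {v}) = UNIV"
    using hk by (auto simp: homeomorphism_def intro: inj_on_inverseI)
  have vn: "v \<notin> L" "v \<notin> U" using v UV by blast+
  have Lv: "L \<subseteq> S2 - {v}" "U \<subseteq> S2 - {v}" using vn L(2) US by blast+
  define p where "p = h \<circ> \<gamma>"
  have pim: "path_image p = h ` L" unfolding p_def path_image_def image_comp[symmetric] \<gamma>(4) ..
  have pp: "path p" unfolding path_def p_def
    by (rule continuous_on_compose[OF \<gamma>(1)]) (use continuous_on_subset[OF ch Lv(1)] \<gamma>(4) in simp)
  have lf: "loop_free p"
    unfolding loop_free_def
  proof (intro ballI impI)
    fix x y :: real assume x: "x \<in> {0..1}" and y: "y \<in> {0..1}" and e: "p x = p y"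
    have "\<gamma> x \<in> L" "\<gamma> y \<in> L" using x y \<gamma>(4) by blast+
    then have "\<gamma> x \<in> S2 - {v}" "\<gamma> y \<in> S2 - {v}" using Lv(1) by blast+
    then have g: "\<gamma> x = \<gamma> y" using inj_onD[OF inj, of "\<gamma> x" "\<gamma> y"] e by (simp add: p_def)
    show "x = y \<or> x = 0 \<and> y = 1 \<or> x = 1 \<and> y = 0"
    proof (cases "x = 1 \<or> y = 1")
      case False
      then have "x \<in> {0..<1}" "y \<in> {0..<1}" using x y by auto
      then show ?thesis using g \<gamma>(3) by (simp add: inj_on_def)
    next
      case True
      then show ?thesis
      proof
        assume x1: "x = 1"
        show ?thesis
        proof (cases "y = 1")
          case False
          then have "\<gamma> 0 = \<gamma> y" "y \<in> {0..<1}" using g x1 \<gamma>(2) y by auto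
          then have "y = 0" using inj_onD[OF \<gamma>(3), of 0 y] by simp
          then show ?thesis using x1 by simp
        qed (use x1 in simp)
      next
        assume y1: "y = 1"
        show ?thesis
        proof (cases "x = 1")
          case False
          then have "\<gamma> 0 = \<gamma> x" "x \<in> {0..<1}" using g y1 \<gamma>(2) x by auto
          then have "x = 0" using inj_onD[OF \<gamma>(3), of 0 x] by simp
          then show ?thesis using y1 by simp
        qed (use y1 in simp)
      qed
    qed
  qed
  have sp: "simple_path p" using pp lf by (simp add: simple_path_def)
  have cl: "pathfinish p = pathstart p" using \<gamma>(2) by (simp add: pathfinish_def pathstart_def p_def)
  note J = Jordan_inside_outside[OF sp cl]
  define A where "A = h ` U" define B where "B = h ` (V - {v})"
  have opn: "open (h ` X)" if "openin (top_of_set (S2 - {v})) X" for X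
    using homeomorphism_imp_open_map[OF hk that] by simp
  have "openin (top_of_set (S2 - {v})) U"
    by (rule openin_subset_trans[OF op(1) Lv(2)]) blast
  then have oA: "open A" unfolding A_def by (rule opn)
  have "openin (top_of_set S2) (V - {v})" by (rule openin_delete[OF op(2)])
  then have "openin (top_of_set (S2 - {v})) (V - {v})"
    by (rule openin_subset_trans) (use US in blast)+
  then have oB: "open B" unfolding B_def by (rule opn)
  have AB: "A \<union> B = inside (path_image p) \<union> outside (path_image p)"
  proof -
    have "U \<union> (V - {v}) = (S2 - {v}) - L" using UV(1) vn by blast
    then have "A \<union> B = h ` ((S2 - {v}) - L)" unfolding A_def B_def by (simp add: image_Un[symmetric])
    also have "\<dots> = h ` (S2 - {v}) - h ` L" using inj Lv(1) by (simp add: inj_on_image_set_diff)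
    also have "\<dots> = - path_image p" unfolding sur pim by blast
    finally show ?thesis using J by simp
  qed
  have "A \<inter> B = h ` (U \<inter> (V - {v}))" unfolding A_def B_def
    by (rule inj_on_image_Int[OF inj, symmetric]) (use Lv US in auto)
  then have dAB: "A \<inter> B = {}" using UV(2) by auto
  \<comment> \<open>The complement of \<open>V\<close> is compact and avoids \<open>v\<close>, so
    the image of \<open>U\<close> is bounded; this rules out that it contains the outside.\<close>
  have cSV: "compact (S2 - V)"
  proof -
    have "closedin (top_of_set S2) (S2 - V)" using op(2) by (simp add: closedin_def Diff_Diff_Int Int_absorb1[OF US(2)])
    then show ?thesis using compact_sphere closedin_compact by blast
  qed
  have "S2 - V \<subseteq> S2 - {v}" using v by blast
  then have "compact (h ` (S2 - V))"
    by (intro compact_continuous_image[OF continuous_on_subset[OF ch] cSV])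
  then have bA: "bounded A"
    by (rule bounded_subset[OF compact_imp_bounded]) (use US UV(2) in \<open>auto simp: A_def simp del: mem_sphere_0\<close>)
  \<comment> \<open>\<open>A\<close> and \<open>B\<close> are open and disjoint, so a connected
    subset of their union lies in one of them. This decides where the inside and the outside of the
    curve go.\<close>
  have conn: "C \<subseteq> A \<or> C \<inter> A = {}" if "connected C" "C \<subseteq> A \<union> B" for C
    using connectedD[OF that(1) oA oB _ that(2)] dAB that(2) by blast
  have "outside (path_image p) \<inter> A = {}"
  proof -
    have "outside (path_image p) \<subseteq> A \<or> outside (path_image p) \<inter> A = {}"
    proof (rule conn)
      show "connected (outside (path_image p))" using J by blast
      show "outside (path_image p) \<subseteq> A \<union> B" unfolding AB by (rule Un_upper2)
    qed
    moreover have "\<not> outside (path_image p) \<subseteq> A" using J bA bounded_subset by blast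
    ultimately show ?thesis by blast
  qed
  then have Ai: "A \<subseteq> inside (path_image p)" using AB by blast
  have "A \<noteq> {}" using UV(3) by (simp add: A_def)
  then have "inside (path_image p) \<inter> A \<noteq> {}" using Ai by blast
  moreover have "inside (path_image p) \<subseteq> A \<or> inside (path_image p) \<inter> A = {}"
  proof (rule conn)
    show "connected (inside (path_image p))" using J by blast
    show "inside (path_image p) \<subseteq> A \<union> B" unfolding AB by (rule Un_upper1)
  qed
  ultimately have "A = inside (path_image p)" using Ai by blast
  then have "simply_connected A" using simply_connected_inside_simple_path[OF sp] by simp
  moreover have "homeomorphism U A h k"
    by (rule homeomorphism_of_subsets[OF hk Lv(2) subset_refl]) (simp add: A_def)
  then have "U homeomorphic A" unfolding homeomorphic_def by blast
  ultimately show ?thesis by (simp only: homeomorphic_simply_connected_eq)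
qed

text \<open>The components are open because the complement of the loop is locally connected; the
  Jordan curve argument applies twice, with the roles of the components exchanged.\<close>

lemma equator_discs:
  assumes "equator L"
  obtains U V where "S2 - L = U \<union> V" "L \<subseteq> S2" "U \<inter> V = {}" "U \<noteq> {}" "V \<noteq> {}"
    "openin (top_of_set S2) U" "openin (top_of_set S2) V" "simply_connected U" "simply_connected V"
proof -
  obtain U V where LS: "L \<subseteq> S2" and UV: "components (S2 - L) = {U, V}" "U \<noteq> V"
    and lp: "smooth_embedded_loop L"
    using assms unfolding equator_def by blast
  obtain \<gamma> :: "real \<Rightarrow> real^3" where \<gamma>: "smooth_on UNIV \<gamma>" "\<And>t. \<gamma> (t + 1) = \<gamma> t" "inj_on \<gamma> {0..<1}" "range \<gamma> = L"
    using lp unfolding smooth_embedded_loop_def by blast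
  have c: "continuous_on {0..1} \<gamma>"
    using smooth_on_imp_continuous_on[OF \<gamma>(1)] continuous_on_subset by blast
  have per: "\<gamma> (t + real n) = \<gamma> t" for t n
  proof (induction n)
    case (Suc n)
    then show ?case using \<gamma>(2)[of "t + real n"] by (simp add: add.assoc add.commute[of 1])
  qed simp
  have im: "\<gamma> ` {0..1} = L"
  proof -
    have "\<gamma> t \<in> \<gamma> ` {0..1}" for t
    proof (cases "t \<ge> 0")
      case True
      define n where "n = nat \<lfloor>t\<rfloor>"
      have "\<gamma> (t - real n) = \<gamma> t" using per[of "t - real n" n] by simp
      moreover have "t - real n \<in> {0..1}" using True unfolding n_def by simp linarith
      ultimately show ?thesis by (metis imageI)
    next
      case False
      define n where "n = nat \<lceil>- t\<rceil>"
      have "\<gamma> (t + real n) = \<gamma> t" by (rule per)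
      moreover have "t + real n \<in> {0..1}" using False unfolding n_def by simp linarith
      ultimately show ?thesis by (metis imageI)
    qed
    then show ?thesis using \<gamma>(4) by blast
  qed
  have cL: "compact L" using compact_continuous_image[OF c] im by auto
  have g1: "\<gamma> 1 = \<gamma> 0" using \<gamma>(2)[of 0] by simp
  have "closedin (top_of_set S2) L" using cL LS by (simp add: closed_subset compact_imp_closed)
  then have oL: "openin (top_of_set S2) (S2 - L)" by (intro openin_diff) auto
  have "locally connected (S2 - L)"
    by (rule locally_open_subset[OF _ oL]) (simp add: locally_connected_sphere)
  then have "openin (top_of_set (S2 - L)) U" "openin (top_of_set (S2 - L)) V"
    using UV openin_components_locally_connected by blast+
  then have op: "openin (top_of_set S2) U" "openin (top_of_set S2) V"
    using oL openin_trans by blast+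
  have un: "S2 - L = U \<union> V" using Union_components[of "S2 - L"] UV by simp
  have dis: "U \<inter> V = {}" using components_nonoverlap[of U "S2 - L" V] UV by auto
  have ne: "U \<noteq> {}" "V \<noteq> {}" using in_components_nonempty UV by blast+
  have "simply_connected U"
    by (rule simply_connected_complementary_disc[OF cL LS un dis ne op c g1 \<gamma>(3) im])
  moreover have "simply_connected V"
    by (rule simply_connected_complementary_disc[OF cL LS _ _ ne(2,1) op(2,1) c g1 \<gamma>(3) im]) (use un dis in auto)
  ultimately show thesis using that un LS dis ne op by blast
qed

text \<open>A short arc of the great circle through \<open>z\<close> and \<open>e\<close>; since
  \<open>z\<close> is at height 0, the point with parameter \<open>t\<close> has height
  \<open>sin t\<close>.\<close>

lemma arc_in_open:
  fixes z e :: "real^3"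
  assumes X: "openin (top_of_set S2) X" "z \<in> X" and e: "e \<bullet> e = 1" "e \<bullet> z = 0"
  obtains \<eta> where "\<eta> > 0" "\<And>t. \<bar>t\<bar> < \<eta> \<Longrightarrow> cos t *\<^sub>R z + sin t *\<^sub>R e \<in> X"
proof -
  obtain G where G: "open G" "X = S2 \<inter> G" using X(1) by (auto simp: openin_open)
  let ?P = "\<lambda>t::real. cos t *\<^sub>R z + sin t *\<^sub>R e"
  have "open (?P -` G)" by (intro open_vimage G continuous_intros)
  moreover have "0 \<in> ?P -` G" using X(2) G(2) by simp
  ultimately obtain \<eta> where \<eta>: "\<eta> > 0" "ball 0 \<eta> \<subseteq> ?P -` G" using open_contains_ball by blast
  have z: "z \<bullet> z = 1" using X(2) G(2) by (simp add: norm_eq_1)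
  have "norm (?P t) = 1" for t
    unfolding norm_eq_1 using e z
    by (simp add: inner_add_left inner_add_right inner_commute[of z e] flip: power2_eq_square)
  then have "?P t \<in> X" if "\<bar>t\<bar> < \<eta>" for t
    using \<eta>(2) that unfolding G(2) by (auto simp: subset_iff)
  with \<eta>(1) show thesis by (rule that)
qed

text \<open>Two vectors do not span the space, so some unit vector \<open>e\<close> is orthogonal to
  both. Placing \<open>p\<close> and \<open>q\<close> on the same level 0 makes heights of either
  sign available near each of them.\<close>

lemma exists_orthonormal_frame:
  fixes p q :: "real^3"
  assumes "p \<in> S2"
  obtains b e where "orthonormal_frame p b e" "e \<bullet> q = 0"
proof -
  have "dim {p, q} \<le> card {p, q}" by (rule dim_le_card') simp
  also have "\<dots> \<le> 2" by (cases "p = q") auto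
  finally have "dim {p, q} < DIM(real^3)" by simp
  then obtain e0 where e0: "e0 \<noteq> 0" "\<And>y. y \<in> span {p, q} \<Longrightarrow> orthogonal e0 y"
    by (rule orthogonal_to_subspace_exists) blast
  have o: "e0 \<bullet> p = 0" "e0 \<bullet> q = 0" using e0(2)[of p] e0(2)[of q] by (simp_all add: orthogonal_def span_base)
  define e where "e = e0 /\<^sub>R norm e0"
  have "norm e = 1" using e0(1) by (simp add: e_def)
  then have "e \<bullet> e = 1" by (simp only: norm_eq_1)
  moreover have "e \<bullet> p = 0" "e \<bullet> q = 0" using o by (simp_all add: e_def)
  ultimately have e: "e \<bullet> e = 1" "e \<bullet> p = 0" "e \<bullet> q = 0" by this+
  have p: "p \<bullet> p = 1" using assms by (simp add: norm_eq_1)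
  have "cross3 e p \<bullet> cross3 e p = (e \<bullet> e) * (p \<bullet> p) - (e \<bullet> p) * (e \<bullet> p)"
    by (simp add: cross3_def inner_vec_def sum_3 algebra_simps)
  then have "orthonormal_frame p (cross3 e p) e"
    using e p by unfold_locales (simp_all add: dot_cross_self inner_commute[of p e])
  with e(3) show thesis by (intro that)
qed

text \<open>Take \<open>p\<close> in \<open>U\<close> and \<open>q\<close> in \<open>V\<close> at
  height 0. Arcs of length \<open>\<tau>\<close> from \<open>p\<close> and \<open>\<tau> / 2\<close>
  from \<open>q\<close>, towards both poles, reach the heights \<open>- s < - r < r < s\<close>: the
  outer ones in \<open>U\<close>, the inner ones in \<open>V\<close>. Open slabs around these
  heights cut out the four sets, in the order that \<open>K_twist_phase\<close> demands.\<close>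

lemma twisting_frame:
  fixes U V :: "(real^3) set"
  assumes UV: "openin (top_of_set S2) U" "openin (top_of_set S2) V" "U \<noteq> {}" "V \<noteq> {}"
  obtains a b e U1 U2 V3 V4 and \<delta> :: real where "orthonormal_frame a b e"
    "openin (top_of_set S2) U1" "openin (top_of_set S2) U2" "openin (top_of_set S2) V3" "openin (top_of_set S2) V4"
    "U1 \<noteq> {}" "U2 \<noteq> {}" "V3 \<noteq> {}" "V4 \<noteq> {}" "U1 \<subseteq> U" "U2 \<subseteq> U" "V3 \<subseteq> V" "V4 \<subseteq> V" "0 < \<delta>"
    "\<forall>x1\<in>U1. \<forall>x2\<in>U2. \<forall>x3\<in>V3. \<forall>x4\<in>V4.
      -1 < e \<bullet> x1 \<and> e \<bullet> x1 < e \<bullet> x3 \<and> e \<bullet> x3 + \<delta> \<le> e \<bullet> x4 \<and> e \<bullet> x4 < e \<bullet> x2"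
proof -
  obtain p q where pq: "p \<in> U" "q \<in> V" using UV(3,4) by blast
  have pS: "p \<in> S2" using pq(1) openin_imp_subset[OF UV(1)] by (rule subsetD[rotated])
  obtain b e where fr: "orthonormal_frame p b e" and eq: "e \<bullet> q = 0"
    by (rule exists_orthonormal_frame[OF pS, of q]) blast
  have ee: "e \<bullet> e = 1" and ep: "e \<bullet> p = 0"
    using orthonormal_frame.unit(3)[OF fr] orthonormal_frame.orth(2)[OF fr] by (simp_all add: inner_commute)
  obtain \<eta>1 where \<eta>1: "\<eta>1 > 0" "\<And>t. \<bar>t\<bar> < \<eta>1 \<Longrightarrow> cos t *\<^sub>R p + sin t *\<^sub>R e \<in> U"
    by (rule arc_in_open[OF UV(1) pq(1) ee ep]) blast
  obtain \<eta>2 where \<eta>2: "\<eta>2 > 0" "\<And>t. \<bar>t\<bar> < \<eta>2 \<Longrightarrow> cos t *\<^sub>R q + sin t *\<^sub>R e \<in> V"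
    by (rule arc_in_open[OF UV(2) pq(2) ee eq]) blast
  \<comment> \<open>Halving keeps \<open>\<tau>\<close> strictly inside both arcs, and the minimum
    with 1 keeps it below \<open>pi / 2\<close>, where \<open>sin\<close> increases.\<close>
  define \<tau> where "\<tau> = min (min \<eta>1 \<eta>2) 1 / 2"
  have \<tau>: "0 < \<tau>" "\<tau> < \<eta>1" "\<tau> < \<eta>2" "\<tau> \<le> 1 / 2" using \<eta>1(1) \<eta>2(1) by (auto simp: \<tau>_def min_def)
  have pi: "3 < pi" by (rule pi_gt3)
  define r where "r = sin (\<tau> / 2)"
  define s where "s = sin \<tau>"
  \<comment> \<open>The midpoint separates the inner from the outer heights. The bounds at distance
    \<open>r / 2\<close> from level 0 are what leaves the gap \<open>\<delta> = r\<close> between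
    the two sets in \<open>V\<close>.\<close>
  define c where "c = (r + s) / 2"
  have r: "0 < r" unfolding r_def using \<tau> pi by (intro sin_gt_zero) auto
  have rs: "r < s" unfolding r_def s_def using \<tau> pi by (intro sin_monotone_2pi) auto
  have "s < sin (pi / 2)" unfolding s_def using \<tau> pi by (intro sin_monotone_2pi) auto
  then have s1: "s < 1" by simp
  have c: "r < c" "c < s" using rs by (auto simp: c_def)
  define H where "H l u = {x::real^3. l < e \<bullet> x \<and> e \<bullet> x < u}" for l u :: real
  have H: "open (H l u)" for l u
    unfolding H_def by (intro open_Collect_conj open_Collect_less continuous_intros)
  have hp: "e \<bullet> (cos t *\<^sub>R p + sin t *\<^sub>R e) = sin t" "e \<bullet> (cos t *\<^sub>R q + sin t *\<^sub>R e) = sin t" for t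
    using ee ep eq by (simp_all add: inner_add_right)
  have mU: "cos t *\<^sub>R p + sin t *\<^sub>R e \<in> U \<inter> H l u" if "\<bar>t\<bar> < \<eta>1" "l < sin t" "sin t < u" for t l u
    using \<eta>1(2)[OF that(1)] that(2,3) by (simp add: H_def hp)
  have mV: "cos t *\<^sub>R q + sin t *\<^sub>R e \<in> V \<inter> H l u" if "\<bar>t\<bar> < \<eta>2" "l < sin t" "sin t < u" for t l u
    using \<eta>2(2)[OF that(1)] that(2,3) by (simp add: H_def hp)
  note sn = sin_minus r_def[symmetric] s_def[symmetric]
  have m1: "cos (- \<tau>) *\<^sub>R p + sin (- \<tau>) *\<^sub>R e \<in> U \<inter> H (-1) (- c)"
  proof (rule mU)
    show "\<bar>- \<tau>\<bar> < \<eta>1" using \<tau> by simp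
    show "-1 < sin (- \<tau>)" unfolding sn using s1 by simp
    show "sin (- \<tau>) < - c" unfolding sn using c by simp
  qed
  have m2: "cos \<tau> *\<^sub>R p + sin \<tau> *\<^sub>R e \<in> U \<inter> H c 2"
  proof (rule mU)
    show "\<bar>\<tau>\<bar> < \<eta>1" using \<tau> by simp
    show "c < sin \<tau>" unfolding sn using c by simp
    show "sin \<tau> < 2" unfolding sn using s1 by simp
  qed
  have m3: "cos (- (\<tau> / 2)) *\<^sub>R q + sin (- (\<tau> / 2)) *\<^sub>R e \<in> V \<inter> H (- c) (- (r / 2))"
  proof (rule mV)
    show "\<bar>- (\<tau> / 2)\<bar> < \<eta>2" using \<tau> by simp
    show "- c < sin (- (\<tau> / 2))" unfolding sn using c by simp
    show "sin (- (\<tau> / 2)) < - (r / 2)" unfolding sn using r by simp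
  qed
  have m4: "cos (\<tau> / 2) *\<^sub>R q + sin (\<tau> / 2) *\<^sub>R e \<in> V \<inter> H (r / 2) c"
  proof (rule mV)
    show "\<bar>\<tau> / 2\<bar> < \<eta>2" using \<tau> by simp
    show "r / 2 < sin (\<tau> / 2)" unfolding sn using r by simp
    show "sin (\<tau> / 2) < c" unfolding sn using c by simp
  qed
  show thesis
  proof (rule that[OF fr])
    show "openin (top_of_set S2) (U \<inter> H (-1) (- c))" "openin (top_of_set S2) (U \<inter> H c 2)"
      "openin (top_of_set S2) (V \<inter> H (- c) (- (r / 2)))" "openin (top_of_set S2) (V \<inter> H (r / 2) c)"
      by (intro openin_Int_open UV H)+
    show "U \<inter> H (-1) (- c) \<noteq> {}" "U \<inter> H c 2 \<noteq> {}" "V \<inter> H (- c) (- (r / 2)) \<noteq> {}" "V \<inter> H (r / 2) c \<noteq> {}"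
      using m1 m2 m3 m4 by blast+
    show "0 < r" by (rule r)
    have "-1 < e \<bullet> x1 \<and> e \<bullet> x1 < e \<bullet> x3 \<and> e \<bullet> x3 + r \<le> e \<bullet> x4 \<and> e \<bullet> x4 < e \<bullet> x2"
      if "x1 \<in> U \<inter> H (-1) (- c)" "x2 \<in> U \<inter> H c 2" "x3 \<in> V \<inter> H (- c) (- (r / 2))" "x4 \<in> V \<inter> H (r / 2) c" for x1 x2 x3 x4
      using that unfolding H_def Int_iff mem_Collect_eq by linarith
    then show "\<forall>x1\<in>U \<inter> H (-1) (- c). \<forall>x2\<in>U \<inter> H c 2. \<forall>x3\<in>V \<inter> H (- c) (- (r / 2)). \<forall>x4\<in>V \<inter> H (r / 2) c.
      -1 < e \<bullet> x1 \<and> e \<bullet> x1 < e \<bullet> x3 \<and> e \<bullet> x3 + r \<le> e \<bullet> x4 \<and> e \<bullet> x4 < e \<bullet> x2"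
      by (intro ballI)
  qed blast+
qed

theorem proposition2:
  fixes \<rho> :: "real^3 \<Rightarrow> real^3 \<Rightarrow> real^3 \<Rightarrow> real" and L :: "(real^3) set"
  assumes "riemannian_metric \<rho>" and "equator L"
  shows "\<exists>(\<Phi> :: (real^3 \<Rightarrow> real^3) \<Rightarrow> real) (A::real) (B::real) (C::real) (D::real).
    (\<forall>f\<in>area_diffeos0. \<forall>g\<in>area_diffeos0.
       ereal \<bar>\<Phi> (compose S2 g f) - \<Phi> f - \<Phi> g\<bar> \<le> ereal C + ereal D * L1_norm \<rho> g) \<and>
    (\<forall>f\<in>area_diffeos0. \<bar>liminf_mean \<Phi> f\<bar> \<noteq> \<infinity>) \<and>
    (\<exists>f\<in>area_diffeos0. liminf_mean \<Phi> f \<noteq> 0) \<and>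
    (\<forall>h\<in>area_diffeos0. h ` L = L \<longrightarrow> \<bar>\<Phi> h\<bar> \<le> B \<and> liminf_mean \<Phi> h = 0) \<and>
    (\<forall>f\<in>area_diffeos0. ereal \<bar>\<Phi> f\<bar> \<le> ereal A * (L1_norm \<rho> f + 1))"
proof -
  obtain U V where L: "S2 - L = U \<union> V" "L \<subseteq> S2" and UV: "U \<inter> V = {}" "U \<noteq> {}" "V \<noteq> {}"
      "openin (top_of_set S2) U" "openin (top_of_set S2) V" "simply_connected U" "simply_connected V"
    by (rule equator_discs[OF assms(2)]) blast
  \<comment> \<open>The frame comes before the functional: \<open>K\<close>, \<open>W\<close> and
    \<open>Phi\<close> are built from it, and the twist that shows non-triviality turns about its
    axis.\<close>
  obtain a b e U1 U2 V3 V4 and \<delta> :: real where fr: "orthonormal_frame a b e"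
    and o: "openin (top_of_set S2) U1" "openin (top_of_set S2) U2" "openin (top_of_set S2) V3" "openin (top_of_set S2) V4"
    and ne: "U1 \<noteq> {}" "U2 \<noteq> {}" "V3 \<noteq> {}" "V4 \<noteq> {}"
    and sub: "U1 \<subseteq> U" "U2 \<subseteq> U" "V3 \<subseteq> V" "V4 \<subseteq> V" and \<delta>: "0 < \<delta>"
    and hts: "\<forall>x1\<in>U1. \<forall>x2\<in>U2. \<forall>x3\<in>V3. \<forall>x4\<in>V4.
      -1 < e \<bullet> x1 \<and> e \<bullet> x1 < e \<bullet> x3 \<and> e \<bullet> x3 + \<delta> \<le> e \<bullet> x4 \<and> e \<bullet> x4 < e \<bullet> x2"
    by (rule twisting_frame[OF UV(4,5,2,3)]) (rule that; assumption)
  interpret orthonormal_frame a b e by (rule fr)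
  interpret two_discs a b e U V by unfold_locales (fact UV)+
  obtain D where D: "D > 0"
    "\<And>\<phi> u. isotopy_from_id \<phi> \<Longrightarrow> u \<in> mp_homeos \<Longrightarrow> dW (compose S2 (\<phi> 1) u) u \<le> ennreal (D * L1_length \<rho> \<phi>)"
    "\<And>\<phi>. isotopy_from_id \<phi> \<Longrightarrow> 0 \<le> L1_length \<rho> \<phi>"
    by (rule dW_le_L1_length[OF assms(1)]) blast
  note mp = mp_homeos_of_area_diffeos0
  have b1: "ereal \<bar>Phi L (compose S2 g f) - Phi L f - Phi L g\<bar> \<le> ereal (2 * D) * L1_norm \<rho> g"
    if fm: "f \<in> mp_homeos" and gm: "g \<in> mp_homeos" for f g
  proof (rule Phi_bounds(1)[OF D(1) _ _ L(2) fm gm])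
    fix \<phi> u assume "isotopy_from_id \<phi>" "u \<in> mp_homeos"
    then show "dW (compose S2 (\<phi> 1) u) u \<le> ennreal (D * L1_length \<rho> \<phi>)" by (rule D(2))
  next
    fix \<phi> assume "isotopy_from_id \<phi>"
    then show "0 \<le> L1_length \<rho> \<phi>" by (rule D(3))
  qed
  have b2: "ereal \<bar>Phi L g\<bar> \<le> ereal D * L1_norm \<rho> g" if gm: "g \<in> mp_homeos" for g
  proof (rule Phi_bounds(2)[OF D(1) _ _ L(2) gm gm])
    fix \<phi> u assume "isotopy_from_id \<phi>" "u \<in> mp_homeos"
    then show "dW (compose S2 (\<phi> 1) u) u \<le> ennreal (D * L1_length \<rho> \<phi>)" by (rule D(2))
  next
    fix \<phi> assume "isotopy_from_id \<phi>"
    then show "0 \<le> L1_length \<rho> \<phi>" by (rule D(3))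
  qed
  show ?thesis
  \<comment> \<open>The witnesses for \<open>A, B, C, D\<close> are \<open>D, 0, 0, 2 * D\<close>:
    the quasi-additivity has no additive error, and \<open>Phi\<close> vanishes on the
    stabiliser.\<close>
  proof (rule exI[of _ "Phi L"], rule exI[of _ D], rule exI[of _ 0], rule exI[of _ 0], rule exI[of _ "2 * D"],
      intro conjI ballI impI)
    fix f g assume "f \<in> area_diffeos0" "g \<in> area_diffeos0"
    then show "ereal \<bar>Phi L (compose S2 g f) - Phi L f - Phi L g\<bar> \<le> ereal 0 + ereal (2 * D) * L1_norm \<rho> g"
      unfolding zero_ereal_def[symmetric] add_0 by (intro b1 mp)
  next
    fix f assume "f \<in> area_diffeos0"
    then show "\<bar>liminf_mean (Phi L) f\<bar> \<noteq> \<infinity>" by (intro liminf_mean_Phi_finite mp L)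
  next
    have "liminf_mean (Phi L) (twist 1) \<noteq> 0"
      by (rule liminf_mean_twist[OF L(2,1) o ne sub \<delta>]) (unfold ht_def, rule hts[rule_format])
    then show "\<exists>f\<in>area_diffeos0. liminf_mean (Phi L) f \<noteq> 0" using twist_in_area_diffeos0 by blast
  next
    fix h assume "h \<in> area_diffeos0" "h ` L = L"
    then have h: "h \<in> stabilizer L" using mp by (simp add: stabilizer_def)
    then show "\<bar>Phi L h\<bar> \<le> 0" by (simp add: Phi_stabilizer)
    show "liminf_mean (Phi L) h = 0" by (rule liminf_mean_Phi_stabilizer[OF h L(2)])
  next
    fix f assume "f \<in> area_diffeos0"
    then have "ereal \<bar>Phi L f\<bar> \<le> ereal D * L1_norm \<rho> f" by (intro b2 mp)
    also have "\<dots> \<le> ereal D * (L1_norm \<rho> f + 1)"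
      using D(1) by (intro ereal_mult_left_mono ereal_le_add_self) auto
    finally show "ereal \<bar>Phi L f\<bar> \<le> ereal D * (L1_norm \<rho> f + 1)" .
  qed
qed

end
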